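(* Let $\mathbb{M}$ be a Polish space. Suppose $(W'_0,X'_0)$ is a random element of $\mathbb{M}\times\mathbb{R}_+$ independent of an i.i.d. sequence $(W'_i,X'_i)_{i\ge 1}$ with values in $\mathbb{M}\times\mathbb{R}_+$, where $X'_1$ has a nonarithmetic distribution with a finite positive mean $\mu$ (and $W'_i$, $X'_i$ may be arbitrarily dependent on each other). Let $T'_i=\sum_{j=0}^i X'_j$, $i\ge 0$, let $\eta'=\sum_{i\ge 0}\delta_{(T'_i,W'_i)}$ be the corresponding delayed marked renewal process, and let $\eta$ be its stationary version. Then $$\theta_t\eta' \xrightarrow{d} \eta \qquad\text{as } t\to\infty,$$ where convergence in distribution is with respect to the vague topology on $M_p(\mathbb{R}\times\mathbb{M})$.
   Context: Notation: $\mathbb{R}_+=[0,\infty)$. A nonnegative random variable is nonarithmetic if its law is not concentrated on $h\mathbb{Z}$ for any $h>0$. Point measures and vague topology: a set $B\subseteq\mathbb{R}\times\mathbb{M}$ is called bounded if $B\subseteq[-h,h]\times\mathbb{M}$ for some $h>0$. $M_p(\mathbb{R}\times\mathbb{M})$ is the space of point measures on $\mathbb{R}\times\mathbb{M}$ that are finite on all bounded (Borel) sets. $m_n$ converges vaguely to $m$ in $M_p(\mathbb{R}\times\mathbb{M})$ if $\int f\,dm_n\to\int f\,dm$ for all continuous bounded $f:\mathbb{R}\times\mathbb{M}\to\mathbb{R}$ with bounded support (that is, with support contained in $[-h,h]\times\mathbb{M}$ for some $h>0$). For $t\in\mathbb{R}$ the shifted measure $\theta_t m$ is defined by $\theta_t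 m(A\times B)=m((A+t)\times B)$ for Borel $A\subseteq\mathbb{R}$, $B\subseteq\mathbb{M}$. Stationary version $\eta$: let $(\widetilde W_i,\widetilde X_i)_{i\in\mathbb{Z}\setminus\{0\}}$ be i.i.d. copies of $(W'_1,X'_1)$. Let $(W^*,X^* )$ be a random element of $\mathbb{M}\times\mathbb{R}_+$, independent of this family, with the size-biased law $\mathbb{E}f(W^*,X^* )=\frac1\mu\mathbb{E}[X'_1 f(W'_1,X'_1)]$ for all bounded measurable real-valued $f$. Let $U$ be uniform on $[0,1]$, independent of everything else. Put $T_0=UX^*$, $T_{-1}=-(1-U)X^*$, and for $i\ge 1$, $T_i=T_0+\sum_{j=1}^i\widetilde X_j$ and $T_{-(i+1)}=T_{-1}-\sum_{j=-i}^{-1}\widetilde X_j$. Put $W_0=W^*$ and $W_i=\widetilde W_i$ for $i\ne 0$. Then $\eta=\sum_{i\in\mathbb{Z}}\delta_{(T_i,W_i)}$. *)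

theory Defs
  imports "HOL-Probability.Probability"
begin

definition nonarithmetic :: "real measure \<Rightarrow> bool" where
  "nonarithmetic D \<longleftrightarrow> (\<forall>h>0. \<not> (AE x in D. \<exists>k::int. x = of_int k * h))"


subsection \<open>Point measures and the vague topology\<close>

definition strip_bounded :: "(real \<times> 'm) set \<Rightarrow> bool" where
  "strip_bounded B \<longleftrightarrow> (\<exists>h>0. B \<subseteq> {-h..h} \<times> UNIV)"

text \<open>The sum of the Dirac masses at the points \<open>x i\<close>, \<open>i \<in> I\<close>, counted with multiplicity, written as
  the image of the counting measure on \<open>I\<close>.\<close>

definition dirac_sum :: "'i set \<Rightarrow> ('i \<Rightarrow> 's::topological_space) \<Rightarrow> 's measure" where
  "dirac_sum I x = distr (count_space I) borel x"

lemma emeasure_dirac_sum: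
  assumes "A \<in> sets borel"
  shows "emeasure (dirac_sum I x) A = (\<integral>\<^sup>+ i. emeasure (return borel (x i)) A \<partial>count_space I)"
proof -
  have "emeasure (dirac_sum I x) A = emeasure (count_space I) (x -` A \<inter> I)"
    using assms by (simp add: dirac_sum_def emeasure_distr)
  also have "\<dots> = (\<integral>\<^sup>+ i. indicator (x -` A \<inter> I) i \<partial>count_space I)"
    by (simp add: nn_integral_indicator)
  also have "\<dots> = (\<integral>\<^sup>+ i. emeasure (return borel (x i)) A \<partial>count_space I)"
    using assms by (intro nn_integral_cong) (auto simp: indicator_def)
  finally show ?thesis .
qed

definition point_measures :: "(real \<times> 'm::topological_space) measure set" where
  "point_measures = {m. (\<exists>(I::nat set) x. m = dirac_sum I x) \<and>
     (\<forall>B\<in>sets borel. strip_bounded B \<longrightarrow> emeasure m B < \<infinity>)}"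

definition vague_test :: "(real \<times> 'm::topological_space \<Rightarrow> real) set" where
  "vague_test = {f. continuous_on UNIV f \<and> bounded (range f) \<and> strip_bounded {z. f z \<noteq> 0}}"

text \<open>The coarsest topology on the point measures that makes all maps \<open>m \<mapsto> \<integral>f dm\<close>, \<open>f\<close> a test
  function, continuous.\<close>

definition vague_topology :: "(real \<times> 'm::topological_space) measure topology" where
  "vague_topology = topology_generated_by
     {{m \<in> point_measures. (\<integral>z. f z \<partial>m) \<in> V} | f V. f \<in> vague_test \<and> open V}"

lemma topspace_vague_topology: "topspace vague_topology = point_measures"
proof -
  have "(\<lambda>_. 0) \<in> vague_test"
    by (auto simp: vague_test_def strip_bounded_def intro: exI[of _ 1])
  then have "point_measures \<in> {{m \<in> point_measures. (\<integral>z. f z \<partial>m) \<in> V} | f V. f \<in> vague_test \<and> open (V::real set)}"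
    by (intro CollectI exI[of _ "\<lambda>_. 0"] exI[of _ UNIV]) auto
  then show ?thesis
    unfolding vague_topology_def topology_generated_by_topspace by blast
qed

lemma limitin_vague_topology:
  assumes "\<And>n. m n \<in> point_measures" "l \<in> point_measures"
  shows "limitin vague_topology m l sequentially \<longleftrightarrow>
    (\<forall>f\<in>vague_test. (\<lambda>n. \<integral>z. f z \<partial>m n) \<longlonglongrightarrow> (\<integral>z. f z \<partial>l))"
proof
  assume lim: "limitin vague_topology m l sequentially"
  show "\<forall>f\<in>vague_test. (\<lambda>n. \<integral>z. f z \<partial>m n) \<longlonglongrightarrow> (\<integral>z. f z \<partial>l)"
  proof (intro ballI topological_tendstoI)
    fix f :: "real \<times> 'a \<Rightarrow> real" and V :: "real set"
    assume f: "f \<in> vague_test" and V: "open V" "(\<integral>z. f z \<partial>l) \<in> V"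
    have "openin vague_topology {m \<in> point_measures. (\<integral>z. f z \<partial>m) \<in> V}"
      unfolding vague_topology_def using f V(1) by (intro topology_generated_by_Basis) blast
    with lim assms(2) V(2) have "\<forall>\<^sub>F n in sequentially. m n \<in> {m \<in> point_measures. (\<integral>z. f z \<partial>m) \<in> V}"
      unfolding limitin_def by blast
    then show "\<forall>\<^sub>F n in sequentially. (\<integral>z. f z \<partial>m n) \<in> V"
      by eventually_elim auto
  qed
next
  assume *: "\<forall>f\<in>vague_test. (\<lambda>n. \<integral>z. f z \<partial>m n) \<longlonglongrightarrow> (\<integral>z. f z \<partial>l)"
  have "l \<in> U \<longrightarrow> (\<forall>\<^sub>F n in sequentially. m n \<in> U)"
    if "generate_topology_on {{m \<in> point_measures. (\<integral>z. f z \<partial>m) \<in> V} | f V. f \<in> vague_test \<and> open V} U" for U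
    using that
  proof induction
    case Empty
    then show ?case by simp
  next
    case (Int a b)
    then show ?case by (auto simp: eventually_conj_iff)
  next
    case (UN K)
    then show ?case by (fastforce elim: eventually_mono)
  next
    case (Basis s)
    then obtain f V where s: "s = {m \<in> point_measures. (\<integral>z. f z \<partial>m) \<in> V}" "f \<in> vague_test" "open V"
      by blast
    show ?case
    proof
      assume "l \<in> s"
      with s * have "\<forall>\<^sub>F n in sequentially. (\<integral>z. f z \<partial>m n) \<in> V"
        by (auto intro: topological_tendstoD)
      then show "\<forall>\<^sub>F n in sequentially. m n \<in> s"
        using assms(1) s(1) by (auto elim: eventually_mono)
    qed
  qed
  then show "limitin vague_topology m l sequentially"
    using assms(2) by (auto simp: limitin_def topspace_vague_topology)
      (auto simp: vague_topology_def openin_topology_generated_by_iff)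
qed

definition shift_measure :: "real \<Rightarrow> (real \<times> 'm::topological_space) measure \<Rightarrow> (real \<times> 'm) measure" where
  "shift_measure t m = distr m borel (\<lambda>(s, w). (s - t, w))"

lemma emeasure_shift_measure:
  fixes m :: "(real \<times> 'm::second_countable_topology) measure"
  assumes "sets m = sets borel" "A \<in> sets borel" "B \<in> sets borel"
  shows "emeasure (shift_measure t m) (A \<times> B) = emeasure m (((\<lambda>s. s + t) ` A) \<times> B)"
proof -
  have "(\<lambda>(s, w). (s - t, w)) \<in> borel_measurable (borel :: (real \<times> 'm) measure)"
    by (intro borel_measurable_continuous_onI) (auto simp: case_prod_beta intro!: continuous_intros)
  then have meas: "(\<lambda>(s, w). (s - t, w)) \<in> measurable m borel"
    using measurable_cong_sets[OF assms(1) refl] by blast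
  have AB: "A \<times> B \<in> sets borel"
    using assms(2,3) by (simp flip: borel_prod)
  have sp: "space m = UNIV"
    using sets_eq_imp_space_eq[OF assms(1)] by simp
  have "(\<lambda>(s, w). (s - t, w)) -` (A \<times> B) \<inter> space m = ((\<lambda>s. s + t) ` A) \<times> B"
    using sp by (force simp: image_iff)
  then show ?thesis
    unfolding shift_measure_def using emeasure_distr[OF meas AB] by simp
qed


subsection \<open>Convergence in distribution in a topological space\<close>

definition borel_algebra :: "'s topology \<Rightarrow> 's measure" where
  "borel_algebra S = sigma (topspace S) {G. openin S G}"

text \<open>The measurability conjuncts say that all maps involved are random elements of the space; they also
  guarantee that the expectations below are those of measurable bounded functions.\<close>

definition converges_in_distribution ::
  "'s topology \<Rightarrow> 'a measure \<Rightarrow> ('t \<Rightarrow> 'a \<Rightarrow> 's) \<Rightarrow> 'b measure \<Rightarrow> ('b \<Rightarrow> 's) \<Rightarrow> 't filter \<Rightarrow> bool" where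
  "converges_in_distribution S P \<xi> N \<zeta> F \<longleftrightarrow>
     (\<forall>t. \<xi> t \<in> measurable P (borel_algebra S)) \<and> \<zeta> \<in> measurable N (borel_algebra S) \<and>
     (\<forall>\<phi>. continuous_map S euclideanreal \<phi> \<and> bounded (\<phi> ` topspace S) \<longrightarrow>
        ((\<lambda>t. \<integral>\<omega>. \<phi> (\<xi> t \<omega>) \<partial>P) \<longlongrightarrow> (\<integral>\<omega>. \<phi> (\<zeta> \<omega>) \<partial>N)) F)"


subsection \<open>Marked renewal processes\<close>

text \<open>A renewal process is locally finite only almost surely. To have a random element of
  \<^const>\<open>point_measures\<close>, the sum of Dirac masses is replaced by the zero measure on the exceptional
  null event.\<close>

definition point_process :: "'i set \<Rightarrow> ('i \<Rightarrow> real \<times> 'm::topological_space) \<Rightarrow> (real \<times> 'm) measure" where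
  "point_process I x = (if dirac_sum I x \<in> point_measures then dirac_sum I x else null_measure borel)"

lemma null_measure_in_point_measures: "null_measure borel \<in> point_measures"
proof -
  have "null_measure borel = dirac_sum ({}::nat set) (x :: nat \<Rightarrow> real \<times> 'a)" for x
    by (intro measure_eqI) (auto simp: dirac_sum_def emeasure_distr)
  then show ?thesis
    unfolding point_measures_def by auto
qed

definition delayed_renewal :: "(nat \<Rightarrow> 'm) \<Rightarrow> (nat \<Rightarrow> real) \<Rightarrow> (real \<times> 'm::topological_space) measure" where
  "delayed_renewal w x = point_process UNIV (\<lambda>i. (\<Sum>j\<le>i. x j, w i))"

text \<open>The points \<open>T\<^sub>i\<close> of the stationary version, given \<open>U = u\<close>, \<open>X\<^sup>* = xs\<close> and the two-sided family \<open>x\<close>,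
  whose value at \<open>0\<close> is not used. For \<open>k = -(i + 1)\<close> the lower summation index \<open>-i\<close> is \<open>k + 1\<close>.\<close>

definition stationary_point :: "real \<Rightarrow> real \<Rightarrow> (int \<Rightarrow> real) \<Rightarrow> int \<Rightarrow> real" where
  "stationary_point u xs x k =
     (if k \<ge> 0 then u * xs + (\<Sum>j\<in>{1..k}. x j)
      else - ((1 - u) * xs) - (\<Sum>j\<in>{k+1..-1}. x j))"

definition stationary_renewal ::
  "real \<Rightarrow> 'm \<Rightarrow> real \<Rightarrow> (int \<Rightarrow> 'm) \<Rightarrow> (int \<Rightarrow> real) \<Rightarrow> (real \<times> 'm::topological_space) measure" where
  "stationary_renewal u ws xs w x =
     point_process UNIV (\<lambda>k. (stationary_point u xs x k, if k = 0 then ws else w k))"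

end

theory Submission
  imports Defs
begin

text \<open>
  Up to a constant, a vaguely continuous bounded function of a point measure is a supremum of maxima of tents,
  each built from finitely many integrals of test functions (\<open>converges_in_distribution_by_tents\<close>).
  Such a maximum \<open>\<Phi>\<close> sees only the points in a bounded time window, and a small shift changes it by at most a multiple of the shift
  and of the number of points near the window (\<open>windowed_maxl\<close>). It remains to show that the mean of \<open>\<Phi>\<close>,
  observed from time \<open>t\<close>, converges to its mean for the stationary process.

  Let \<open>H t\<close> be this mean for the process in which all pairs, including the first, are identically
  distributed. The expected number of renewals in an interval is bounded in terms of its length
  (\<open>expected_renewals_bound\<close>), so \<open>H\<close> is Lipschitz. Conditioning on the first pair shows that
  \<open>H t\<close> is, up to an error that vanishes as \<open>t\<close> grows, the mean of \<open>H (t - X)\<close>. For a nonarithmetic \<open>X\<close> this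
  forces \<open>H (t + s) - H t\<close> to tend to \<open>0\<close> for each \<open>s\<close> (\<open>asymptotic_shift_invariance\<close>), an asymptotic form of the
  theorem of Choquet and Deny that bounded continuous harmonic functions are constant. A delay therefore
  changes the mean by a quantity that tends to \<open>0\<close>, whatever its law (\<open>delay_forgotten\<close>).

  To find the limit, the stationary process is compared with the others. To the right of the origin it is a
  renewal process too, with its own delay, so in the limit it has the same mean as they do. But its mean does
  not depend on \<open>t\<close> at all (\<open>stationary_mean_const\<close>): a uniform point in a size-biased interval amounts to
  Lebesgue measure on the interval of index \<open>0\<close> of a two-sided independent sequence, and relabelling the
  intervals preserves the law of that sequence. Hence all the means converge to the stationary one
  (\<open>delayed_mean_tendsto_stationary_mean\<close>).
\<close>

section \<open>Convergence of integrals from approximation by tents\<close>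

text \<open>A tent of height \<open>c\<close> and radius \<open>r\<close>, as a function of the distance to its centre. The value \<open>0\<close> for
  \<open>r \<le> 0\<close> or \<open>c \<le> 0\<close> lets all pairs of rationals serve as indices.\<close>

definition tent :: "real \<Rightarrow> real \<Rightarrow> real \<Rightarrow> real" where
  "tent d r c = (if r > 0 \<and> c > 0 then c * max 0 (1 - d / r) else 0)"

lemma tent_nonneg: "0 \<le> tent d r c"
  by (simp add: tent_def)

lemma tent_le: "0 \<le> d \<Longrightarrow> tent d r c \<le> max 0 c"
  by (auto simp: tent_def max_def mult_left_le)

lemma tent_eq_0: "r \<le> d \<Longrightarrow> tent d r c = 0"
  by (auto simp: tent_def max_def field_simps)

lemma tent_lipschitz: "\<bar>tent d r c - tent d' r c\<bar> \<le> \<bar>c / r\<bar> * \<bar>d - d'\<bar>"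
proof (cases "r > 0 \<and> c > 0")
  case True
  have "\<bar>max 0 (1 - d / r) - max 0 (1 - d' / r)\<bar> \<le> \<bar>d / r - d' / r\<bar>"
    by (auto simp: max_def)
  also have "\<dots> = \<bar>d - d'\<bar> / r"
    using True by (simp flip: diff_divide_distrib)
  finally have "c * \<bar>max 0 (1 - d / r) - max 0 (1 - d' / r)\<bar> \<le> c * (\<bar>d - d'\<bar> / r)"
    using True by (intro mult_left_mono) auto
  moreover have "\<bar>tent d r c - tent d' r c\<bar> = c * \<bar>max 0 (1 - d / r) - max 0 (1 - d' / r)\<bar>"
    using True by (simp add: tent_def abs_mult flip: right_diff_distrib)
  ultimately show ?thesis
    using True by simp
qed (auto simp: tent_def)

lemma tent_measurable [measurable]:
  assumes "d \<in> borel_measurable M"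
  shows "(\<lambda>z. tent (d z) r c) \<in> borel_measurable M"
  using assms unfolding tent_def by simp

definition maxl :: "('j \<Rightarrow> 's \<Rightarrow> real) \<Rightarrow> 'j list \<Rightarrow> 's \<Rightarrow> real" where
  "maxl b L z = foldr (\<lambda>j. max (b j z)) L 0"

lemma maxl_simps [simp]: "maxl b [] z = 0" "maxl b (j # L) z = max (b j z) (maxl b L z)"
  by (simp_all add: maxl_def)

lemma maxl_nonneg: "0 \<le> maxl b L z"
  by (induction L) auto

lemma maxl_ge: "j \<in> set L \<Longrightarrow> b j z \<le> maxl b L z"
  by (induction L) auto

lemma maxl_le: "0 \<le> B \<Longrightarrow> (\<And>j. j \<in> set L \<Longrightarrow> b j z \<le> B) \<Longrightarrow> maxl b L z \<le> B"
  by (induction L) auto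

lemma maxl_measurable [measurable]:
  assumes "\<And>j. b j \<in> borel_measurable M"
  shows "maxl b L \<in> borel_measurable M"
proof (induction L)
  case Nil
  have "maxl b [] = (\<lambda>_. 0)" by auto
  then show ?case by simp
next
  case (Cons j L)
  have "maxl b (j # L) = (\<lambda>z. max (b j z) (maxl b L z))" by auto
  then show ?case using Cons assms by simp
qed

abbreviation tents :: "('j \<Rightarrow> 's \<Rightarrow> real) \<Rightarrow> 'j \<times> rat \<times> rat \<Rightarrow> 's \<Rightarrow> real" where
  "tents d \<equiv> (\<lambda>(j, r, c) z. tent (d j z) (of_rat r) (of_rat c))"

lemma tents_measurable [measurable]:
  assumes "\<And>j. d j \<in> borel_measurable M"
  shows "tents d i \<in> borel_measurable M"
  using assms by (cases i) (simp, measurable)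

text \<open>Lower semicontinuity with respect to pseudo-distances \<open>d j\<close> to centres \<open>j\<close>. The triangle inequality is
  hidden in \<open>d j z + d j z'\<close>, which bounds the distance from \<open>z\<close> to \<open>z'\<close>; the centres need not be points
  of the space, and the pseudo-metric may depend on the centre.\<close>

definition lsc_near :: "('j \<Rightarrow> 's \<Rightarrow> real) \<Rightarrow> 's set \<Rightarrow> ('s \<Rightarrow> real) \<Rightarrow> bool" where
  "lsc_near d S \<phi> \<longleftrightarrow> (\<forall>z\<in>S. \<forall>c<\<phi> z. \<exists>\<epsilon>>0. \<forall>\<delta>>0. \<exists>j. d j z < \<delta> \<and>
      (\<forall>z'\<in>S. d j z + d j z' < \<epsilon> \<longrightarrow> c < \<phi> z'))"

lemma tent_below:
  assumes lsc: "lsc_near d S \<phi>" and nonneg: "\<And>z. z \<in> S \<Longrightarrow> 0 \<le> \<phi> z" "\<And>j z. 0 \<le> d j z"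
    and z: "z \<in> S" and c: "0 \<le> c" "c < \<phi> z"
  shows "\<exists>i. c < tents d i z \<and> (\<forall>z'\<in>S. tents d i z' \<le> \<phi> z')"
proof -
  obtain q where q: "c < of_rat q" "of_rat q < \<phi> z"
    using of_rat_dense[OF c(2)] by blast
  obtain \<epsilon> where \<epsilon>: "\<epsilon> > 0"
    "\<And>\<delta>. \<delta> > 0 \<Longrightarrow> \<exists>j. d j z < \<delta> \<and> (\<forall>z'\<in>S. d j z + d j z' < \<epsilon> \<longrightarrow> of_rat q < \<phi> z')"
    using lsc z q(2) unfolding lsc_near_def by blast
  obtain r where r: "0 < (of_rat r :: real)" "of_rat r < \<epsilon> / 2"
    using of_rat_dense[of 0 "\<epsilon> / 2"] \<epsilon>(1) by auto
  have q0: "0 < (of_rat q :: real)"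
    using c q by linarith
  \<comment> \<open>A centre this close to \<open>z\<close> makes the tent of height \<open>q\<close> exceed \<open>c\<close> at \<open>z\<close>.\<close>
  have "0 < of_rat r * (1 - c / of_rat q)"
    using r q q0 by simp
  from \<epsilon>(2)[OF this] obtain j where j: "d j z < of_rat r * (1 - c / of_rat q)"
    "\<And>z'. z' \<in> S \<Longrightarrow> d j z + d j z' < \<epsilon> \<Longrightarrow> of_rat q < \<phi> z'"
    by blast
  have dr: "d j z < of_rat r"
  proof -
    have "of_rat r * (1 - c / of_rat q) \<le> of_rat r * 1"
      using r q0 c by (intro mult_left_mono) auto
    then show ?thesis using j(1) by simp
  qed
  have "d j z / of_rat r < 1 - c / of_rat q"
    using j(1) r(1) by (simp add: field_simps)
  then have "c < of_rat q * (1 - d j z / of_rat r)"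
    using q0 by (simp add: field_simps)
  then have 1: "c < tent (d j z) (of_rat r) (of_rat q)"
    using r q0 dr by (simp add: tent_def max_def)
  have "tent (d j z') (of_rat r) (of_rat q) \<le> \<phi> z'" if "z' \<in> S" for z'
  proof (cases "d j z' < of_rat r")
    case True
    then have "of_rat q < \<phi> z'"
      using dr r(2) that by (intro j(2)) auto
    then show ?thesis
      using tent_le[of "d j z'" "of_rat r" "of_rat q"] nonneg(2) q0 by (smt (verit))
  next
    case False
    then show ?thesis
      using tent_eq_0[of "of_rat r" "d j z'" "of_rat q"] nonneg(1)[OF that] by simp
  qed
  with 1 show ?thesis
    by (intro exI[of _ "(j, r, q)"]) auto
qed

text \<open>Countably many tents lie below \<open>\<phi>\<close> and have it as supremum; their finite maxima increase to it.
  This gives the lower half of the convergence of integrals.\<close>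

lemma eventually_integral_greater:
  fixes M :: "'t \<Rightarrow> 's measure" and d :: "'j::countable \<Rightarrow> 's \<Rightarrow> real"
  assumes sp: "\<And>t. space (M t) = S" "space N = S"
    and meas: "\<And>t j. d j \<in> borel_measurable (M t)" "\<And>j. d j \<in> borel_measurable N"
    and dpos: "\<And>j z. 0 \<le> d j z"
    and int: "\<And>t. integrable (M t) \<phi>" "integrable N \<phi>"
    and lsc: "lsc_near d S \<phi>" and nonneg: "\<And>z. z \<in> S \<Longrightarrow> 0 \<le> \<phi> z"
    and conv: "\<And>L. ((\<lambda>t. \<integral>z. maxl (tents d) L z \<partial>M t) \<longlongrightarrow> (\<integral>z. maxl (tents d) L z \<partial>N)) F"
    and e: "e < (\<integral>z. \<phi> z \<partial>N)"
  shows "\<forall>\<^sub>F t in F. e < (\<integral>z. \<phi> z \<partial>M t)"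
proof -
  define good where "good i \<longleftrightarrow> (\<forall>z\<in>S. tents d i z \<le> \<phi> z)" for i
  define L where "L n = filter good (map from_nat [0..<n])" for n
  have le: "maxl (tents d) (L n) z \<le> \<phi> z" if "z \<in> S" for n z
    using that nonneg by (intro maxl_le) (auto simp: L_def good_def)
  have [measurable]: "maxl (tents d) K \<in> borel_measurable N" "maxl (tents d) K \<in> borel_measurable (M t)" for t K
    using meas by measurable
  have lim: "(\<lambda>n. maxl (tents d) (L n) z) \<longlonglongrightarrow> \<phi> z" if z: "z \<in> S" for z
  proof (rule increasing_tendsto)
    show "\<forall>\<^sub>F n in sequentially. maxl (tents d) (L n) z \<le> \<phi> z"
      using le[OF z] by simp
    fix c assume "c < \<phi> z"
    show "\<forall>\<^sub>F n in sequentially. c < maxl (tents d) (L n) z"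
    proof (cases "c < 0")
      case True
      then show ?thesis
        by (intro always_eventually allI) (meson maxl_nonneg order_less_le_trans)
    next
      case False
      then obtain i where i: "c < tents d i z" "good i"
        using tent_below[OF lsc nonneg dpos z _ \<open>c < \<phi> z\<close>] by (auto simp: good_def)
      have "i \<in> set (L n)" if "n > to_nat i" for n
        using that i(2) unfolding L_def by (auto intro!: image_eqI[of _ _ "to_nat i"])
      then have "c < maxl (tents d) (L n) z" if "n > to_nat i" for n
        using that i(1) maxl_ge[of i "L n" "tents d" z] by force
      then show ?thesis
        using eventually_gt_at_top[of "to_nat i"] by (rule eventually_mono[rotated])
    qed
  qed
  have "(\<lambda>n. \<integral>z. maxl (tents d) (L n) z \<partial>N) \<longlonglongrightarrow> (\<integral>z. \<phi> z \<partial>N)"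
  proof (rule integral_dominated_convergence)
    show "AE z in N. (\<lambda>n. maxl (tents d) (L n) z) \<longlonglongrightarrow> \<phi> z"
      using lim sp by auto
    show "AE z in N. norm (maxl (tents d) (L n) z) \<le> \<phi> z" for n
      using le sp(2) by (intro AE_I2) (simp add: abs_of_nonneg[OF maxl_nonneg])
  qed (use int in auto)
  then have "\<forall>\<^sub>F n in sequentially. e < (\<integral>z. maxl (tents d) (L n) z \<partial>N)"
    using e by (rule order_tendstoD)
  then obtain n where "e < (\<integral>z. maxl (tents d) (L n) z \<partial>N)"
    by (auto dest: eventually_happens)
  with conv have "\<forall>\<^sub>F t in F. e < (\<integral>z. maxl (tents d) (L n) z \<partial>M t)"
    by (rule order_tendstoD)
  then show ?thesis
  proof eventually_elim
    case (elim t)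
    have "(\<integral>z. maxl (tents d) (L n) z \<partial>M t) \<le> (\<integral>z. \<phi> z \<partial>M t)"
    proof (rule integral_mono)
      show "integrable (M t) (maxl (tents d) (L n))"
        by (rule Bochner_Integration.integrable_bound[OF int(1)])
          (use le nonneg sp in \<open>auto intro!: AE_I2 simp: abs_of_nonneg[OF maxl_nonneg]\<close>)
    qed (use int le sp in auto)
    with elim show ?case by simp
  qed
qed

text \<open>The lower bound for \<open>\<phi>\<close> and the one for \<open>\<kappa> - \<phi>\<close> are the two halves of the convergence. Here \<open>M t\<close> and
  \<open>N\<close> will be point measures, and later on laws of random point measures.\<close>

lemma tendsto_integral_by_tents:
  fixes M :: "'t \<Rightarrow> 's measure" and d :: "'j::countable \<Rightarrow> 's \<Rightarrow> real"
  assumes sp: "\<And>t. space (M t) = S" "space N = S"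
    and meas: "\<And>t j. d j \<in> borel_measurable (M t)" "\<And>j. d j \<in> borel_measurable N"
    and dpos: "\<And>j z. 0 \<le> d j z"
    and int: "\<And>t. integrable (M t) \<phi>" "integrable N \<phi>" "\<And>t. integrable (M t) \<kappa>" "integrable N \<kappa>"
    and lsc: "lsc_near d S \<phi>" "lsc_near d S (\<lambda>z. \<kappa> z - \<phi> z)"
    and bounds: "\<And>z. z \<in> S \<Longrightarrow> 0 \<le> \<phi> z" "\<And>z. z \<in> S \<Longrightarrow> \<phi> z \<le> \<kappa> z"
    and conv: "\<And>L. ((\<lambda>t. \<integral>z. maxl (tents d) L z \<partial>M t) \<longlongrightarrow> (\<integral>z. maxl (tents d) L z \<partial>N)) F"
    and conv\<kappa>: "((\<lambda>t. \<integral>z. \<kappa> z \<partial>M t) \<longlongrightarrow> (\<integral>z. \<kappa> z \<partial>N)) F"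
  shows "((\<lambda>t. \<integral>z. \<phi> z \<partial>M t) \<longlongrightarrow> (\<integral>z. \<phi> z \<partial>N)) F"
proof (rule order_tendstoI)
  fix e assume "e < (\<integral>z. \<phi> z \<partial>N)"
  then show "\<forall>\<^sub>F t in F. e < (\<integral>z. \<phi> z \<partial>M t)"
    using eventually_integral_greater[OF sp meas dpos int(1,2) lsc(1) bounds(1) conv] by blast
next
  fix e assume e: "(\<integral>z. \<phi> z \<partial>N) < e"
  define \<gamma> where "\<gamma> = (e - (\<integral>z. \<phi> z \<partial>N)) / 2"
  have \<gamma>: "\<gamma> > 0" "e = (\<integral>z. \<phi> z \<partial>N) + 2 * \<gamma>"
    using e by (simp_all add: \<gamma>_def field_simps)
  have N: "(\<integral>z. \<kappa> z - \<phi> z \<partial>N) = (\<integral>z. \<kappa> z \<partial>N) - (\<integral>z. \<phi> z \<partial>N)"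
    and M: "(\<integral>z. \<kappa> z - \<phi> z \<partial>M t) = (\<integral>z. \<kappa> z \<partial>M t) - (\<integral>z. \<phi> z \<partial>M t)" for t
    using int by simp_all
  have "\<forall>\<^sub>F t in F. (\<integral>z. \<kappa> z - \<phi> z \<partial>N) - \<gamma> < (\<integral>z. \<kappa> z - \<phi> z \<partial>M t)"
    by (rule eventually_integral_greater[OF sp meas dpos _ _ lsc(2) _ conv])
      (use int bounds \<gamma> in auto)
  moreover have "\<forall>\<^sub>F t in F. (\<integral>z. \<kappa> z \<partial>M t) < (\<integral>z. \<kappa> z \<partial>N) + \<gamma>"
    using conv\<kappa> by (rule order_tendstoD) (use \<gamma> in auto)
  ultimately show "\<forall>\<^sub>F t in F. (\<integral>z. \<phi> z \<partial>M t) < e"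
    by eventually_elim (use M N \<gamma> in auto)
qed

section \<open>The vague topology has a countable base\<close>

definition dense_pt :: "nat \<Rightarrow> 'a::second_countable_topology" where
  "dense_pt = from_nat_into (SOME D. countable D \<and> (\<forall>X. open X \<longrightarrow> X \<noteq> {} \<longrightarrow> (\<exists>d\<in>D. d \<in> X)))"

lemma dense_pt:
  assumes "open (X :: 'a::second_countable_topology set)" "X \<noteq> {}"
  shows "\<exists>n. dense_pt n \<in> X"
proof -
  define D where "D = (SOME D. countable D \<and> (\<forall>X::'a set. open X \<longrightarrow> X \<noteq> {} \<longrightarrow> (\<exists>d\<in>D. d \<in> X)))"
  have D: "countable D \<and> (\<forall>X::'a set. open X \<longrightarrow> X \<noteq> {} \<longrightarrow> (\<exists>d\<in>D. d \<in> X))"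
    unfolding D_def using countable_dense_exists by (rule someI_ex)
  with assms obtain d where d: "d \<in> D" "d \<in> X"
    by blast
  from from_nat_into_surj[of D d] D d(1) obtain n where "from_nat_into D n = d"
    by blast
  with d(2) show ?thesis
    by (intro exI[of _ n]) (simp add: dense_pt_def flip: D_def)
qed

abbreviation pt_dist :: "nat \<Rightarrow> 'a::{metric_space, second_countable_topology} \<Rightarrow> real" where
  "pt_dist j z \<equiv> dist z (dense_pt j)"

lemma lsc_near_continuous:
  fixes \<phi> :: "'a::{metric_space, second_countable_topology} \<Rightarrow> real"
  assumes "continuous_on UNIV \<phi>"
  shows "lsc_near pt_dist UNIV \<phi>"
  unfolding lsc_near_def
proof (intro ballI allI impI)
  fix z c assume "c < \<phi> z"
  have "open (\<phi> -` {c<..})"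
    using assms by (intro open_vimage) auto
  then obtain \<epsilon> where \<epsilon>: "\<epsilon> > 0" "ball z \<epsilon> \<subseteq> \<phi> -` {c<..}"
    using \<open>c < \<phi> z\<close> by (metis greaterThan_iff openE vimageI)
  show "\<exists>\<epsilon>>0. \<forall>\<delta>>0. \<exists>j. pt_dist j z < \<delta> \<and> (\<forall>z'\<in>UNIV. pt_dist j z + pt_dist j z' < \<epsilon> \<longrightarrow> c < \<phi> z')"
  proof (intro exI[of _ \<epsilon>] conjI \<epsilon>(1) allI impI)
    fix \<delta> :: real assume "\<delta> > 0"
    then obtain j where "dense_pt j \<in> ball z \<delta>"
      using dense_pt[of "ball z \<delta>"] by auto
    moreover have "c < \<phi> z'" if "pt_dist j z + pt_dist j z' < \<epsilon>" for z'
      using that \<epsilon>(2) dist_triangle2[of z z' "dense_pt j"] by force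
    ultimately show "\<exists>j. pt_dist j z < \<delta> \<and> (\<forall>z'\<in>UNIV. pt_dist j z + pt_dist j z' < \<epsilon> \<longrightarrow> c < \<phi> z')"
      by auto
  qed
qed

text \<open>Besides being vague test functions, the functions used below vary in time at a bounded rate. This is
  what makes the expectations studied later Lipschitz functions of the shift.\<close>

definition time_lipschitz_test :: "(real \<times> 'm::topological_space \<Rightarrow> real) \<Rightarrow> bool" where
  "time_lipschitz_test f \<longleftrightarrow> continuous_on UNIV f \<and> (\<forall>z. 0 \<le> f z) \<and>
     (\<exists>B. \<forall>z. f z \<le> B) \<and> (\<exists>h>0. \<forall>z. f z \<noteq> 0 \<longrightarrow> \<bar>fst z\<bar> \<le> h) \<and>
     (\<exists>K\<ge>0. \<forall>s s' w. \<bar>f (s, w) - f (s', w)\<bar> \<le> K * \<bar>s - s'\<bar>)"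

lemma time_lipschitz_test_zero: "time_lipschitz_test (\<lambda>_. 0)"
  by (auto simp: time_lipschitz_test_def intro: exI[of _ 1])

lemma time_lipschitz_test_max:
  assumes "time_lipschitz_test f" "time_lipschitz_test g"
  shows "time_lipschitz_test (\<lambda>z. max (f z) (g z))"
proof -
  obtain Bf hf Kf where f: "continuous_on UNIV f" "\<And>z. 0 \<le> f z" "\<And>z. f z \<le> Bf" "hf > 0"
    "\<And>z. f z \<noteq> 0 \<Longrightarrow> \<bar>fst z\<bar> \<le> hf" "Kf \<ge> 0" "\<And>s s' w. \<bar>f (s, w) - f (s', w)\<bar> \<le> Kf * \<bar>s - s'\<bar>"
    using assms(1) unfolding time_lipschitz_test_def by blast
  obtain Bg hg Kg where g: "continuous_on UNIV g" "\<And>z. 0 \<le> g z" "\<And>z. g z \<le> Bg" "hg > 0"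
    "\<And>z. g z \<noteq> 0 \<Longrightarrow> \<bar>fst z\<bar> \<le> hg" "Kg \<ge> 0" "\<And>s s' w. \<bar>g (s, w) - g (s', w)\<bar> \<le> Kg * \<bar>s - s'\<bar>"
    using assms(2) unfolding time_lipschitz_test_def by blast
  have "continuous_on UNIV (\<lambda>z. max (f z) (g z))"
    using f(1) g(1) by (intro continuous_intros)
  moreover have "max (f z) (g z) \<le> max Bf Bg" for z
    using f(3)[of z] g(3)[of z] by linarith
  moreover have "\<bar>fst z\<bar> \<le> max hf hg" if "max (f z) (g z) \<noteq> 0" for z
    using that f(5)[of z] g(5)[of z] by (cases "f z = 0"; cases "g z = 0") auto
  moreover have "\<bar>max (f (s, w)) (g (s, w)) - max (f (s', w)) (g (s', w))\<bar> \<le> max Kf Kg * \<bar>s - s'\<bar>" for s s' w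
  proof -
    have "Kf * \<bar>s - s'\<bar> \<le> max Kf Kg * \<bar>s - s'\<bar>" "Kg * \<bar>s - s'\<bar> \<le> max Kf Kg * \<bar>s - s'\<bar>"
      by (intro mult_right_mono; simp)+
    then show ?thesis
      using f(7)[of s w s'] g(7)[of s w s'] by linarith
  qed
  moreover have "0 \<le> max (f z) (g z)" for z
    using f(2)[of z] by linarith
  moreover have "max hf hg > 0" "max Kf Kg \<ge> 0"
    using f g by linarith+
  ultimately show ?thesis
    unfolding time_lipschitz_test_def by blast
qed

lemma time_lipschitz_test_tent:
  fixes e :: "real \<times> 'm::metric_space"
  shows "time_lipschitz_test (\<lambda>z. tent (dist z e) r c)"
  unfolding time_lipschitz_test_def
proof (intro conjI allI)
  show "continuous_on UNIV (\<lambda>z. tent (dist z e) r c)"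
    unfolding tent_def by (cases "r > 0 \<and> c > 0") (auto intro!: continuous_intros)
  show "0 \<le> tent (dist z e) r c" for z
    by (rule tent_nonneg)
  show "\<exists>B. \<forall>z. tent (dist z e) r c \<le> B"
    using tent_le[OF zero_le_dist] by blast
  have "\<bar>fst z\<bar> \<le> \<bar>fst e\<bar> + \<bar>r\<bar> + 1" if "tent (dist z e) r c \<noteq> 0" for z
  proof -
    have "dist z e < r"
      using that tent_eq_0[of r "dist z e" c] by force
    then show ?thesis
      using dist_fst_le[of z e] by (auto simp: dist_real_def)
  qed
  then show "\<exists>h>0. \<forall>z. tent (dist z e) r c \<noteq> 0 \<longrightarrow> \<bar>fst z\<bar> \<le> h"
    by (intro exI[of _ "\<bar>fst e\<bar> + \<bar>r\<bar> + 1"]) auto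
  have "\<bar>tent (dist (s, w) e) r c - tent (dist (s', w) e) r c\<bar> \<le> \<bar>c / r\<bar> * \<bar>s - s'\<bar>" for s s' w
  proof -
    have "\<bar>dist (s, w) e - dist (s', w) e\<bar> \<le> dist (s, w) (s', w)"
      by (metis abs_dist_diff_le dist_commute)
    also have "\<dots> = \<bar>s - s'\<bar>"
      by (simp add: dist_Pair_Pair dist_real_def)
    finally have "\<bar>c / r\<bar> * \<bar>dist (s, w) e - dist (s', w) e\<bar> \<le> \<bar>c / r\<bar> * \<bar>s - s'\<bar>"
      by (intro mult_left_mono) auto
    then show ?thesis
      using tent_lipschitz[of "dist (s, w) e" r c "dist (s', w) e"] by linarith
  qed
  then show "\<exists>K\<ge>0. \<forall>s s' w. \<bar>tent (dist (s, w) e) r c - tent (dist (s', w) e) r c\<bar> \<le> K * \<bar>s - s'\<bar>"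
    by (intro exI[of _ "\<bar>c / r\<bar>"]) auto
qed

text \<open>Finite maxima of tents have bounded support in the mark space, so they cannot dominate a general test
  function. The functions of index \<open>Inr j\<close> depend on time only and do so for large \<open>j\<close>.\<close>

definition test_fun :: "(nat \<times> rat \<times> rat) list + nat \<Rightarrow> real \<times> 'm::polish_space \<Rightarrow> real" where
  "test_fun i = (case i of Inl L \<Rightarrow> maxl (tents pt_dist) L | Inr j \<Rightarrow> (\<lambda>z. max 0 (real j - \<bar>fst z\<bar>)))"

lemma time_lipschitz_test_fun: "time_lipschitz_test (test_fun i :: real \<times> 'm::polish_space \<Rightarrow> real)"
proof (cases i)
  case (Inl L)
  have "time_lipschitz_test (maxl (tents pt_dist) L :: real \<times> 'm \<Rightarrow> real)"
  proof (induction L)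
    case Nil
    have "maxl (tents pt_dist) [] = (\<lambda>_::real \<times> 'm. 0)" by auto
    then show ?case using time_lipschitz_test_zero by (simp only:)
  next
    case (Cons a L)
    obtain j r c where a: "a = (j, r, c)" by (cases a)
    have "maxl (tents pt_dist) (a # L) = (\<lambda>z::real \<times> 'm. max (tent (pt_dist j z) (of_rat r) (of_rat c)) (maxl (tents pt_dist) L z))"
      using a by auto
    then show ?case
      using time_lipschitz_test_max[OF time_lipschitz_test_tent Cons] by (simp only:)
  qed
  then show ?thesis using Inl by (simp add: test_fun_def)
next
  case (Inr j)
  have "time_lipschitz_test (\<lambda>z::real \<times> 'm. max 0 (real j - \<bar>fst z\<bar>))"
    unfolding time_lipschitz_test_def
  proof (intro conjI allI)
    show "continuous_on UNIV (\<lambda>z::real \<times> 'm. max 0 (real j - \<bar>fst z\<bar>))"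
      by (intro continuous_on_max continuous_on_const continuous_on_diff continuous_on_rabs continuous_on_fst continuous_on_id)
    show "\<exists>B. \<forall>z::real \<times> 'm. max 0 (real j - \<bar>fst z\<bar>) \<le> B"
      by (intro exI[of _ "real j"]) auto
    show "\<exists>h>0. \<forall>z::real \<times> 'm. max 0 (real j - \<bar>fst z\<bar>) \<noteq> 0 \<longrightarrow> \<bar>fst z\<bar> \<le> h"
      by (intro exI[of _ "real j + 1"]) auto
    show "\<exists>K\<ge>0. \<forall>s s' w. \<bar>max 0 (real j - \<bar>fst (s, w::'m)\<bar>) - max 0 (real j - \<bar>fst (s', w)\<bar>)\<bar> \<le> K * \<bar>s - s'\<bar>"
      by (intro exI[of _ 1]) auto
  qed simp
  then show ?thesis using Inr by (simp add: test_fun_def)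
qed

lemma time_lipschitz_test_imp_vague_test: "time_lipschitz_test f \<Longrightarrow> f \<in> vague_test"
proof -
  assume "time_lipschitz_test f"
  then obtain B h where f: "continuous_on UNIV f" "\<And>z. 0 \<le> f z" "\<And>z. f z \<le> B" "h > 0"
    "\<And>z. f z \<noteq> 0 \<Longrightarrow> \<bar>fst z\<bar> \<le> h"
    unfolding time_lipschitz_test_def by blast
  have "bounded (range f)"
    unfolding bounded_iff using f(2,3) by (intro exI[of _ B]) (auto simp: abs_of_nonneg)
  moreover have "{z. f z \<noteq> 0} \<subseteq> {-h..h} \<times> UNIV"
  proof
    fix z assume "z \<in> {z. f z \<noteq> 0}"
    then have "\<bar>fst z\<bar> \<le> h" using f(5) by blast
    then show "z \<in> {-h..h} \<times> UNIV" by (auto simp: abs_le_iff mem_Times_iff)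
  qed
  ultimately show ?thesis
    using f(1,4) unfolding vague_test_def strip_bounded_def by blast
qed

lemma sets_point_measures: "m \<in> point_measures \<Longrightarrow> sets m = sets borel"
  by (auto simp: point_measures_def dirac_sum_def)

lemma space_point_measures: "m \<in> point_measures \<Longrightarrow> space m = UNIV"
  using sets_eq_imp_space_eq[OF sets_point_measures] by simp

lemma vague_test_measurable: "f \<in> vague_test \<Longrightarrow> f \<in> borel_measurable borel"
  by (auto simp: vague_test_def intro: borel_measurable_continuous_onI)

abbreviation strip :: "real \<Rightarrow> (real \<times> 'm) set" where
  "strip h \<equiv> {-h..h} \<times> UNIV"

lemma strip_sets [measurable, simp]: "strip h \<in> sets (borel :: (real \<times> 'm::topological_space) measure)"
  by (intro borel_closed closed_Times) auto

lemma emeasure_strip: "m \<in> point_measures \<Longrightarrow> emeasure m (strip h) < \<infinity>"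
proof -
  assume m: "m \<in> point_measures"
  have "strip_bounded (strip h :: (real \<times> 'a) set)"
    unfolding strip_bounded_def by (intro exI[of _ "max 1 h"]) auto
  with m show ?thesis unfolding point_measures_def by auto
qed

lemma vague_test_bound:
  assumes "f \<in> vague_test"
  obtains h B where "h > 0" "B > 0" "\<And>z. \<bar>f z\<bar> \<le> B * indicator (strip h) z"
proof -
  from assms obtain h where h: "h > 0" "{z. f z \<noteq> 0} \<subseteq> strip h"
    by (auto simp: vague_test_def strip_bounded_def)
  from assms obtain B where B: "\<And>z. \<bar>f z\<bar> \<le> B"
    by (auto simp: vague_test_def bounded_iff)
  show ?thesis
  proof (rule that[OF h(1), of "\<bar>B\<bar> + 1"])
    fix z
    show "\<bar>f z\<bar> \<le> (\<bar>B\<bar> + 1) * indicator (strip h) z"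
      using B[of z] h(2) by (cases "z \<in> strip h") auto
  qed simp
qed

lemma integrable_vague_test:
  assumes m: "m \<in> point_measures" and f: "f \<in> vague_test"
  shows "integrable m f"
proof -
  obtain h B where hB: "\<And>z. \<bar>f z\<bar> \<le> B * indicator (strip h) z"
    using vague_test_bound[OF f] by metis
  have meas: "f \<in> borel_measurable m"
    using vague_test_measurable[OF f] measurable_cong_sets[OF sets_point_measures[OF m] refl] by blast
  have "integrable m (\<lambda>z. B * indicator (strip h) z)"
    using emeasure_strip[OF m] sets_point_measures[OF m]
    by (intro integrable_mult_right integrable_real_indicator) auto
  then show ?thesis
    using meas by (rule Bochner_Integration.integrable_bound) (use hB in \<open>auto intro!: AE_I2 order_trans[OF hB] simp del: split_paired_All\<close>)
qed

definition vcoord :: "(real \<times> 'm::polish_space) measure \<Rightarrow> nat \<Rightarrow> real" where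
  "vcoord m k = (\<integral>z. test_fun (from_nat k) z \<partial>m)"

text \<open>A nonnegative test function lies below one of the time cutoffs, and it and the difference are increasing
  limits of finite maxima of tents. A general test function is the difference of its two parts.\<close>

lemma vague_limit_if_vcoord_tendsto:
  fixes m :: "nat \<Rightarrow> (real \<times> 'm::polish_space) measure"
  assumes m: "\<And>n. m n \<in> point_measures" "l \<in> point_measures"
    and conv: "\<And>k. (\<lambda>n. vcoord (m n) k) \<longlonglongrightarrow> vcoord l k"
  shows "limitin vague_topology m l sequentially"
proof -
  have conv': "(\<lambda>n. \<integral>z. test_fun i z \<partial>m n) \<longlonglongrightarrow> (\<integral>z. test_fun i z \<partial>l)" for i
    using conv[of "to_nat i"] by (simp add: vcoord_def)
  have test: "test_fun i \<in> (vague_test :: (real \<times> 'm \<Rightarrow> real) set)" for i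
    by (intro time_lipschitz_test_imp_vague_test time_lipschitz_test_fun)
  have pos: "(\<lambda>n. \<integral>z. \<phi> z \<partial>m n) \<longlonglongrightarrow> (\<integral>z. \<phi> z \<partial>l)"
    if \<phi>: "\<phi> \<in> vague_test" "\<And>z. 0 \<le> \<phi> z" for \<phi>
  proof -
    obtain h B where hB: "h > 0" "B > 0" "\<And>z. \<bar>\<phi> z\<bar> \<le> B * indicator (strip h) z"
      using vague_test_bound[OF \<phi>(1)] by metis
    obtain j where j: "B + h \<le> real j"
      using real_arch_simple by blast
    let ?\<kappa> = "test_fun (Inr j) :: real \<times> 'm \<Rightarrow> real"
    have le: "\<phi> z \<le> ?\<kappa> z" for z
    proof (cases "z \<in> strip h")
      case True
      then have "\<phi> z \<le> B" "\<bar>fst z\<bar> \<le> h"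
        using hB(3)[of z] by auto
      then show ?thesis
        using j by (simp add: test_fun_def)
    qed (use hB(3)[of z] in \<open>simp add: test_fun_def\<close>)
    have cont: "continuous_on UNIV \<phi>" "continuous_on UNIV (\<lambda>z. ?\<kappa> z - \<phi> z)"
      using \<phi>(1) test[of "Inr j"] by (auto simp: vague_test_def intro!: continuous_intros)
    have meas: "g \<in> borel_measurable (m n)" "g \<in> borel_measurable l"
      if "g \<in> borel_measurable borel" for g :: "real \<times> 'm \<Rightarrow> real" and n
      using that measurable_cong_sets[OF sets_point_measures[OF m(1)] refl]
        measurable_cong_sets[OF sets_point_measures[OF m(2)] refl] by blast+
    show ?thesis
    proof (rule tendsto_integral_by_tents[where \<kappa> = ?\<kappa> and S = UNIV and d = pt_dist])
      show "space (m t) = UNIV" "space l = UNIV" for t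
        using m space_point_measures by auto
      show "lsc_near pt_dist UNIV \<phi>" "lsc_near pt_dist UNIV (\<lambda>z. ?\<kappa> z - \<phi> z)"
        using cont by (auto intro: lsc_near_continuous)
      show "(\<lambda>t. \<integral>z. maxl (tents pt_dist) L z \<partial>m t) \<longlonglongrightarrow> (\<integral>z. maxl (tents pt_dist) L z \<partial>l)" for L
        using conv'[of "Inl L"] by (simp add: test_fun_def)
    qed (use le \<phi> m test conv' in \<open>auto intro!: integrable_vague_test meas\<close>)
  qed
  have "(\<lambda>n. \<integral>z. f z \<partial>m n) \<longlonglongrightarrow> (\<integral>z. f z \<partial>l)" if f: "f \<in> vague_test" for f
  proof -
    have parts: "(\<lambda>z. max 0 (f z)) \<in> vague_test" "(\<lambda>z. max 0 (- f z)) \<in> vague_test"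
    proof -
      obtain h B where hB: "h > 0" "B > 0" "\<And>z. \<bar>f z\<bar> \<le> B * indicator (strip h) z"
        using vague_test_bound[OF f] by metis
      have cont: "continuous_on UNIV f"
        using f by (simp add: vague_test_def)
      have *: "g \<in> vague_test" if "continuous_on UNIV g" "\<And>z. \<bar>g z\<bar> \<le> \<bar>f z\<bar>" for g
        unfolding vague_test_def
      proof (intro CollectI conjI)
        show "bounded (range g)"
          unfolding bounded_iff
        proof (intro exI[of _ B] ballI)
          fix y assume "y \<in> range g"
          then obtain z where "y = g z" by blast
          then show "norm y \<le> B"
            using that(2)[of z] hB(2) hB(3)[of z] by (cases "z \<in> strip h") auto
        qed
        show "strip_bounded {z. g z \<noteq> 0}"
          unfolding strip_bounded_def
        proof (intro exI[of _ h] conjI hB(1) subsetI)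
          fix z assume "z \<in> {z. g z \<noteq> 0}"
          then show "z \<in> strip h"
            using that(2)[of z] hB(3)[of z] by (cases "z \<in> strip h") auto
        qed
      qed fact
      show "(\<lambda>z. max 0 (f z)) \<in> vague_test" "(\<lambda>z. max 0 (- f z)) \<in> vague_test"
        using cont by (auto intro!: * continuous_intros)
    qed
    have *: "f = (\<lambda>z. max 0 (f z) - max 0 (- f z))"
      by auto
    have eq: "(\<integral>z. f z \<partial>m') = (\<integral>z. max 0 (f z) \<partial>m') - (\<integral>z. max 0 (- f z) \<partial>m')"
      if "m' \<in> point_measures" for m'
      using parts that by (subst *, subst Bochner_Integration.integral_diff) (auto intro: integrable_vague_test)
    show ?thesis
      using m by (simp add: eq) (intro tendsto_diff pos parts; simp)
  qed
  then show ?thesis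
    using limitin_vague_topology[of m l] m by blast
qed

text \<open>Otherwise some sequence outside \<open>G\<close> would converge to \<open>m\<close> in each coordinate, hence vaguely.\<close>

lemma vcoord_neighbourhood:
  fixes m :: "(real \<times> 'm::polish_space) measure"
  assumes G: "openin vague_topology G" "m \<in> G"
  shows "\<exists>n. \<exists>\<epsilon>>0. \<forall>m'\<in>point_measures. (\<Sum>k<n. \<bar>vcoord m' k - vcoord m k\<bar>) < \<epsilon> \<longrightarrow> m' \<in> G"
proof (rule ccontr)
  assume neg: "\<not> ?thesis"
  have m: "m \<in> point_measures"
    using openin_subset[OF G(1)] G(2) by (auto simp: topspace_vague_topology)
  have "\<exists>m'. m' \<in> point_measures \<and> (\<Sum>k<n. \<bar>vcoord m' k - vcoord m k\<bar>) < inverse (real (Suc n)) \<and> m' \<notin> G" for n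
  proof (rule ccontr)
    assume "\<nexists>m'. m' \<in> point_measures \<and> (\<Sum>k<n. \<bar>vcoord m' k - vcoord m k\<bar>) < inverse (real (Suc n)) \<and> m' \<notin> G"
    then have "\<forall>m'\<in>point_measures. (\<Sum>k<n. \<bar>vcoord m' k - vcoord m k\<bar>) < inverse (real (Suc n)) \<longrightarrow> m' \<in> G"
      by blast
    moreover have "inverse (real (Suc n)) > 0" by simp
    ultimately show False using neg by blast
  qed
  then obtain M where M: "\<And>n. M n \<in> point_measures"
    "\<And>n. (\<Sum>k<n. \<bar>vcoord (M n) k - vcoord m k\<bar>) < inverse (real (Suc n))" "\<And>n. M n \<notin> G"
    by metis
  have "(\<lambda>n. vcoord (M n) k) \<longlonglongrightarrow> vcoord m k" for k
  proof (rule LIMSEQ_I)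
    fix e :: real assume "e > 0"
    then obtain n0 where n0: "inverse (real (Suc n0)) < e"
      using reals_Archimedean by blast
    show "\<exists>no. \<forall>n\<ge>no. norm (vcoord (M n) k - vcoord m k) < e"
    proof (intro exI[of _ "max n0 (Suc k)"] allI impI)
      fix n assume n: "max n0 (Suc k) \<le> n"
      have "\<bar>vcoord (M n) k - vcoord m k\<bar> \<le> (\<Sum>k<n. \<bar>vcoord (M n) k - vcoord m k\<bar>)"
        using n by (intro member_le_sum) auto
      also have "\<dots> < inverse (real (Suc n))" by (rule M(2))
      also have "\<dots> \<le> inverse (real (Suc n0))"
        using n by (intro le_imp_inverse_le) auto
      finally show "norm (vcoord (M n) k - vcoord m k) < e"
        using n0 by simp
    qed
  qed
  then have "limitin vague_topology M m sequentially"
    using M(1) m by (intro vague_limit_if_vcoord_tendsto)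
  then have "\<forall>\<^sub>F n in sequentially. M n \<in> G"
    using G unfolding limitin_def by blast
  then show False
    using M(3) by (auto dest: eventually_happens)
qed

text \<open>The centres of the tents in the space of point measures are finite lists of rationals; the length of the
  list is the number of coordinates in use.\<close>

definition vdist :: "rat list \<Rightarrow> (real \<times> 'm::polish_space) measure \<Rightarrow> real" where
  "vdist q m = (\<Sum>k<length q. \<bar>vcoord m k - of_rat (q ! k)\<bar>)"

lemma vdist_nonneg: "0 \<le> vdist q m"
  unfolding vdist_def by (intro sum_nonneg) auto

lemma rational_list_close:
  assumes "\<delta> > 0"
  shows "\<exists>q. length q = n \<and> (\<Sum>k<n. \<bar>(v::nat \<Rightarrow> real) k - of_rat (q ! k)\<bar>) < \<delta>"
proof -
  have "\<exists>r. \<bar>v k - of_rat r\<bar> < \<delta> / real (Suc n)" for k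
  proof -
    have "v k - \<delta> / real (Suc n) < v k"
      using assms by simp
    from of_rat_dense[OF this] obtain r where r: "v k - \<delta> / real (Suc n) < of_rat r" "of_rat r < v k" by blast
    then have "\<bar>v k - of_rat r\<bar> < \<delta> / real (Suc n)" unfolding abs_less_iff by linarith
    then show ?thesis by blast
  qed
  then obtain r where r: "\<And>k. \<bar>v k - of_rat (r k)\<bar> < \<delta> / real (Suc n)"
    by metis
  have "(\<Sum>k<n. \<bar>v k - of_rat (map r [0..<n] ! k)\<bar>) \<le> (\<Sum>k<n. \<delta> / real (Suc n))"
    using r by (intro sum_mono) (auto intro: less_imp_le)
  also have "\<dots> < \<delta>"
    using assms by (simp add: field_simps)
  finally show ?thesis
    by (intro exI[of _ "map r [0..<n]"]) auto
qed

lemma lsc_near_if_openin: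
  fixes \<phi> :: "(real \<times> 'm::polish_space) measure \<Rightarrow> real"
  assumes "\<And>c. openin vague_topology {m \<in> point_measures. c < \<phi> m}"
  shows "lsc_near vdist point_measures \<phi>"
  unfolding lsc_near_def
proof (intro ballI allI impI)
  fix m :: "(real \<times> 'm) measure" and c assume m: "m \<in> point_measures" "c < \<phi> m"
  then obtain n \<epsilon> where \<epsilon>: "\<epsilon> > 0" "\<And>m'. m' \<in> point_measures \<Longrightarrow>
      (\<Sum>k<n. \<bar>vcoord m' k - vcoord m k\<bar>) < \<epsilon> \<Longrightarrow> c < \<phi> m'"
    using vcoord_neighbourhood[OF assms, of m c] by blast
  show "\<exists>\<epsilon>>0. \<forall>\<delta>>0. \<exists>q. vdist q m < \<delta> \<and> (\<forall>m'\<in>point_measures. vdist q m + vdist q m' < \<epsilon> \<longrightarrow> c < \<phi> m')"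
  proof (intro exI[of _ \<epsilon>] conjI \<epsilon>(1) allI impI)
    fix \<delta> :: real assume "\<delta> > 0"
    then obtain q where q: "length q = n" "(\<Sum>k<n. \<bar>vcoord m k - of_rat (q ! k)\<bar>) < \<delta>"
      using rational_list_close by blast
    have "c < \<phi> m'" if m': "m' \<in> point_measures" "vdist q m + vdist q m' < \<epsilon>" for m'
    proof (rule \<epsilon>(2)[OF m'(1)])
      have "(\<Sum>k<n. \<bar>vcoord m' k - vcoord m k\<bar>)
          \<le> (\<Sum>k<n. \<bar>vcoord m k - of_rat (q ! k)\<bar> + \<bar>vcoord m' k - of_rat (q ! k)\<bar>)"
        by (intro sum_mono) linarith
      also have "\<dots> = vdist q m + vdist q m'"
        by (simp add: vdist_def q(1) sum.distrib)
      finally show "(\<Sum>k<n. \<bar>vcoord m' k - vcoord m k\<bar>) < \<epsilon>"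
        using m'(2) by linarith
    qed
    then show "\<exists>q. vdist q m < \<delta> \<and> (\<forall>m'\<in>point_measures. vdist q m + vdist q m' < \<epsilon> \<longrightarrow> c < \<phi> m')"
      using q by (intro exI[of _ q]) (auto simp: vdist_def)
  qed
qed

lemma space_borel_algebra [simp]: "space (borel_algebra S) = topspace S"
  unfolding borel_algebra_def by (rule space_measure_of) (auto dest: openin_subset)

lemma sets_borel_algebra: "sets (borel_algebra S) = sigma_sets (topspace S) {G. openin S G}"
  unfolding borel_algebra_def by (rule sets_measure_of) (auto dest: openin_subset)

lemma continuous_map_borel_measurable:
  fixes \<phi> :: "'s \<Rightarrow> real"
  assumes "continuous_map S euclideanreal \<phi>"
  shows "\<phi> \<in> borel_measurable (borel_algebra S)"
proof (rule borel_measurableI)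
  fix V :: "real set" assume "open V"
  then have "openin S {x \<in> topspace S. \<phi> x \<in> V}"
    using assms by (simp add: continuous_map_def)
  moreover have "\<phi> -` V \<inter> space (borel_algebra S) = {x \<in> topspace S. \<phi> x \<in> V}"
    by auto
  ultimately show "\<phi> -` V \<inter> space (borel_algebra S) \<in> sets (borel_algebra S)"
    by (auto simp: sets_borel_algebra)
qed

lemma continuous_map_vcoord:
  "continuous_map vague_topology euclideanreal (\<lambda>m :: (real \<times> 'm::polish_space) measure. vcoord m k)"
  unfolding continuous_map_def
proof (intro conjI allI impI)
  fix V :: "real set" assume "openin euclideanreal V"
  moreover have "test_fun (from_nat k) \<in> (vague_test :: (real \<times> 'm \<Rightarrow> real) set)"
    by (intro time_lipschitz_test_imp_vague_test time_lipschitz_test_fun)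
  ultimately show "openin vague_topology {m \<in> topspace (vague_topology :: (real \<times> 'm) measure topology). vcoord m k \<in> V}"
    unfolding topspace_vague_topology unfolding vague_topology_def vcoord_def
    by (intro topology_generated_by_Basis CollectI exI[of _ "test_fun (from_nat k)"] exI[of _ V]) auto
qed auto

lemma vdist_borel_measurable [measurable]: "vdist q \<in> borel_measurable (borel_algebra vague_topology)"
proof -
  have [measurable]: "(\<lambda>m. vcoord m k) \<in> borel_measurable (borel_algebra vague_topology)" for k
    by (intro continuous_map_borel_measurable continuous_map_vcoord)
  show ?thesis
    unfolding vdist_def[abs_def] by measurable
qed

text \<open>Every open set is a countable union of positivity sets of tents, so the coordinates generate the
  Borel sets.\<close>

lemma measurable_vague_if_vcoord:
  fixes \<xi> :: "'a \<Rightarrow> (real \<times> 'm::polish_space) measure"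
  assumes \<xi>: "\<And>\<omega>. \<omega> \<in> space M \<Longrightarrow> \<xi> \<omega> \<in> point_measures"
    and meas: "\<And>k. (\<lambda>\<omega>. vcoord (\<xi> \<omega>) k) \<in> borel_measurable M"
  shows "\<xi> \<in> measurable M (borel_algebra vague_topology)"
  unfolding borel_algebra_def
proof (rule measurable_sigma_sets)
  show "sets (sigma (topspace vague_topology) {G. openin vague_topology G}) =
      sigma_sets (topspace vague_topology) {G. openin vague_topology (G :: (real \<times> 'm) measure set)}"
    by (rule sets_measure_of) (auto dest: openin_subset)
  show "{G. openin vague_topology G} \<subseteq> Pow (topspace vague_topology)"
    by (auto dest: openin_subset)
  show "\<xi> \<in> space M \<rightarrow> topspace vague_topology"
    using \<xi> by (auto simp: topspace_vague_topology)
  fix G :: "(real \<times> 'm) measure set" assume "G \<in> {G. openin vague_topology G}"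
  then have G: "openin vague_topology G" "G \<subseteq> point_measures"
    using openin_subset[of vague_topology G] by (auto simp: topspace_vague_topology)
  define I where "I = {i. \<forall>m\<in>point_measures. 0 < tents vdist i m \<longrightarrow> m \<in> G}"
  have lsc: "lsc_near vdist point_measures (\<lambda>m. indicat_real G m)"
  proof (rule lsc_near_if_openin)
    fix c :: real
    have "{m \<in> point_measures. c < indicat_real G m} = (if c < 0 then point_measures else if c < 1 then G else {})"
      using G(2) by (auto simp: indicator_def)
    then show "openin vague_topology {m \<in> point_measures. c < indicat_real G m}"
      using G(1) openin_topspace[of "vague_topology :: (real \<times> 'm) measure topology"] by (simp add: topspace_vague_topology)
  qed
  have "\<xi> -` G \<inter> space M = (\<Union>i\<in>I. {\<omega> \<in> space M. 0 < tents vdist i (\<xi> \<omega>)})"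
  proof (intro equalityI subsetI)
    fix \<omega> assume \<omega>: "\<omega> \<in> \<xi> -` G \<inter> space M"
    then have "\<exists>i. 0 < tents vdist i (\<xi> \<omega>) \<and> (\<forall>m\<in>point_measures. tents vdist i m \<le> indicat_real G m)"
      using \<xi> by (intro tent_below[OF lsc]) (auto simp: vdist_nonneg)
    then obtain i where i: "0 < tents vdist i (\<xi> \<omega>)"
      "\<And>m. m \<in> point_measures \<Longrightarrow> tents vdist i m \<le> indicat_real G m"
      by blast
    have "m \<in> G" if "m \<in> point_measures" "0 < tents vdist i m" for m
      using i(2)[OF that(1)] that(2) by (cases "m \<in> G") auto
    then have "i \<in> I"
      by (simp add: I_def)
    then show "\<omega> \<in> (\<Union>i\<in>I. {\<omega> \<in> space M. 0 < tents vdist i (\<xi> \<omega>)})"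
      using \<omega> i(1) by blast
  qed (use \<xi> in \<open>auto simp: I_def\<close>)
  moreover have "(\<lambda>\<omega>. tents vdist i (\<xi> \<omega>)) \<in> borel_measurable M" for i
    using meas unfolding vdist_def by (cases i) (simp, measurable)
  then have "{\<omega> \<in> space M. 0 < tents vdist i (\<xi> \<omega>)} \<in> sets M" for i
    by simp
  then have "(\<Union>i\<in>I. {\<omega> \<in> space M. 0 < tents vdist i (\<xi> \<omega>)}) \<in> sets M"
    by (intro sets.countable_UN'') auto
  ultimately show "\<xi> -` G \<inter> space M \<in> sets M"
    by simp
qed

text \<open>For convergence in distribution it suffices to test against the functionals \<open>maxl (tents vdist) L\<close>, each
  of which depends on finitely many integrals of time-Lipschitz test functions.\<close>

theorem converges_in_distribution_by_tents:
  fixes \<xi> :: "'t \<Rightarrow> 'a \<Rightarrow> (real \<times> 'm::polish_space) measure"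
  assumes P: "prob_space P" and N: "prob_space N"
    and \<xi>: "\<And>t. \<xi> t \<in> measurable P (borel_algebra vague_topology)"
    and \<zeta>: "\<zeta> \<in> measurable N (borel_algebra vague_topology)"
    and conv: "\<And>L. ((\<lambda>t. \<integral>\<omega>. maxl (tents vdist) L (\<xi> t \<omega>) \<partial>P) \<longlongrightarrow> (\<integral>\<omega>. maxl (tents vdist) L (\<zeta> \<omega>) \<partial>N)) F"
  shows "converges_in_distribution vague_topology P \<xi> N \<zeta> F"
  unfolding converges_in_distribution_def
proof (intro conjI allI impI)
  let ?V = "borel_algebra (vague_topology :: (real \<times> 'm) measure topology)"
  interpret P: prob_space P by fact
  interpret N: prob_space N by fact
  fix \<phi> :: "(real \<times> 'm) measure \<Rightarrow> real"
  assume \<phi>: "continuous_map vague_topology euclideanreal \<phi> \<and> bounded (\<phi> ` topspace vague_topology)"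
  have [measurable]: "\<phi> \<in> borel_measurable ?V"
    using \<phi> continuous_map_borel_measurable by blast
  obtain B where B: "\<And>m. m \<in> point_measures \<Longrightarrow> \<bar>\<phi> m\<bar> \<le> B"
    using \<phi> by (auto simp: bounded_iff topspace_vague_topology)
  have BB: "\<bar>\<phi> m\<bar> \<le> \<bar>B\<bar>" if "m \<in> point_measures" for m
    using B[OF that] by linarith
  note [measurable] = \<xi> \<zeta>
  have pm: "\<omega> \<in> space P \<Longrightarrow> \<xi> t \<omega> \<in> point_measures" "\<omega>' \<in> space N \<Longrightarrow> \<zeta> \<omega>' \<in> point_measures" for t \<omega> \<omega>'
    using \<xi>[of t, THEN measurable_space] \<zeta>[THEN measurable_space] by (auto simp: topspace_vague_topology)
  interpret DP: prob_space "distr P ?V (\<xi> t)" for t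
    by (rule P.prob_space_distr) simp
  interpret DN: prob_space "distr N ?V \<zeta>"
    by (rule N.prob_space_distr) simp
  have intP: "integrable P (\<lambda>\<omega>. \<phi> (\<xi> t \<omega>))" for t
    by (rule P.integrable_const_bound[where B = "\<bar>B\<bar>"]) (use pm BB in \<open>auto intro!: AE_I2\<close>)
  have intN: "integrable N (\<lambda>\<omega>. \<phi> (\<zeta> \<omega>))"
    by (rule N.integrable_const_bound[where B = "\<bar>B\<bar>"]) (use pm BB in \<open>auto intro!: AE_I2\<close>)
  have op: "openin vague_topology {m \<in> point_measures. \<phi> m \<in> V}" if "open V" for V
    using \<phi> that by (auto simp: continuous_map_def topspace_vague_topology)
  have "((\<lambda>t. \<integral>m. \<phi> m + \<bar>B\<bar> \<partial>distr P ?V (\<xi> t)) \<longlongrightarrow> (\<integral>m. \<phi> m + \<bar>B\<bar> \<partial>distr N ?V \<zeta>)) F"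
  proof (rule tendsto_integral_by_tents[where \<kappa> = "\<lambda>_. 2 * \<bar>B\<bar>" and S = point_measures and d = vdist])
    show "space (distr P ?V (\<xi> t)) = point_measures" "space (distr N ?V \<zeta>) = point_measures" for t
      by (simp_all add: topspace_vague_topology)
    show "lsc_near vdist point_measures (\<lambda>m. \<phi> m + \<bar>B\<bar>)"
    proof (rule lsc_near_if_openin)
      fix c
      have "{m \<in> point_measures. c < \<phi> m + \<bar>B\<bar>} = {m \<in> point_measures. \<phi> m \<in> {c - \<bar>B\<bar><..}}"
        by auto
      then show "openin vague_topology {m \<in> point_measures. c < \<phi> m + \<bar>B\<bar>}"
        using op[of "{c - \<bar>B\<bar><..}"] by simp
    qed
    show "lsc_near vdist point_measures (\<lambda>m. 2 * \<bar>B\<bar> - (\<phi> m + \<bar>B\<bar>))"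
    proof (rule lsc_near_if_openin)
      fix c
      have "{m \<in> point_measures. c < 2 * \<bar>B\<bar> - (\<phi> m + \<bar>B\<bar>)} = {m \<in> point_measures. \<phi> m \<in> {..<\<bar>B\<bar> - c}}"
        by auto
      then show "openin vague_topology {m \<in> point_measures. c < 2 * \<bar>B\<bar> - (\<phi> m + \<bar>B\<bar>)}"
        using op[of "{..<\<bar>B\<bar> - c}"] by simp
    qed
    show "0 \<le> \<phi> m + \<bar>B\<bar>" "\<phi> m + \<bar>B\<bar> \<le> 2 * \<bar>B\<bar>" if "m \<in> point_measures" for m
      using BB[OF that] by linarith+
    show "((\<lambda>t. \<integral>m. maxl (tents vdist) L m \<partial>distr P ?V (\<xi> t)) \<longlongrightarrow> (\<integral>m. maxl (tents vdist) L m \<partial>distr N ?V \<zeta>)) F" for L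
      using conv[of L] by (simp add: integral_distr)
    show "integrable (distr P ?V (\<xi> t)) (\<lambda>m. \<phi> m + \<bar>B\<bar>)" for t
      using intP by (subst integrable_distr_eq) auto
    show "integrable (distr N ?V \<zeta>) (\<lambda>m. \<phi> m + \<bar>B\<bar>)"
      using intN by (subst integrable_distr_eq) auto
    show "((\<lambda>t. \<integral>m. 2 * \<bar>B\<bar> \<partial>distr P ?V (\<xi> t)) \<longlongrightarrow> (\<integral>m. 2 * \<bar>B\<bar> \<partial>distr N ?V \<zeta>)) F"
      using DP.prob_space DN.prob_space by (simp del: space_borel_algebra space_distr)
  qed (simp_all add: vdist_nonneg)
  then have "((\<lambda>t. (\<integral>\<omega>. \<phi> (\<xi> t \<omega>) \<partial>P) + \<bar>B\<bar>) \<longlongrightarrow> (\<integral>\<omega>. \<phi> (\<zeta> \<omega>) \<partial>N) + \<bar>B\<bar>) F"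
    using intP intN by (simp add: integral_distr P.prob_space N.prob_space)
  from tendsto_diff[OF this tendsto_const[of "\<bar>B\<bar>"]]
  show "((\<lambda>t. \<integral>\<omega>. \<phi> (\<xi> t \<omega>) \<partial>P) \<longlongrightarrow> (\<integral>\<omega>. \<phi> (\<zeta> \<omega>) \<partial>N)) F"
    by simp
qed (fact \<xi> \<zeta>)+

section \<open>Random point measures given by random sequences of points\<close>

definition locally_finite_points :: "('i \<Rightarrow> real \<times> 'm) \<Rightarrow> bool" where
  "locally_finite_points x \<longleftrightarrow> (\<forall>h. finite {i. \<bar>fst (x i)\<bar> \<le> h})"

definition shift_points :: "real \<Rightarrow> ('i \<Rightarrow> real \<times> 'm) \<Rightarrow> 'i \<Rightarrow> real \<times> 'm" where
  "shift_points t x i = (fst (x i) - t, snd (x i))"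

lemma shift_points_sel [simp]: "fst (shift_points t x i) = fst (x i) - t" "snd (shift_points t x i) = snd (x i)"
  by (simp_all add: shift_points_def)

lemma shift_points_0: "shift_points 0 x = x"
  by (simp add: fun_eq_iff shift_points_def)

lemma shift_points_add: "shift_points (t + s) x = shift_points s (shift_points t x)"
  by (simp add: fun_eq_iff shift_points_def)

lemma locally_finite_shift_points [simp]:
  "locally_finite_points (shift_points t x) \<longleftrightarrow> locally_finite_points x"
proof -
  have *: "locally_finite_points (shift_points t x)" if "locally_finite_points x" for t and x :: "'i \<Rightarrow> real \<times> 'm"
    unfolding locally_finite_points_def
  proof
    fix h
    have "finite {i. \<bar>fst (x i)\<bar> \<le> h + \<bar>t\<bar>}"
      using that by (simp add: locally_finite_points_def)
    then show "finite {i. \<bar>fst (shift_points t x i)\<bar> \<le> h}"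
      by (rule rev_finite_subset) auto
  qed
  have "shift_points (- t) (shift_points t x) = x"
    by (auto simp: fun_eq_iff prod_eq_iff)
  then show ?thesis
    using *[of x t] *[of "shift_points t x" "-t"] by auto
qed

lemma emeasure_dirac_sum_count:
  "A \<in> sets borel \<Longrightarrow> emeasure (dirac_sum UNIV x) A = emeasure (count_space UNIV) {i. x i \<in> A}"
  by (simp add: dirac_sum_def emeasure_distr vimage_def)

lemma dirac_sum_reindex:
  assumes "bij_betw \<pi> I J"
  shows "dirac_sum I (\<lambda>i. x (\<pi> i)) = dirac_sum J x"
proof -
  have "dirac_sum J x = distr (distr (count_space I) (count_space J) \<pi>) borel x"
    unfolding dirac_sum_def using assms by (simp add: distr_bij_count_space)
  also have "\<dots> = distr (count_space I) borel (x \<circ> \<pi>)"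
    using assms by (intro distr_distr) (auto simp: bij_betw_def)
  finally show ?thesis
    by (simp add: dirac_sum_def comp_def)
qed

lemma dirac_sum_in_point_measures_iff:
  fixes x :: "'i::countable \<Rightarrow> real \<times> 'm::topological_space"
  shows "dirac_sum UNIV x \<in> point_measures \<longleftrightarrow> locally_finite_points x"
proof
  assume m: "dirac_sum UNIV x \<in> point_measures"
  show "locally_finite_points x"
    unfolding locally_finite_points_def
  proof
    fix h
    have "emeasure (dirac_sum UNIV x) (strip h) < \<infinity>"
      using m by (rule emeasure_strip)
    then have "finite {i. x i \<in> strip h}"
      by (subst (asm) emeasure_dirac_sum_count) (auto simp: emeasure_count_space split: if_splits)
    then show "finite {i. \<bar>fst (x i)\<bar> \<le> h}"
      by (rule rev_finite_subset) (auto simp: mem_Times_iff abs_le_iff)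
  qed
next
  assume lf: "locally_finite_points x"
  have "bij_betw to_nat (UNIV :: 'i set) (range (to_nat :: 'i \<Rightarrow> nat))"
    by (intro bij_betw_imageI) simp_all
  from dirac_sum_reindex[OF this, of "\<lambda>n. x (from_nat n)"]
  have 1: "dirac_sum UNIV x = dirac_sum (range (to_nat :: 'i \<Rightarrow> nat)) (\<lambda>n. x (from_nat n))"
    by simp
  have 2: "emeasure (dirac_sum UNIV x) B < \<infinity>" if B: "B \<in> sets borel" "strip_bounded B" for B
  proof -
    obtain h where "B \<subseteq> strip h"
      using B(2) by (auto simp: strip_bounded_def)
    then have "{i. x i \<in> B} \<subseteq> {i. \<bar>fst (x i)\<bar> \<le> h}"
      by (auto simp: mem_Times_iff abs_le_iff)
    then have "finite {i. x i \<in> B}"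
      using lf finite_subset unfolding locally_finite_points_def by blast
    then show ?thesis
      using B(1) by (simp add: emeasure_dirac_sum_count of_nat_less_top)
  qed
  show "dirac_sum UNIV x \<in> point_measures"
    unfolding point_measures_def using 1 2 by blast
qed

lemma point_process_in_point_measures [simp]: "point_process I x \<in> point_measures"
  by (simp add: point_process_def null_measure_in_point_measures)

lemma point_process_eq_dirac_sum:
  fixes x :: "'i::countable \<Rightarrow> real \<times> 'm::topological_space"
  shows "locally_finite_points x \<Longrightarrow> point_process UNIV x = dirac_sum UNIV x"
  by (simp add: point_process_def dirac_sum_in_point_measures_iff)

lemma shift_borel_measurable:
  "(\<lambda>(s, w). (s - t, w)) \<in> measurable borel (borel :: (real \<times> 'm::topological_space) measure)"
  by (intro borel_measurable_continuous_onI) (auto simp: case_prod_beta intro!: continuous_intros)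

lemma shift_measurable_pm:
  assumes "m \<in> point_measures"
  shows "(\<lambda>(s, w). (s - t, w)) \<in> measurable m (borel :: (real \<times> 'm::topological_space) measure)"
  using shift_borel_measurable measurable_cong_sets[OF sets_point_measures[OF assms] refl] by blast

lemma shift_dirac_sum: "shift_measure t (dirac_sum UNIV x) = dirac_sum UNIV (shift_points t x)"
proof -
  have "shift_measure t (dirac_sum UNIV x) = distr (count_space UNIV) borel ((\<lambda>(s, w). (s - t, w)) \<circ> x)"
    unfolding shift_measure_def dirac_sum_def
    by (rule distr_distr) (use shift_borel_measurable in auto)
  also have "(\<lambda>(s, w). (s - t, w)) \<circ> x = shift_points t x"
    by (auto simp: fun_eq_iff shift_points_def split: prod.split)
  finally show ?thesis
    by (simp add: dirac_sum_def)
qed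

lemma shift_point_process:
  fixes x :: "'i::countable \<Rightarrow> real \<times> 'm::topological_space"
  shows "shift_measure t (point_process UNIV x) = point_process UNIV (shift_points t x)"
proof (cases "locally_finite_points x")
  case True
  then show ?thesis
    by (simp add: point_process_eq_dirac_sum shift_dirac_sum)
next
  case False
  have "shift_measure t (null_measure borel) = (null_measure borel :: (real \<times> 'm) measure)"
    unfolding shift_measure_def
    by (intro measure_eqI) (auto simp: emeasure_distr shift_borel_measurable measurable_cong_sets[OF sets_null_measure refl])
  then show ?thesis
    using False by (simp add: point_process_def dirac_sum_in_point_measures_iff)
qed

lemma shift_in_point_measures:
  assumes m: "m \<in> point_measures"
  shows "shift_measure t m \<in> (point_measures :: (real \<times> 'm::topological_space) measure set)"
proof -
  obtain I :: "nat set" and x where x: "m = dirac_sum I x"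
    using m by (auto simp: point_measures_def)
  have 1: "shift_measure t m = dirac_sum I ((\<lambda>(s, w). (s - t, w)) \<circ> x)"
    unfolding shift_measure_def dirac_sum_def x
    by (rule distr_distr) (use shift_borel_measurable in auto)
  have "emeasure (shift_measure t m) B < \<infinity>" if B: "B \<in> sets borel" "strip_bounded B" for B
  proof -
    obtain h where h: "B \<subseteq> strip h"
      using B(2) by (auto simp: strip_bounded_def)
    have "emeasure (shift_measure t m) B = emeasure m ((\<lambda>(s, w). (s - t, w)) -` B \<inter> space m)"
      unfolding shift_measure_def by (rule emeasure_distr[OF shift_measurable_pm[OF m] B(1)])
    also have "\<dots> \<le> emeasure m (strip (h + \<bar>t\<bar>))"
    proof (rule emeasure_mono)
      show "(\<lambda>(s, w). (s - t, w)) -` B \<inter> space m \<subseteq> strip (h + \<bar>t\<bar>)"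
        using h by fastforce
    qed (simp only: sets_point_measures[OF m] strip_sets)
    finally show ?thesis
      using emeasure_strip[OF m] by (rule order_le_less_trans)
  qed
  with 1 show ?thesis
    unfolding point_measures_def by blast
qed

lemma vcoord_point_process:
  fixes x :: "'i::countable \<Rightarrow> real \<times> 'm::polish_space"
  shows "vcoord (point_process UNIV x) k = (if locally_finite_points x
    then enn2real (\<integral>\<^sup>+i. ennreal (test_fun (from_nat k) (x i)) \<partial>count_space UNIV) else 0)"
proof (cases "locally_finite_points x")
  case True
  have f: "test_fun (from_nat k) \<in> borel_measurable (borel :: (real \<times> 'm) measure)" "\<And>z::real \<times> 'm. 0 \<le> test_fun (from_nat k) z"
    using time_lipschitz_test_fun[of "from_nat k"]
    by (auto simp: time_lipschitz_test_def intro: borel_measurable_continuous_onI)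
  have "vcoord (point_process UNIV x) k = (\<integral>z. test_fun (from_nat k) z \<partial>distr (count_space UNIV) borel x)"
    using True by (simp add: vcoord_def point_process_eq_dirac_sum dirac_sum_def)
  also have "\<dots> = enn2real (\<integral>\<^sup>+z. ennreal (test_fun (from_nat k) z) \<partial>distr (count_space UNIV) borel x)"
    using f by (intro integral_eq_nn_integral) auto
  also have "\<dots> = enn2real (\<integral>\<^sup>+i. ennreal (test_fun (from_nat k) (x i)) \<partial>count_space UNIV)"
    using f(1) by (subst nn_integral_distr) auto
  finally show ?thesis
    using True by simp
next
  case False
  have "integral\<^sup>L (null_measure borel) f = 0" for f :: "real \<times> 'm \<Rightarrow> real"
    by (rule integral_null_measure)
  then show ?thesis
    using False by (simp add: vcoord_def point_process_def dirac_sum_in_point_measures_iff)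
qed

lemma finite_iff_bounded_to_nat: "finite (A :: 'i::countable set) \<longleftrightarrow> (\<exists>n. \<forall>i. i \<in> A \<longrightarrow> to_nat i \<le> n)"
proof
  assume "finite A"
  then have "\<forall>i\<in>A. to_nat i \<le> Max (to_nat ` A)"
    by auto
  then show "\<exists>n. \<forall>i. i \<in> A \<longrightarrow> to_nat i \<le> n"
    by blast
next
  assume "\<exists>n. \<forall>i. i \<in> A \<longrightarrow> to_nat i \<le> n"
  then obtain n where "to_nat ` A \<subseteq> {..n}" by auto
  then have "finite (to_nat ` A)"
    by (rule finite_subset) simp
  then show "finite A"
    by (rule finite_imageD) auto
qed

lemma locally_finite_points_iff_nat:
  "locally_finite_points x \<longleftrightarrow> (\<forall>h::nat. finite {i. \<bar>fst (x i)\<bar> \<le> real h})"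
  unfolding locally_finite_points_def
proof safe
  fix h :: real
  assume *: "\<forall>h::nat. finite {i. \<bar>fst (x i)\<bar> \<le> real h}"
  obtain n :: nat where "h \<le> real n"
    using real_arch_simple by blast
  then show "finite {i. \<bar>fst (x i)\<bar> \<le> h}"
    using *[rule_format, of n] by (rule_tac rev_finite_subset) auto
qed blast

lemma fst_borel_measurable [measurable]:
  "fst \<in> measurable (borel :: ('a::topological_space \<times> 'b::topological_space) measure) borel"
  "snd \<in> measurable (borel :: ('a::topological_space \<times> 'b::topological_space) measure) borel"
  by (intro borel_measurable_continuous_onI continuous_intros)+

lemma locally_finite_points_pred [measurable]:
  fixes x :: "'i::countable \<Rightarrow> 'a \<Rightarrow> real \<times> 'm::polish_space"
  assumes [measurable]: "\<And>i. x i \<in> measurable M borel"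
  shows "Measurable.pred M (\<lambda>\<omega>. locally_finite_points (\<lambda>i. x i \<omega>))"
  unfolding locally_finite_points_iff_nat finite_iff_bounded_to_nat mem_Collect_eq by measurable

lemma point_process_measurable:
  fixes x :: "'i::countable \<Rightarrow> 'a \<Rightarrow> real \<times> 'm::polish_space"
  assumes [measurable]: "\<And>i. x i \<in> measurable M borel"
  shows "(\<lambda>\<omega>. point_process UNIV (\<lambda>i. x i \<omega>)) \<in> measurable M (borel_algebra vague_topology)"
proof (rule measurable_vague_if_vcoord)
  fix k
  have [measurable]: "test_fun (from_nat k) \<in> borel_measurable (borel :: (real \<times> 'm) measure)"
    using time_lipschitz_test_fun[of "from_nat k"]
    by (auto simp: time_lipschitz_test_def intro: borel_measurable_continuous_onI)
  interpret C: sigma_finite_measure "count_space (UNIV :: 'i set)"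
    by (rule sigma_finite_measure_count_space_countable) simp
  have "(\<lambda>(\<omega>, i). ennreal (test_fun (from_nat k) (x i \<omega>))) \<in> borel_measurable (M \<Otimes>\<^sub>M count_space UNIV)"
    using measurable_pair_swap[OF measurable_pair_measure_countable1[of UNIV
        "\<lambda>(i, \<omega>). ennreal (test_fun (from_nat k) (x i \<omega>))" M borel]] by simp
  then have [measurable]: "(\<lambda>\<omega>. \<integral>\<^sup>+i. ennreal (test_fun (from_nat k) (x i \<omega>)) \<partial>count_space UNIV) \<in> borel_measurable M"
    by (rule C.borel_measurable_nn_integral)
  show "(\<lambda>\<omega>. vcoord (point_process UNIV (\<lambda>i. x i \<omega>)) k) \<in> borel_measurable M"
    unfolding vcoord_point_process by measurable
qed simp

section \<open>Functionals of a bounded window\<close>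

text \<open>The first property allows points outside the window to be ignored. The second one bounds the change under
  a shift by the number of points near the window, whose expectation will be bounded uniformly in time.\<close>

definition window_lipschitz :: "real \<Rightarrow> real \<Rightarrow> ((real \<times> 'm::topological_space) measure \<Rightarrow> real) \<Rightarrow> bool" where
  "window_lipschitz h C \<Phi> \<longleftrightarrow>
     (\<forall>m\<in>point_measures. \<forall>m'\<in>point_measures.
        (\<forall>A\<in>sets borel. A \<subseteq> strip h \<longrightarrow> emeasure m A = emeasure m' A) \<longrightarrow> \<Phi> m = \<Phi> m') \<and>
     (\<forall>m\<in>point_measures. \<forall>s. \<bar>s\<bar> \<le> 1 \<longrightarrow>
        \<bar>\<Phi> (shift_measure s m) - \<Phi> m\<bar> \<le> C * \<bar>s\<bar> * measure m (strip (h + 1)))"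

definition windowed :: "((real \<times> 'm::topological_space) measure \<Rightarrow> real) \<Rightarrow> bool" where
  "windowed \<Phi> \<longleftrightarrow> (\<exists>h>0. \<exists>C\<ge>0. window_lipschitz h C \<Phi>)"

lemma window_lipschitz_mono:
  assumes \<Phi>: "window_lipschitz h C \<Phi>" and "h \<le> h'" "C \<le> C'" "0 \<le> C'"
  shows "window_lipschitz h' C' \<Phi>"
  unfolding window_lipschitz_def
proof (intro conjI ballI allI impI)
  fix m m' :: "(real \<times> 'a) measure"
  assume m: "m \<in> point_measures" "m' \<in> point_measures"
    and eq: "\<forall>A\<in>sets borel. A \<subseteq> strip h' \<longrightarrow> emeasure m A = emeasure m' A"
  have "strip h \<subseteq> (strip h' :: (real \<times> 'a) set)"
    using \<open>h \<le> h'\<close> by auto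
  then have "\<forall>A\<in>sets borel. A \<subseteq> strip h \<longrightarrow> emeasure m A = emeasure m' A"
    using eq by (meson order_trans)
  then show "\<Phi> m = \<Phi> m'"
    using \<Phi>[unfolded window_lipschitz_def, THEN conjunct1] m by blast
next
  fix m :: "(real \<times> 'a) measure" and s :: real
  assume m: "m \<in> point_measures" and s: "\<bar>s\<bar> \<le> 1"
  have "\<bar>\<Phi> (shift_measure s m) - \<Phi> m\<bar> \<le> C * \<bar>s\<bar> * measure m (strip (h + 1))"
    using \<Phi> m s unfolding window_lipschitz_def by blast
  also have "\<dots> \<le> C' * \<bar>s\<bar> * measure m (strip (h + 1))"
    using assms by (intro mult_right_mono) auto
  also have "measure m (strip (h + 1)) \<le> measure m (strip (h' + 1))"
  proof (rule measure_mono_fmeasurable)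
    show "strip (h + 1) \<subseteq> (strip (h' + 1) :: (real \<times> 'a) set)"
      using assms(2) by auto
    show "strip (h' + 1) \<in> fmeasurable m" "strip (h + 1) \<in> sets m"
      using emeasure_strip[OF m, of "h' + 1"]
      by (simp_all only: fmeasurable_def mem_Collect_eq sets_point_measures[OF m] strip_sets infinity_ennreal_def)
  qed
  then have "C' * \<bar>s\<bar> * measure m (strip (h + 1)) \<le> C' * \<bar>s\<bar> * measure m (strip (h' + 1))"
    using assms by (intro mult_left_mono) auto
  finally show "\<bar>\<Phi> (shift_measure s m) - \<Phi> m\<bar> \<le> C' * \<bar>s\<bar> * measure m (strip (h' + 1))" .
qed

lemma windowed_binary:
  assumes f: "windowed f" and g: "windowed g"
    and op: "\<And>a b a' b'. \<bar>op a b - op a' b'\<bar> \<le> \<bar>a - a'\<bar> + \<bar>b - b'\<bar>"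
  shows "windowed (\<lambda>m. op (f m) (g m))"
proof -
  obtain hf Cf hg Cg where "hf > 0" "Cf \<ge> 0" "window_lipschitz hf Cf f" "hg > 0" "Cg \<ge> 0" "window_lipschitz hg Cg g"
    using f g unfolding windowed_def by blast
  define h C where "h = max hf hg" and "C = max Cf Cg"
  have hC: "h > 0" "C \<ge> 0"
    using \<open>hf > 0\<close> \<open>Cf \<ge> 0\<close> by (auto simp: h_def C_def)
  have fg: "window_lipschitz h C f" "window_lipschitz h C g"
    using \<open>window_lipschitz hf Cf f\<close> \<open>window_lipschitz hg Cg g\<close> \<open>Cf \<ge> 0\<close>
    by (auto simp: h_def C_def intro: window_lipschitz_mono)
  have "window_lipschitz h (C + C) (\<lambda>m. op (f m) (g m))"
    unfolding window_lipschitz_def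
  proof (intro conjI ballI allI impI)
    fix m m' :: "(real \<times> 'a) measure"
    assume "m \<in> point_measures" "m' \<in> point_measures"
      "\<forall>A\<in>sets borel. A \<subseteq> strip h \<longrightarrow> emeasure m A = emeasure m' A"
    then have "f m = f m'" "g m = g m'"
      using fg unfolding window_lipschitz_def by blast+
    then show "op (f m) (g m) = op (f m') (g m')"
      by simp
  next
    fix m :: "(real \<times> 'a) measure" and s :: real
    assume "m \<in> point_measures" "\<bar>s\<bar> \<le> 1"
    then have "\<bar>f (shift_measure s m) - f m\<bar> \<le> C * \<bar>s\<bar> * measure m (strip (h + 1))"
      "\<bar>g (shift_measure s m) - g m\<bar> \<le> C * \<bar>s\<bar> * measure m (strip (h + 1))"
      using fg unfolding window_lipschitz_def by blast+
    then show "\<bar>op (f (shift_measure s m)) (g (shift_measure s m)) - op (f m) (g m)\<bar>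
        \<le> (C + C) * \<bar>s\<bar> * measure m (strip (h + 1))"
      using op[of "f (shift_measure s m)" "g (shift_measure s m)" "f m" "g m"]
      by (simp add: algebra_simps)
  qed
  then show ?thesis
    unfolding windowed_def using hC by (intro exI[of _ h] exI[of _ "C + C"] conjI) auto
qed

lemma windowed_unary:
  assumes f: "windowed f" and u: "\<And>a b. \<bar>u a - u b\<bar> \<le> K * \<bar>a - b\<bar>" and "K \<ge> 0"
  shows "windowed (\<lambda>m. u (f m))"
proof -
  obtain h C where hC: "h > 0" "C \<ge> 0" "window_lipschitz h C f"
    using f unfolding windowed_def by blast
  have "window_lipschitz h (K * C) (\<lambda>m. u (f m))"
    unfolding window_lipschitz_def
  proof (intro conjI ballI allI impI)
    fix m m' :: "(real \<times> 'a) measure"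
    assume "m \<in> point_measures" "m' \<in> point_measures"
      "\<forall>A\<in>sets borel. A \<subseteq> strip h \<longrightarrow> emeasure m A = emeasure m' A"
    then have "f m = f m'"
      using hC(3) unfolding window_lipschitz_def by blast
    then show "u (f m) = u (f m')"
      by simp
  next
    fix m :: "(real \<times> 'a) measure" and s :: real
    assume "m \<in> point_measures" "\<bar>s\<bar> \<le> 1"
    then have "\<bar>f (shift_measure s m) - f m\<bar> \<le> C * \<bar>s\<bar> * measure m (strip (h + 1))"
      using hC(3) unfolding window_lipschitz_def by blast
    then have "K * \<bar>f (shift_measure s m) - f m\<bar> \<le> K * (C * \<bar>s\<bar> * measure m (strip (h + 1)))"
      using \<open>K \<ge> 0\<close> by (rule mult_left_mono)
    then show "\<bar>u (f (shift_measure s m)) - u (f m)\<bar> \<le> K * C * \<bar>s\<bar> * measure m (strip (h + 1))"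
      using u[of "f (shift_measure s m)" "f m"] by (simp add: mult.assoc)
  qed
  then show ?thesis
    unfolding windowed_def using hC \<open>K \<ge> 0\<close> by (intro exI[of _ h] exI[of _ "K * C"] conjI) auto
qed

lemma windowed_const: "windowed (\<lambda>_. c)"
  unfolding windowed_def window_lipschitz_def by (intro exI[of _ 1] exI[of _ 0]) auto

lemma windowed_vcoord: "windowed (\<lambda>m :: (real \<times> 'm::polish_space) measure. vcoord m k)"
proof -
  define f :: "real \<times> 'm \<Rightarrow> real" where "f = test_fun (from_nat k)"
  have tl: "time_lipschitz_test f"
    unfolding f_def by (rule time_lipschitz_test_fun)
  then have test: "f \<in> vague_test"
    by (rule time_lipschitz_test_imp_vague_test)
  note [measurable] = vague_test_measurable[OF test]
  obtain h K where hK: "h > 0" "\<And>z. f z \<noteq> 0 \<Longrightarrow> \<bar>fst z\<bar> \<le> h" "K \<ge> 0"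
    "\<And>s s' w. \<bar>f (s, w) - f (s', w)\<bar> \<le> K * \<bar>s - s'\<bar>"
    using tl unfolding time_lipschitz_test_def by blast
  have meas: "f \<in> borel_measurable m" if "m \<in> point_measures" for m
    using that vague_test_measurable[OF test] measurable_cong_sets[OF sets_point_measures refl] by blast
  have agree: "vcoord m k = vcoord m' k"
    if m: "m \<in> point_measures" "m' \<in> point_measures"
      and eq: "\<forall>A\<in>sets borel. A \<subseteq> strip h \<longrightarrow> emeasure m A = emeasure m' A"
    for m m' :: "(real \<times> 'm) measure"
  proof -
    have *: "(\<integral>z. f z \<partial>m) = (\<integral>z. f z \<partial>density m (indicator (strip h)))" if "m \<in> point_measures" for m
    proof -
      have "(\<integral>z. f z \<partial>density m (indicator (strip h))) = (\<integral>z. f z \<partial>density m (\<lambda>z. ennreal (indicator (strip h) z)))"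
        by (simp add: ennreal_indicator)
      also have "\<dots> = (\<integral>z. indicator (strip h) z *\<^sub>R f z \<partial>m)"
        using meas[OF that] strip_sets[of h]
        by (intro integral_density borel_measurable_indicator) (simp_all only: sets_point_measures[OF that], auto)
      also have "\<dots> = (\<integral>z. f z \<partial>m)"
        using hK(2) by (intro Bochner_Integration.integral_cong) (force simp: indicator_def mem_Times_iff)+
      finally show ?thesis ..
    qed
    have "density m (indicator (strip h)) = density m' (indicator (strip h))"
    proof (rule measure_eqI)
      show "sets (density m (indicator (strip h))) = sets (density m' (indicator (strip h)))"
        using m by (simp add: sets_point_measures)
      fix A assume "A \<in> sets (density m (indicator (strip h)))"
      then have A: "A \<in> sets borel"
        using m by (simp add: sets_point_measures)
      have "emeasure m (strip h \<inter> A) = emeasure m' (strip h \<inter> A)"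
        using eq A by (metis Int_lower1 sets.Int strip_sets)
      then show "emeasure (density m (indicator (strip h))) A = emeasure (density m' (indicator (strip h))) A"
        using m A by (simp add: emeasure_restricted sets_point_measures)
    qed
    then show ?thesis
      using *[OF m(1)] *[OF m(2)] by (simp add: vcoord_def flip: f_def)
  qed
  have shift: "\<bar>vcoord (shift_measure s m) k - vcoord m k\<bar> \<le> K * \<bar>s\<bar> * measure m (strip (h + 1))"
    if m: "m \<in> point_measures" and s: "\<bar>s\<bar> \<le> 1" for m :: "(real \<times> 'm) measure" and s
  proof -
    note sh = shift_measurable_pm[OF m, of s]
    let ?g = "\<lambda>z. f (fst z - s, snd z)"
    have g: "(\<integral>z. f z \<partial>shift_measure s m) = (\<integral>z. ?g z \<partial>m)"
      unfolding shift_measure_def by (subst integral_distr[OF sh]) (auto simp: case_prod_beta)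
    have intg: "integrable m ?g"
      using integrable_vague_test[OF shift_in_point_measures[OF m] test, of s] unfolding shift_measure_def
      by (subst (asm) integrable_distr_eq[OF sh]) (auto simp: case_prod_beta)
    note intf = integrable_vague_test[OF m test]
    have b: "\<bar>?g z - f z\<bar> \<le> K * \<bar>s\<bar> * indicator (strip (h + 1)) z" for z
    proof (cases "z \<in> strip (h + 1)")
      case True
      then show ?thesis
        using hK(4)[of "fst z - s" "snd z" "fst z"] by simp
    next
      case False
      then have z: "\<bar>fst z\<bar> > h + 1"
        by (cases z) auto
      have "f z = 0"
        using hK(2)[of z] z by linarith
      moreover have "?g z = 0"
        using hK(2)[of "(fst z - s, snd z)"] z s by fastforce
      ultimately show ?thesis using False by simp
    qed
    have "\<bar>vcoord (shift_measure s m) k - vcoord m k\<bar> = \<bar>\<integral>z. ?g z - f z \<partial>m\<bar>"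
      using intg intf g by (simp add: vcoord_def flip: f_def)
    also have "\<dots> \<le> (\<integral>z. \<bar>?g z - f z\<bar> \<partial>m)"
      by (rule integral_abs_bound)
    also have "\<dots> \<le> (\<integral>z. K * \<bar>s\<bar> * indicator (strip (h + 1)) z \<partial>m)"
      by (intro integral_mono integrable_mult_right integrable_real_indicator
          Bochner_Integration.integrable_abs Bochner_Integration.integrable_diff intg intf b
          emeasure_strip[OF m]) (simp only: sets_point_measures[OF m] strip_sets)
    also have "\<dots> = K * \<bar>s\<bar> * measure m (strip (h + 1))"
      by (simp add: space_point_measures[OF m])
    finally show ?thesis .
  qed
  have "window_lipschitz h K (\<lambda>m :: (real \<times> 'm) measure. vcoord m k)"
    unfolding window_lipschitz_def using agree shift by blast
  then show ?thesis
    unfolding windowed_def using hK by blast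
qed

lemma windowed_vdist: "windowed (vdist q :: (real \<times> 'm::polish_space) measure \<Rightarrow> real)"
proof -
  have "windowed (\<lambda>m :: (real \<times> 'm) measure. \<Sum>k<n. \<bar>vcoord m k - r k\<bar>)" for n and r :: "nat \<Rightarrow> real"
  proof (induction n)
    case 0
    then show ?case using windowed_const[of 0] by simp
  next
    case (Suc n)
    have abs: "windowed (\<lambda>m :: (real \<times> 'm) measure. \<bar>vcoord m n - r n\<bar>)"
      by (rule windowed_unary[OF windowed_vcoord, where K = 1]) auto
    have "windowed (\<lambda>m :: (real \<times> 'm) measure. (\<Sum>k<n. \<bar>vcoord m k - r k\<bar>) + \<bar>vcoord m n - r n\<bar>)"
      by (rule windowed_binary[OF Suc abs, where op = "(+)"]) linarith
    then show ?case
      by simp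
  qed
  from this[where n = "length q" and r = "\<lambda>k. of_rat (q ! k)"] show ?thesis
    by (simp add: vdist_def[abs_def])
qed

lemma windowed_maxl: "windowed (maxl (tents vdist) L :: (real \<times> 'm::polish_space) measure \<Rightarrow> real)"
proof (induction L)
  case Nil
  have "maxl (tents vdist) [] = (\<lambda>_ :: (real \<times> 'm) measure. 0)" by auto
  then show ?case using windowed_const by (simp only:)
next
  case (Cons a L)
  obtain q r c where a: "a = (q, r, c)" by (cases a)
  have eq: "maxl (tents vdist) (a # L) =
      (\<lambda>m :: (real \<times> 'm) measure. max (tent (vdist q m) (of_rat r) (of_rat c)) (maxl (tents vdist) L m))"
    using a by auto
  have "windowed (\<lambda>m :: (real \<times> 'm) measure. tent (vdist q m) (of_rat r) (of_rat c))"
    by (rule windowed_unary[OF windowed_vdist tent_lipschitz]) auto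
  then show ?case
    unfolding eq by (rule windowed_binary[OF _ Cons, where op = max]) linarith
qed

lemma maxl_tents_bounded:
  assumes "\<And>j z. 0 \<le> d j z"
  shows "\<exists>B. \<forall>z. maxl (tents d) L z \<le> B"
proof (induction L)
  case (Cons a L)
  then obtain B where "\<And>z. maxl (tents d) L z \<le> B" by blast
  moreover obtain q r c where "a = (q, r, c)" by (cases a)
  ultimately have "maxl (tents d) (a # L) z \<le> max (max 0 (of_rat c)) B" for z
    using tent_le[OF assms, of q z "of_rat r" "of_rat c"] by (auto intro: max.mono le_max_iff_disj[THEN iffD2])
  then show ?case by blast
qed auto

text \<open>Two processes that differ only by relabelling and by points outside the window give the same value.
  With \<open>\<pi> = Suc\<close> this removes the first renewal, with \<open>\<pi> = int\<close> the points on the negative half-line.\<close>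

lemma window_lipschitz_point_process_eq:
  fixes x :: "'i::countable \<Rightarrow> real \<times> 'm::topological_space" and y :: "'j::countable \<Rightarrow> real \<times> 'm"
  assumes \<Phi>: "window_lipschitz h C \<Phi>" and lf: "locally_finite_points x" "locally_finite_points y"
    and \<pi>: "inj \<pi>" "\<And>i. y (\<pi> i) = x i" "\<And>j. j \<notin> range \<pi> \<Longrightarrow> h < \<bar>fst (y j)\<bar>"
  shows "\<Phi> (point_process UNIV y) = \<Phi> (point_process UNIV x)"
proof -
  have "emeasure (point_process UNIV y) A = emeasure (point_process UNIV x) A"
    if A: "A \<in> sets borel" "A \<subseteq> strip h" for A
  proof -
    have eq: "{j. y j \<in> A} = \<pi> ` {i. x i \<in> A}"
    proof (intro equalityI subsetI)
      fix j assume j: "j \<in> {j. y j \<in> A}"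
      then have "y j \<in> strip h" using A(2) by blast
      then have "\<bar>fst (y j)\<bar> \<le> h" by (auto simp: mem_Times_iff abs_le_iff)
      then have "j \<in> range \<pi>" using \<pi>(3)[of j] by force
      then obtain i where "j = \<pi> i" by blast
      then show "j \<in> \<pi> ` {i. x i \<in> A}" using j \<pi>(2)[of i] by auto
    qed (auto simp: \<pi>(2))
    have inj: "inj_on \<pi> {i. x i \<in> A}"
      using \<pi>(1) by (rule inj_on_subset) simp
    show ?thesis
      using A(1) lf inj
      by (simp add: point_process_eq_dirac_sum emeasure_dirac_sum_count eq emeasure_count_space
          finite_image_iff card_image)
  qed
  then show ?thesis
    using \<Phi>[unfolded window_lipschitz_def, THEN conjunct1]
      point_process_in_point_measures[of UNIV x] point_process_in_point_measures[of UNIV y] by blast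
qed

section \<open>Asymptotically harmonic functions for a nonarithmetic law\<close>

lemma filterlim_add_const_at_top:
  fixes u :: "'a \<Rightarrow> real"
  shows "filterlim u at_top F \<Longrightarrow> filterlim (\<lambda>x. u x + c) at_top F"
  using filterlim_tendsto_add_at_top[OF tendsto_const[of c], of u F] by (simp add: add.commute)

lemma continuous_on_if_modulus:
  fixes f :: "real \<Rightarrow> real"
  assumes "\<And>e. e > 0 \<Longrightarrow> \<exists>\<delta>>0. \<forall>u v. \<bar>u - v\<bar> \<le> \<delta> \<longrightarrow> \<bar>f u - f v\<bar> \<le> e"
  shows "continuous_on UNIV f"
  unfolding continuous_on_iff
proof (intro ballI allI impI)
  fix x e :: real assume "e > 0"
  then obtain \<delta> where \<delta>: "\<delta> > 0" "\<And>u v. \<bar>u - v\<bar> \<le> \<delta> \<Longrightarrow> \<bar>f u - f v\<bar> \<le> e / 2"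
    using assms[of "e / 2"] by auto
  have "dist (f x') (f x) < e" if "dist x' x < \<delta>" for x'
    using \<delta>(2)[of x' x] that \<open>e > 0\<close> by (simp add: dist_real_def)
  then show "\<exists>d>0. \<forall>x'\<in>UNIV. dist x' x < d \<longrightarrow> dist (f x') (f x) < e"
    using \<delta>(1) by blast
qed

lemma additive_set_small_gap:
  fixes \<Gamma> :: "real set"
  assumes \<Gamma>: "0 \<in> \<Gamma>" "\<And>a b. a \<in> \<Gamma> \<Longrightarrow> b \<in> \<Gamma> \<Longrightarrow> a + b \<in> \<Gamma>" "\<And>a. a \<in> \<Gamma> \<Longrightarrow> 0 \<le> a"
    and nonlattice: "\<And>h. h > 0 \<Longrightarrow> \<exists>y\<in>\<Gamma>. \<forall>k::int. y \<noteq> of_int k * h"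
    and \<delta>: "\<delta> > 0"
  shows "\<exists>a\<in>\<Gamma>. \<exists>b\<in>\<Gamma>. a < b \<and> b - a \<le> \<delta>"
proof (rule ccontr)
  assume none: "\<not> ?thesis"
  \<comment> \<open>The differences form a group without small positive elements, which is generated by its least
    positive element.\<close>
  define G where "G = {b - a | a b. a \<in> \<Gamma> \<and> b \<in> \<Gamma>}"
  have sub: "x - y \<in> G" if "x \<in> G" "y \<in> G" for x y
  proof -
    from that(1) obtain a b where ab: "x = b - a" "a \<in> \<Gamma>" "b \<in> \<Gamma>"
      unfolding G_def by blast
    from that(2) obtain c d where cd: "y = d - c" "c \<in> \<Gamma>" "d \<in> \<Gamma>"
      unfolding G_def by blast
    have "x - y = (b + c) - (a + d)"
      using ab(1) cd(1) by simp
    then show ?thesis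
      unfolding G_def using \<Gamma>(2)[OF ab(2) cd(3)] \<Gamma>(2)[OF ab(3) cd(2)] by blast
  qed
  have \<Gamma>G: "y \<in> G" if "y \<in> \<Gamma>" for y
    unfolding G_def using that \<Gamma>(1) by force
  have mult: "of_nat k * g \<in> G" if "g \<in> G" for k g
  proof (induction k)
    case 0
    then show ?case using \<Gamma>G[OF \<Gamma>(1)] by simp
  next
    case (Suc k)
    have "0 - g \<in> G" using sub[OF \<Gamma>G[OF \<Gamma>(1)] that] .
    from sub[OF Suc this] show ?case by (simp add: algebra_simps)
  qed
  have gap: "\<delta> < g" if "g \<in> G" "0 < g" for g
    using none that unfolding G_def by force
  define g0 where "g0 = Inf {g \<in> G. 0 < g}"
  obtain y where y: "y \<in> \<Gamma>" "\<And>k::int. y \<noteq> of_int k * 1"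
    using nonlattice[of 1] by auto
  have "0 < y"
    using \<Gamma>(3)[OF y(1)] y(2)[of 0] by simp
  then have ne: "{g \<in> G. 0 < g} \<noteq> {}"
    using \<Gamma>G[OF y(1)] by blast
  have bdd: "bdd_below {g \<in> G. 0 < g}"
    by (rule bdd_belowI[of _ 0]) auto
  obtain g where g: "g \<in> G" "0 < g" "g < g0 + \<delta>"
    using cInf_lessD[OF ne, of "g0 + \<delta>"] \<delta> by (auto simp: g0_def)
  have min: "g \<le> g'" if "g' \<in> G" "0 < g'" for g'
  proof (rule ccontr)
    assume "\<not> g \<le> g'"
    then have "\<delta> < g - g'"
      using gap[OF sub[OF g(1) that(1)]] by simp
    moreover have "g0 \<le> g'"
      unfolding g0_def using that by (intro cInf_lower bdd) auto
    ultimately show False using g(3) by simp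
  qed
  obtain z where z: "z \<in> \<Gamma>" "\<And>k::int. z \<noteq> of_int k * g"
    using nonlattice[OF g(2)] by blast
  define k where "k = nat \<lfloor>z / g\<rfloor>"
  have k: "of_nat k = (of_int \<lfloor>z / g\<rfloor> :: real)"
    using \<Gamma>(3)[OF z(1)] g(2) by (simp add: k_def)
  have "of_nat k * g \<le> z" "z < (of_nat k + 1) * g"
    using floor_divide_lower[OF g(2), of "z"] floor_divide_upper[OF g(2), of "z"] unfolding k by auto
  moreover have "z - of_nat k * g \<in> G"
    using sub[OF \<Gamma>G[OF z(1)] mult[OF g(1)]] .
  ultimately have "z = of_nat k * g"
    using min[of "z - of_nat k * g"] by (force simp: algebra_simps)
  then show False
    using z(2)[of "int k"] by simp
qed

text \<open>For \<open>a < b\<close> in \<open>\<Gamma>\<close> the sums of \<open>m\<close> copies of \<open>a\<close> or \<open>b\<close> run from \<open>m * a\<close> to \<open>m * b\<close> in steps of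
  \<open>b - a\<close>, and these ranges overlap for consecutive large \<open>m\<close>.\<close>

lemma additive_set_asymptotically_dense:
  fixes \<Gamma> :: "real set"
  assumes \<Gamma>: "0 \<in> \<Gamma>" "\<And>a b. a \<in> \<Gamma> \<Longrightarrow> b \<in> \<Gamma> \<Longrightarrow> a + b \<in> \<Gamma>" "\<And>a. a \<in> \<Gamma> \<Longrightarrow> 0 \<le> a"
    and nonlattice: "\<And>h. h > 0 \<Longrightarrow> \<exists>y\<in>\<Gamma>. \<forall>k::int. y \<noteq> of_int k * h"
    and \<delta>: "\<delta> > 0"
  shows "\<exists>Y. \<forall>y\<ge>Y. \<exists>g\<in>\<Gamma>. \<bar>y - g\<bar> \<le> \<delta>"
proof -
  obtain a0 b0 where ab0: "a0 \<in> \<Gamma>" "b0 \<in> \<Gamma>" "a0 < b0" "b0 - a0 \<le> \<delta>"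
    using additive_set_small_gap[OF assms] by blast
  \<comment> \<open>Adding \<open>b0\<close> to both makes \<open>a\<close> positive without changing the gap.\<close>
  define a b d where "a = a0 + b0" "b = b0 + b0" "d = b - a"
  have ab: "a \<in> \<Gamma>" "b \<in> \<Gamma>" "0 < a" "0 < d" "d \<le> \<delta>"
    unfolding a_b_d_def using ab0 \<Gamma>(2)[OF ab0(1,2)] \<Gamma>(2)[OF ab0(2,2)] \<Gamma>(3)[OF ab0(1)] by linarith+
  have mult: "of_nat k * g \<in> \<Gamma>" if "g \<in> \<Gamma>" for k g
    using that \<Gamma>(1,2) by (induction k) (auto simp: algebra_simps)
  obtain n :: nat where n: "a / d \<le> real n"
    using real_arch_simple by blast
  then have n: "a \<le> real n * d"
    using ab by (simp add: field_simps)
  show ?thesis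
  proof (intro exI[of _ "real n * a"] allI impI)
    fix y assume y: "real n * a \<le> y"
    have y0: "0 \<le> y"
      using y ab(3) by (meson mult_nonneg_nonneg of_nat_0_le_iff order_less_imp_le order_trans)
    define m where "m = nat \<lfloor>y / a\<rfloor>"
    have m: "of_nat m = (of_int \<lfloor>y / a\<rfloor> :: real)"
      using y0 ab(3) by (simp add: m_def)
    have m1: "real m * a \<le> y" "y < (real m + 1) * a"
      using floor_divide_lower[OF ab(3), of "y"] floor_divide_upper[OF ab(3), of "y"] unfolding m by auto
    define k where "k = nat \<lfloor>(y - real m * a) / d\<rfloor>"
    have k: "of_nat k = (of_int \<lfloor>(y - real m * a) / d\<rfloor> :: real)"
      using m1 ab(4) by (simp add: k_def)
    have k1: "real k * d \<le> y - real m * a" "y - real m * a < (real k + 1) * d"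
      using floor_divide_lower[OF ab(4), of "y - real m * a"] floor_divide_upper[OF ab(4), of "y - real m * a"] unfolding k by auto
    have "real n * a < (real m + 1) * a"
      using y m1(2) by linarith
    then have "n \<le> m"
      using ab(3) by (simp add: mult_less_cancel_right)
    then have "real n * d \<le> real m * d"
      using ab(4) by (intro mult_right_mono) auto
    moreover have "y - real m * a < a"
      using m1(2) by (simp add: algebra_simps)
    ultimately have "real k * d < real m * d"
      using k1(1) n by linarith
    then have "k \<le> m"
      using ab(4) by (simp add: mult_less_cancel_right)
    then have "real m * a + real k * d = real (m - k) * a + real k * b"
      by (simp add: a_b_d_def algebra_simps of_nat_diff)
    moreover have "real (m - k) * a + real k * b \<in> \<Gamma>"
      by (intro \<Gamma>(2) mult ab)
    moreover have "\<bar>y - (real m * a + real k * d)\<bar> \<le> \<delta>"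
      using k1 ab(5) by (simp add: algebra_simps)
    ultimately show "\<exists>g\<in>\<Gamma>. \<bar>y - g\<bar> \<le> \<delta>"
      by (intro bexI[of _ "real m * a + real k * d"]) auto
  qed
qed

lemma AE_in_support:
  fixes F :: "real measure"
  assumes "prob_space F" "sets F = sets borel"
  shows "AE y in F. \<forall>\<delta>>0. 0 < measure F {y - \<delta><..<y + \<delta>}"
proof -
  interpret prob_space F by fact
  define N where "N = {i :: rat \<times> rat. {of_rat (fst i)<..<of_rat (snd i)} \<in> null_sets F}"
  have "(\<Union>i\<in>N. {of_rat (fst i)<..<of_rat (snd i)}) \<in> null_sets F"
    by (intro null_sets_UN' countableI_type) (auto simp: N_def)
  then show ?thesis
  proof (rule AE_I')
    show "{y \<in> space F. \<not> (\<forall>\<delta>>0. 0 < measure F {y - \<delta><..<y + \<delta>})} \<subseteq> (\<Union>i\<in>N. {of_rat (fst i)<..<of_rat (snd i)})"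
    proof
      fix y assume "y \<in> {y \<in> space F. \<not> (\<forall>\<delta>>0. 0 < measure F {y - \<delta><..<y + \<delta>})}"
      then obtain \<delta> where \<delta>: "\<delta> > 0" "measure F {y - \<delta><..<y + \<delta>} = 0"
        by (auto simp: not_less measure_le_0_iff)
      obtain p where p: "y - \<delta> < of_rat p" "of_rat p < y"
        using of_rat_dense[of "y - \<delta>" y] \<delta> by auto
      obtain q where q: "y < of_rat q" "of_rat q < y + \<delta>"
        using of_rat_dense[of y "y + \<delta>"] \<delta> by auto
      have "{y - \<delta><..<y + \<delta>} \<in> null_sets F"
        using \<delta> assms(2) by (auto simp: null_sets_def emeasure_eq_measure)
      then have "{of_rat p<..<of_rat q} \<in> null_sets F"
        by (rule null_sets_subset) (use p q assms(2) in auto)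
      then have "(p, q) \<in> N"
        by (simp add: N_def)
      then show "y \<in> (\<Union>i\<in>N. {of_rat (fst i)<..<of_rat (snd i)})"
        using p q by force
    qed
  qed
qed

lemma tendsto_upper_limit:
  fixes D :: "real \<Rightarrow> real" and \<eta> :: real
  assumes up: "\<And>\<epsilon>. \<epsilon> > 0 \<Longrightarrow> \<forall>\<^sub>F t in at_top. D t \<le> \<eta> + \<epsilon>"
    and u: "filterlim u at_top sequentially"
    and low: "\<And>\<epsilon>. \<epsilon> > 0 \<Longrightarrow> \<forall>\<^sub>F n in sequentially. \<eta> - \<epsilon> \<le> D (u n)"
  shows "(\<lambda>n. D (u n)) \<longlonglongrightarrow> \<eta>"
proof (rule tendstoI)
  fix \<epsilon> :: real assume "\<epsilon> > 0"
  then have "\<epsilon> / 2 > 0" by simp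
  from eventually_compose_filterlim[OF up[OF this] u] low[OF this]
  show "\<forall>\<^sub>F n in sequentially. dist (D (u n)) \<eta> < \<epsilon>"
    by eventually_elim (use \<open>\<epsilon> > 0\<close> in \<open>simp add: dist_real_def abs_less_iff\<close>)
qed

text \<open>As \<open>D (u n)\<close> is asymptotically the average of \<open>D (u n - x)\<close>, and these values cannot exceed \<open>\<eta>\<close> in the
  limit, they converge to \<open>\<eta>\<close> in mean. Uniform continuity turns this into convergence at each point of the
  support.\<close>

lemma upper_limit_spreads:
  fixes F :: "real measure" and D :: "real \<Rightarrow> real"
  assumes F: "prob_space F" "sets F = sets borel"
    and bdd: "\<And>t. \<bar>D t\<bar> \<le> B" and [measurable]: "D \<in> borel_measurable borel"
    and uc: "\<And>e. e > 0 \<Longrightarrow> \<exists>\<delta>>0. \<forall>u v. \<bar>u - v\<bar> \<le> \<delta> \<longrightarrow> \<bar>D u - D v\<bar> \<le> e"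
    and harm: "((\<lambda>t. D t - (\<integral>x. D (t - x) \<partial>F)) \<longlongrightarrow> 0) at_top"
    and up: "\<And>\<epsilon>. \<epsilon> > 0 \<Longrightarrow> \<forall>\<^sub>F t in at_top. D t \<le> \<eta> + \<epsilon>"
    and u: "filterlim u at_top sequentially" and Du: "(\<lambda>n. D (u n)) \<longlonglongrightarrow> \<eta>"
    and y: "\<And>\<delta>. \<delta> > 0 \<Longrightarrow> 0 < measure F {y - \<delta><..<y + \<delta>}"
  shows "(\<lambda>n. D (u n - y)) \<longlonglongrightarrow> \<eta>"
proof -
  interpret prob_space F by fact
  note F(2)[measurable_cong]
  have B0: "0 \<le> B"
    using bdd[of 0] by linarith
  have intD: "integrable F (\<lambda>x. D (t - x))" for t
    by (rule integrable_const_bound[where B = B]) (use bdd in auto)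
  have shift_top: "filterlim (\<lambda>n. u n - x) at_top sequentially" for x
    using filterlim_add_const_at_top[OF u, of "- x"] by simp
  show ?thesis
  proof (rule tendsto_upper_limit[OF up])
    show "filterlim (\<lambda>n. u n - y) at_top sequentially"
      by (rule shift_top)
    fix \<epsilon> :: real assume \<epsilon>: "\<epsilon> > 0"
    have "(\<lambda>n. \<integral>x. D (u n - x) \<partial>F) \<longlonglongrightarrow> \<eta>"
      using tendsto_diff[OF Du filterlim_compose[OF harm u]] by simp
    moreover have pos: "(\<lambda>n. \<integral>x. max 0 (D (u n - x) - \<eta>) \<partial>F) \<longlonglongrightarrow> (\<integral>x. 0 \<partial>F)"
    proof (rule integral_dominated_convergence[where w = "\<lambda>_. B + \<bar>\<eta>\<bar>"])
      show "AE x in F. (\<lambda>n. max 0 (D (u n - x) - \<eta>)) \<longlonglongrightarrow> 0"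
      proof (intro AE_I2 tendstoI)
        fix x \<epsilon> :: real assume "\<epsilon> > 0"
        then have "\<epsilon> / 2 > 0" by simp
        from eventually_compose_filterlim[OF up[OF this] shift_top[of x]]
        show "\<forall>\<^sub>F n in sequentially. dist (max 0 (D (u n - x) - \<eta>)) 0 < \<epsilon>"
          by eventually_elim (use \<open>\<epsilon> > 0\<close> in \<open>auto simp: max_def\<close>)
      qed
      show "AE x in F. norm (max 0 (D (u n - x) - \<eta>)) \<le> B + \<bar>\<eta>\<bar>" for n
      proof (rule AE_I2)
        fix x
        show "norm (max 0 (D (u n - x) - \<eta>)) \<le> B + \<bar>\<eta>\<bar>"
          using bdd[of "u n - x"] B0 by (auto simp: max_def)
      qed
    qed auto
    ultimately have "(\<lambda>n. (\<integral>x. max 0 (D (u n - x) - \<eta>) \<partial>F) - ((\<integral>x. D (u n - x) \<partial>F) - \<eta>)) \<longlonglongrightarrow> 0 - (\<eta> - \<eta>)"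
      by (intro tendsto_intros) auto
    moreover have "(\<integral>x. max 0 (\<eta> - D (u n - x)) \<partial>F)
        = (\<integral>x. max 0 (D (u n - x) - \<eta>) \<partial>F) - ((\<integral>x. D (u n - x) \<partial>F) - \<eta>)" for n
    proof -
      have "integrable F (\<lambda>x. max 0 (D (u n - x) - \<eta>))"
        using intD by (intro Bochner_Integration.integrable_max) auto
      moreover have "(\<integral>x. max 0 (\<eta> - D (u n - x)) \<partial>F) = (\<integral>x. max 0 (D (u n - x) - \<eta>) - (D (u n - x) - \<eta>) \<partial>F)"
        by (intro Bochner_Integration.integral_cong) auto
      ultimately show ?thesis
        using intD by (simp add: prob_space)
    qed
    ultimately have neg: "(\<lambda>n. \<integral>x. max 0 (\<eta> - D (u n - x)) \<partial>F) \<longlonglongrightarrow> 0"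
      by simp
    obtain \<delta> where \<delta>: "\<delta> > 0" "\<And>u v. \<bar>u - v\<bar> \<le> \<delta> \<Longrightarrow> \<bar>D u - D v\<bar> \<le> \<epsilon> / 2"
      using uc[of "\<epsilon> / 2"] \<epsilon> by auto
    let ?I = "{y - \<delta><..<y + \<delta>}"
    have "0 < \<epsilon> / 2 * measure F ?I"
      using \<epsilon> y[OF \<delta>(1)] by simp
    from order_tendstoD(2)[OF neg this]
    show "\<forall>\<^sub>F n in sequentially. \<eta> - \<epsilon> \<le> D (u n - y)"
    proof eventually_elim
      case (elim n)
      show ?case
      proof (rule ccontr)
        assume *: "\<not> \<eta> - \<epsilon> \<le> D (u n - y)"
        have "\<epsilon> / 2 * measure F ?I = (\<integral>x. \<epsilon> / 2 * indicator ?I x \<partial>F)"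
          by (simp add: F(2) sets_eq_imp_space_eq[OF F(2)])
        also have "\<dots> \<le> (\<integral>x. max 0 (\<eta> - D (u n - x)) \<partial>F)"
        proof (rule integral_mono)
          show "integrable F (\<lambda>x. max 0 (\<eta> - D (u n - x)))"
            using intD by (intro Bochner_Integration.integrable_max) auto
          show "integrable F (\<lambda>x. \<epsilon> / 2 * indicator ?I x)"
            by (intro integrable_mult_right integrable_real_indicator) (auto simp: F(2) emeasure_eq_measure)
          fix x
          show "\<epsilon> / 2 * indicator ?I x \<le> max 0 (\<eta> - D (u n - x))"
          proof (cases "x \<in> ?I")
            case True
            then have "\<bar>D (u n - x) - D (u n - y)\<bar> \<le> \<epsilon> / 2"
              by (intro \<delta>(2)) (auto simp: abs_le_iff)
            then have "\<epsilon> / 2 \<le> max 0 (\<eta> - D (u n - x))"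
              using * by linarith
            then show ?thesis
              using True by simp
          qed simp
        qed
        finally show False
          using elim by simp
      qed
    qed
  qed
qed

text \<open>Let \<open>\<eta>\<close> be the upper limit of the increments \<open>D t = H (t + s) - H t\<close>, attained along \<open>t\<^sub>n\<close>. Then \<open>D\<close> tends
  to \<open>\<eta>\<close> also along \<open>t\<^sub>n - y\<close> for \<open>y\<close> in the support of \<open>F\<close>, hence for \<open>y\<close> in the additive set generated by it.
  That set is asymptotically dense, so \<open>D\<close> is close to \<open>\<eta>\<close> at arbitrarily many consecutive points at
  distance \<open>s\<close>; adding up these increments of the bounded function \<open>H\<close> shows \<open>\<eta> \<le> 0\<close>.\<close>

lemma asymptotic_increment_upper:
  fixes F :: "real measure" and H :: "real \<Rightarrow> real"
  assumes F: "prob_space F" "sets F = sets borel" "nonarithmetic F" "AE x in F. 0 \<le> x"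
    and bdd: "\<And>t. \<bar>H t\<bar> \<le> B"
    and uc: "\<And>e. e > 0 \<Longrightarrow> \<exists>\<delta>>0. \<forall>u v. \<bar>u - v\<bar> \<le> \<delta> \<longrightarrow> \<bar>H u - H v\<bar> \<le> e"
    and harm: "((\<lambda>t. H t - (\<integral>x. H (t - x) \<partial>F)) \<longlongrightarrow> 0) at_top"
    and e: "e > 0"
  shows "\<forall>\<^sub>F t in at_top. H (t + s) - H t < e"
proof -
  interpret prob_space F by fact
  define D where "D t = H (t + s) - H t" for t
  have ucD: "\<exists>\<delta>>0. \<forall>u v. \<bar>u - v\<bar> \<le> \<delta> \<longrightarrow> \<bar>D u - D v\<bar> \<le> e" if e: "e > 0" for e
  proof -
    obtain \<delta> where \<delta>: "\<delta> > 0" "\<And>u v. \<bar>u - v\<bar> \<le> \<delta> \<Longrightarrow> \<bar>H u - H v\<bar> \<le> e / 2"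
      using uc[of "e / 2"] e by auto
    show ?thesis
    proof (intro exI[of _ \<delta>] conjI \<delta>(1) allI impI)
      fix u v assume "\<bar>u - v\<bar> \<le> \<delta>"
      then have "\<bar>H u - H v\<bar> \<le> e / 2" "\<bar>H (u + s) - H (v + s)\<bar> \<le> e / 2"
        using \<delta>(2)[of u v] \<delta>(2)[of "u + s" "v + s"] by auto
      then show "\<bar>D u - D v\<bar> \<le> e"
        unfolding D_def by linarith
    qed
  qed
  have Dbdd: "\<bar>D t\<bar> \<le> 2 * B" for t
    using bdd[of t] bdd[of "t + s"] unfolding D_def by linarith
  have contH: "continuous_on UNIV H"
    using uc by (rule continuous_on_if_modulus)
  note F(2)[measurable_cong]
  have [measurable]: "H \<in> borel_measurable borel"
    using contH by (rule borel_measurable_continuous_onI)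
  then have [measurable]: "D \<in> borel_measurable borel"
    unfolding D_def by measurable
  have intH: "integrable F (\<lambda>x. H (t - x))" for t
    by (rule integrable_const_bound[where B = B]) (use bdd in auto)
  have harmD: "((\<lambda>t. D t - (\<integral>x. D (t - x) \<partial>F)) \<longlongrightarrow> 0) at_top"
  proof -
    have "filterlim (\<lambda>t. t + s) at_top (at_top :: real filter)"
      by (rule filterlim_add_const_at_top) (rule filterlim_ident)
    from tendsto_diff[OF filterlim_compose[OF harm this] harm]
    have "((\<lambda>t. (H (t + s) - (\<integral>x. H (t + s - x) \<partial>F)) - (H t - (\<integral>x. H (t - x) \<partial>F))) \<longlongrightarrow> 0) at_top"
      by simp
    moreover have "(H (t + s) - (\<integral>x. H (t + s - x) \<partial>F)) - (H t - (\<integral>x. H (t - x) \<partial>F)) = D t - (\<integral>x. D (t - x) \<partial>F)" for t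
    proof -
      have "(\<integral>x. D (t - x) \<partial>F) = (\<integral>x. H (t + s - x) \<partial>F) - (\<integral>x. H (t - x) \<partial>F)"
        using Bochner_Integration.integral_diff[OF intH[of "t + s"] intH[of t]]
        by (simp add: D_def algebra_simps)
      then show ?thesis by (simp add: D_def)
    qed
    ultimately show ?thesis by simp
  qed
  define C where "C = {c. \<forall>\<^sub>F t in at_top. D t \<le> c}"
  define \<eta> where "\<eta> = Inf C"
  have "2 * B \<in> C"
    using Dbdd by (auto simp: C_def abs_le_iff)
  then have Cne: "C \<noteq> {}" by blast
  have Cbdd: "bdd_below C"
  proof (rule bdd_belowI[of _ "- (2 * B)"])
    fix c assume "c \<in> C"
    then have "\<forall>\<^sub>F t in at_top. D t \<le> c" by (simp add: C_def)
    then obtain t where "D t \<le> c"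
      by (auto dest!: eventually_happens)
    then show "- (2 * B) \<le> c"
      using Dbdd[of t] by linarith
  qed
  have up: "\<forall>\<^sub>F t in at_top. D t \<le> \<eta> + \<epsilon>" if \<epsilon>: "\<epsilon> > 0" for \<epsilon>
  proof -
    obtain c where "c \<in> C" "c < \<eta> + \<epsilon>"
      using cInf_lessD[OF Cne, of "\<eta> + \<epsilon>"] \<epsilon> by (auto simp: \<eta>_def)
    then show ?thesis
      unfolding C_def by (auto elim!: eventually_mono)
  qed
  have lo: "\<exists>t\<ge>T. \<eta> - \<epsilon> < D t" if \<epsilon>: "\<epsilon> > 0" for \<epsilon> T
  proof (rule ccontr)
    assume "\<not> ?thesis"
    then have "\<eta> - \<epsilon> \<in> C"
      unfolding C_def eventually_at_top_linorder by (force simp: not_less)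
    then have "\<eta> \<le> \<eta> - \<epsilon>"
      using cInf_lower[OF _ Cbdd, of "\<eta> - \<epsilon>"] by (simp add: \<eta>_def)
    then show False using \<epsilon> by simp
  qed
  define \<Gamma> where "\<Gamma> = {y. 0 \<le> y \<and> (\<forall>u. filterlim u at_top sequentially \<longrightarrow> (\<lambda>n. D (u n)) \<longlonglongrightarrow> \<eta> \<longrightarrow>
      (\<lambda>n. D (u n - y)) \<longlonglongrightarrow> \<eta>)}"
  note shift_top = filterlim_add_const_at_top[of _ sequentially "- y" for y, simplified]
  have \<Gamma>0: "0 \<in> \<Gamma>"
    by (simp add: \<Gamma>_def)
  have \<Gamma>add: "a + b \<in> \<Gamma>" if ab: "a \<in> \<Gamma>" "b \<in> \<Gamma>" for a b
  proof -
    have "(\<lambda>n. D (u n - (a + b))) \<longlonglongrightarrow> \<eta>"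
      if u: "filterlim u at_top sequentially" "(\<lambda>n. D (u n)) \<longlonglongrightarrow> \<eta>" for u
    proof -
      have "(\<lambda>n. D (u n - a)) \<longlonglongrightarrow> \<eta>"
        using ab(1) u by (simp add: \<Gamma>_def)
      then have "(\<lambda>n. D (u n - a - b)) \<longlonglongrightarrow> \<eta>"
        using ab(2) shift_top[OF u(1), of a] by (simp add: \<Gamma>_def)
      then show ?thesis
        by (simp add: algebra_simps)
    qed
    then show ?thesis
      using ab by (simp add: \<Gamma>_def)
  qed
  have supp: "y \<in> \<Gamma>" if y: "0 \<le> y" "\<And>\<delta>. \<delta> > 0 \<Longrightarrow> 0 < measure F {y - \<delta><..<y + \<delta>}" for y
    using upper_limit_spreads[OF F(1,2) Dbdd _ ucD harmD up _ _ y(2)] y(1) by (simp add: \<Gamma>_def)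
  have nonlattice: "\<exists>y\<in>\<Gamma>. \<forall>k::int. y \<noteq> of_int k * h" if h: "h > 0" for h
  proof (rule ccontr)
    assume neg: "\<not> ?thesis"
    have "AE x in F. \<exists>k::int. x = of_int k * h"
      using AE_in_support[OF F(1,2)] F(4)
    proof eventually_elim
      case (elim y)
      then have "y \<in> \<Gamma>" using supp by blast
      then show ?case using neg by blast
    qed
    then show False
      using F(3) h by (simp add: nonarithmetic_def)
  qed
  have "\<eta> \<le> 0"
  proof (rule ccontr)
    assume "\<not> \<eta> \<le> 0"
    then have \<eta>: "\<eta> > 0" by simp
    obtain \<delta> where \<delta>: "\<delta> > 0" "\<And>u v. \<bar>u - v\<bar> \<le> \<delta> \<Longrightarrow> \<bar>D u - D v\<bar> \<le> \<eta> / 4"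
      using ucD[of "\<eta> / 4"] \<eta> by auto
    have "\<exists>Y. \<forall>y\<ge>Y. \<exists>g\<in>\<Gamma>. \<bar>y - g\<bar> \<le> \<delta>"
      by (rule additive_set_asymptotically_dense[OF \<Gamma>0 \<Gamma>add _ nonlattice \<delta>(1)]) (auto simp: \<Gamma>_def)
    then obtain Y where Y: "\<And>y. y \<ge> Y \<Longrightarrow> \<exists>g\<in>\<Gamma>. \<bar>y - g\<bar> \<le> \<delta>"
      by blast
    obtain N :: nat where N: "2 * B / (\<eta> / 2) < real N"
      using reals_Archimedean2 by blast
    then have N: "2 * B < real N * (\<eta> / 2)"
      using \<eta> by (simp add: field_simps)
    define y0 where "y0 = Y + real N * \<bar>s\<bar>"
    have "\<exists>g\<in>\<Gamma>. \<bar>y0 - real i * s - g\<bar> \<le> \<delta>" if "i < N" for i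
    proof (rule Y)
      have "real i * s \<le> real i * \<bar>s\<bar>"
        by (intro mult_left_mono) auto
      also have "\<dots> \<le> real N * \<bar>s\<bar>"
        using that by (intro mult_right_mono) auto
      finally show "Y \<le> y0 - real i * s"
        by (simp add: y0_def)
    qed
    then obtain g where g: "\<And>i. i < N \<Longrightarrow> g i \<in> \<Gamma>" "\<And>i. i < N \<Longrightarrow> \<bar>y0 - real i * s - g i\<bar> \<le> \<delta>"
      by metis
    have "\<exists>t\<ge>real n. \<eta> - 1 / real (Suc n) < D t" for n
      by (rule lo) simp
    then obtain t where t: "\<And>n. real n \<le> t n" "\<And>n. \<eta> - 1 / real (Suc n) < D (t n)"
      by metis
    have t_top: "filterlim t at_top sequentially"
      by (rule filterlim_at_top_mono[OF filterlim_real_sequentially]) (use t(1) in auto)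
    have "(\<lambda>n. D (t n)) \<longlonglongrightarrow> \<eta>"
    proof (rule tendsto_upper_limit[OF _ t_top])
      fix \<epsilon> :: real assume "\<epsilon> > 0"
      then obtain n0 where n0: "inverse (real (Suc n0)) < \<epsilon>"
        using reals_Archimedean by blast
      show "\<forall>\<^sub>F n in sequentially. \<eta> - \<epsilon> \<le> D (t n)"
        using eventually_ge_at_top[of n0]
      proof eventually_elim
        case (elim n)
        have "1 / real (Suc n) \<le> inverse (real (Suc n0))"
          using elim by (simp add: field_simps)
        then show ?case
          using t(2)[of n] n0 by linarith
      qed
    qed (rule up)
    then have "(\<lambda>n. D (t n - g i)) \<longlonglongrightarrow> \<eta>" if "i < N" for i
      using g(1)[OF that] t_top by (simp add: \<Gamma>_def)
    then have "\<forall>\<^sub>F n in sequentially. 3 * \<eta> / 4 < D (t n - g i)" if "i < N" for i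
      using that \<eta> by (intro order_tendstoD(1)[of _ \<eta>]) auto
    then have "\<forall>\<^sub>F n in sequentially. \<forall>i\<in>{..<N}. 3 * \<eta> / 4 < D (t n - g i)"
      by (intro eventually_ball_finite) auto
    then obtain n where n: "\<And>i. i < N \<Longrightarrow> 3 * \<eta> / 4 < D (t n - g i)"
      by (auto dest!: eventually_happens)
    \<comment> \<open>All points \<open>w + i * s\<close> with \<open>i < N\<close> lie within \<open>\<delta>\<close> of points where \<open>D\<close> is close to \<open>\<eta>\<close>.\<close>
    define w where "w = t n - y0"
    have "\<eta> / 2 \<le> D (w + real i * s)" if "i < N" for i
    proof -
      have "\<bar>D (w + real i * s) - D (t n - g i)\<bar> \<le> \<eta> / 4"
        using g(2)[OF that] by (intro \<delta>(2)) (simp add: w_def abs_le_iff)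
      then show ?thesis
        using n[OF that] by linarith
    qed
    then have "real N * (\<eta> / 2) \<le> (\<Sum>i<N. D (w + real i * s))"
      using sum_bounded_below[of "{..<N}" "\<eta> / 2" "\<lambda>i. D (w + real i * s)"] by simp
    also have "\<dots> = H (w + real N * s) - H w"
      by (induction N) (auto simp: D_def algebra_simps)
    also have "\<dots> \<le> 2 * B"
      using bdd[of "w + real N * s"] bdd[of w] by linarith
    finally show False
      using N by simp
  qed
  moreover have "\<forall>\<^sub>F t in at_top. D t \<le> \<eta> + e / 2"
    using e by (intro up) simp
  ultimately show ?thesis
    using e by (auto simp: D_def elim!: eventually_mono)
qed

theorem asymptotic_shift_invariance:
  fixes F :: "real measure" and H :: "real \<Rightarrow> real"
  assumes F: "prob_space F" "sets F = sets borel" "nonarithmetic F" "AE x in F. 0 \<le> x"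
    and bdd: "\<And>t. \<bar>H t\<bar> \<le> B"
    and uc: "\<And>e. e > 0 \<Longrightarrow> \<exists>\<delta>>0. \<forall>u v. \<bar>u - v\<bar> \<le> \<delta> \<longrightarrow> \<bar>H u - H v\<bar> \<le> e"
    and harm: "((\<lambda>t. H t - (\<integral>x. H (t - x) \<partial>F)) \<longlongrightarrow> 0) at_top"
  shows "((\<lambda>t. H (t + s) - H t) \<longlongrightarrow> 0) at_top"
proof (rule tendstoI)
  fix e :: real assume e: "e > 0"
  have "\<forall>\<^sub>F t in at_top. H (t + s) - H t < e"
    by (rule asymptotic_increment_upper[OF F bdd uc harm e])
  moreover have "\<forall>\<^sub>F t in at_top. - H (t + s) - - H t < e"
  proof (rule asymptotic_increment_upper[OF F _ _ _ e])
    show "\<bar>- H t\<bar> \<le> B" for t using bdd[of t] by simp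
    show "\<exists>\<delta>>0. \<forall>u v. \<bar>u - v\<bar> \<le> \<delta> \<longrightarrow> \<bar>- H u - - H v\<bar> \<le> e" if "e > 0" for e
      using uc[OF that] by (metis abs_minus_commute minus_diff_minus abs_minus)
    show "((\<lambda>t. - H t - (\<integral>x. - H (t - x) \<partial>F)) \<longlongrightarrow> 0) at_top"
      using tendsto_minus[OF harm] by simp
  qed
  ultimately show "\<forall>\<^sub>F t in at_top. dist (H (t + s) - H t) 0 < e"
    by eventually_elim (simp add: dist_real_def abs_less_iff)
qed

section \<open>The renewal equation\<close>

text \<open>The pair of index \<open>i\<close> consists of the mark of point \<open>i\<close> and the length of the interval that ends there; the
  process starts at time \<open>0\<close>, which is not a point.\<close>

definition renewal_points :: "(nat \<Rightarrow> 'm \<times> real) \<Rightarrow> nat \<Rightarrow> real \<times> 'm" where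
  "renewal_points \<omega> i = (\<Sum>j\<le>i. snd (\<omega> j), fst (\<omega> i))"

lemma renewal_points_case_nat:
  "renewal_points (case_nat z \<omega>) 0 = (snd z, fst z)"
  "renewal_points (case_nat z \<omega>) (Suc i) = shift_points (- snd z) (renewal_points \<omega>) i"
  by (simp_all add: renewal_points_def shift_points_def sum.atMost_Suc_shift del: sum.atMost_Suc)

lemma delayed_renewal_eq:
  "delayed_renewal (\<lambda>i. fst (\<omega> i)) (\<lambda>i. snd (\<omega> i)) = point_process UNIV (renewal_points \<omega>)"
  by (simp add: delayed_renewal_def renewal_points_def[abs_def])

lemma locally_finite_renewal_case_nat:
  assumes "locally_finite_points (renewal_points \<omega>)"
  shows "locally_finite_points (renewal_points (case_nat z \<omega>))"
  unfolding locally_finite_points_def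
proof
  fix h
  have "locally_finite_points (shift_points (- snd z) (renewal_points \<omega>))"
    using assms by simp
  then have "finite (insert 0 (Suc ` {i. \<bar>fst (shift_points (- snd z) (renewal_points \<omega>) i)\<bar> \<le> h}))"
    unfolding locally_finite_points_def by blast
  moreover have "{i. \<bar>fst (renewal_points (case_nat z \<omega>) i)\<bar> \<le> h}
      \<subseteq> insert 0 (Suc ` {i. \<bar>fst (shift_points (- snd z) (renewal_points \<omega>) i)\<bar> \<le> h})"
  proof
    fix i assume "i \<in> {i. \<bar>fst (renewal_points (case_nat z \<omega>) i)\<bar> \<le> h}"
    then show "i \<in> insert 0 (Suc ` {i. \<bar>fst (shift_points (- snd z) (renewal_points \<omega>) i)\<bar> \<le> h})"
      by (cases i) (auto simp: renewal_points_case_nat)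
  qed
  ultimately show "finite {i. \<bar>fst (renewal_points (case_nat z \<omega>) i)\<bar> \<le> h}"
    by (rule rev_finite_subset)
qed

locale renewal_law = D: prob_space D for D :: "('m::polish_space \<times> real) measure" +
  assumes sets_D [measurable_cong]: "sets D = sets borel"
    and nonneg: "AE z in D. 0 \<le> snd z"
    and nonarith: "nonarithmetic (distr D borel snd)"
    and integrable_snd: "integrable D snd"
    and mean_pos: "0 < (\<integral>z. snd z \<partial>D)"
begin

abbreviation S :: "(nat \<Rightarrow> 'm \<times> real) measure" where
  "S \<equiv> PiM UNIV (\<lambda>_. D)"

sublocale S: sequence_space D ..

lemma space_D [simp]: "space D = UNIV"
  using sets_eq_imp_space_eq[OF sets_D] by simp

lemma measurable_fst_D [measurable]: "fst \<in> measurable D borel" "snd \<in> measurable D borel"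
  by measurable

lemma renewal_points_measurable [measurable]: "(\<lambda>\<omega>. renewal_points \<omega> i) \<in> measurable S borel"
  unfolding renewal_points_def by (intro borel_measurable_Pair) measurable

lemma nn_integral_first_step:
  assumes [measurable]: "f \<in> borel_measurable S"
  shows "(\<integral>\<^sup>+\<omega>. f \<omega> \<partial>S) = (\<integral>\<^sup>+z. \<integral>\<^sup>+\<omega>. f (case_nat z \<omega>) \<partial>S \<partial>D)"
proof -
  have "(\<integral>\<^sup>+\<omega>. f \<omega> \<partial>S) = (\<integral>\<^sup>+\<omega>. f \<omega> \<partial>distr (D \<Otimes>\<^sub>M S) S (\<lambda>(z, \<omega>). case_nat z \<omega>))"
    by (simp only: S.PiM_iter)
  also have "\<dots> = (\<integral>\<^sup>+x. f (case x of (z, \<omega>) \<Rightarrow> case_nat z \<omega>) \<partial>(D \<Otimes>\<^sub>M S))"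
    by (rule nn_integral_distr) measurable
  also have "\<dots> = (\<integral>\<^sup>+z. \<integral>\<^sup>+\<omega>. f (case_nat z \<omega>) \<partial>S \<partial>D)"
    by (subst S.P.nn_integral_fst[symmetric]) auto
  finally show ?thesis .
qed

subsection \<open>Uniform bound for the expected number of renewals\<close>

definition laplace :: real where
  "laplace = (\<integral>z. exp (- snd z) \<partial>D)"

lemma integrable_exp: "integrable D (\<lambda>z. exp (- snd z))"
  by (rule D.integrable_const_bound[where B = 1]) (use nonneg in auto)

lemma laplace_less_1: "laplace < 1"
proof -
  have int: "integrable D (\<lambda>z. 1 - exp (- snd z))"
    using integrable_exp by auto
  have nn: "AE z in D. 0 \<le> 1 - exp (- snd z)"
    using nonneg by eventually_elim auto
  have "0 \<le> (\<integral>z. 1 - exp (- snd z) \<partial>D)"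
    using nn by (rule integral_nonneg_AE)
  moreover have "(\<integral>z. 1 - exp (- snd z) \<partial>D) \<noteq> 0"
  proof
    assume "(\<integral>z. 1 - exp (- snd z) \<partial>D) = 0"
    then have "AE z in D. 1 - exp (- snd z) = 0"
      using integral_nonneg_eq_0_iff_AE[OF int nn] by simp
    then have "AE z in D. snd z = 0"
      by eventually_elim simp
    then have "(\<integral>z. snd z \<partial>D) = 0"
      by (rule integral_eq_zero_AE)
    then show False
      using mean_pos by simp
  qed
  moreover have "(\<integral>z. 1 - exp (- snd z) \<partial>D) = 1 - laplace"
    using integrable_exp by (simp add: laplace_def D.prob_space[simplified])
  ultimately show ?thesis by linarith
qed

text \<open>Let \<open>u\<close> be the left end \<open>a\<close> of an interval of length \<open>l\<close> minus the current position of the renewal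
  walk. The bounded function \<open>min 1 (exp u)\<close> is superharmonic for the walk, and when the walk is in
  \<open>[a, a + l]\<close>, its mean drops by at least \<open>count_const l\<close> with the next step. Hence the expected number of
  renewals in the interval is bounded independently of \<open>a\<close>.\<close>

definition count_const :: "real \<Rightarrow> real" where
  "count_const l = exp (- l) * (1 - laplace)"

lemma count_const_pos: "0 < count_const l"
  using laplace_less_1 by (simp add: count_const_def)

lemma superharmonic_step:
  "ennreal (count_const l * indicator {- l..0} u) + (\<integral>\<^sup>+z. ennreal (min 1 (exp (u - snd z))) \<partial>D) \<le> ennreal (min 1 (exp u))"
proof (cases "u \<in> {- l..0}")
  case True
  have "(\<integral>\<^sup>+z. ennreal (min 1 (exp (u - snd z))) \<partial>D) \<le> (\<integral>\<^sup>+z. ennreal (exp u * exp (- snd z)) \<partial>D)"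
    by (intro nn_integral_mono) (auto simp: exp_diff exp_minus field_simps)
  also have "\<dots> = ennreal (exp u * laplace)"
    unfolding laplace_def using integrable_exp by (subst nn_integral_eq_integral) auto
  finally have "ennreal (count_const l * indicator {- l..0} u) + (\<integral>\<^sup>+z. ennreal (min 1 (exp (u - snd z))) \<partial>D)
      \<le> ennreal (count_const l) + ennreal (exp u * laplace)"
    using True by (intro add_mono) auto
  also have "\<dots> = ennreal (count_const l + exp u * laplace)"
    using count_const_pos[of l] by (intro ennreal_plus[symmetric]) (auto simp: laplace_def integral_nonneg_AE)
  also have "\<dots> \<le> ennreal (min 1 (exp u))"
  proof (rule ennreal_leI)
    have "exp (- l) * (1 - laplace) \<le> exp u * (1 - laplace)"
      using True laplace_less_1 by (intro mult_right_mono) auto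
    then have "count_const l + exp u * laplace \<le> exp u"
      by (simp add: count_const_def algebra_simps)
    then show "count_const l + exp u * laplace \<le> min 1 (exp u)"
      using True by simp
  qed
  finally show ?thesis .
next
  case False
  have "(\<integral>\<^sup>+z. ennreal (min 1 (exp (u - snd z))) \<partial>D) \<le> (\<integral>\<^sup>+z. ennreal (min 1 (exp u)) \<partial>D)"
  proof (rule nn_integral_mono_AE)
    show "AE z in D. ennreal (min 1 (exp (u - snd z))) \<le> ennreal (min 1 (exp u))"
      using nonneg by eventually_elim (intro ennreal_leI min.mono, auto)
  qed
  then show ?thesis
    using False by (simp add: D.emeasure_space_1[simplified])
qed

definition renewal_count :: "nat \<Rightarrow> real \<Rightarrow> real \<Rightarrow> (nat \<Rightarrow> 'm \<times> real) \<Rightarrow> ennreal" where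
  "renewal_count n l a \<omega> = (\<Sum>i<n. indicator {a..a + l} (fst (renewal_points \<omega> i)))"

lemma renewal_count_measurable [measurable]: "renewal_count n l a \<in> borel_measurable S"
  unfolding renewal_count_def[abs_def] by measurable

lemma renewal_count_Suc:
  "renewal_count (Suc n) l a (case_nat z \<omega>) = indicator {- l..0} (a - snd z) + renewal_count n l (a - snd z) \<omega>"
  unfolding renewal_count_def
  by (subst sum.lessThan_Suc_shift) (auto simp: renewal_points_case_nat indicator_def algebra_simps intro!: sum.cong)

lemma renewal_count_bound:
  "ennreal (count_const l) * (\<integral>\<^sup>+\<omega>. renewal_count n l a \<omega> \<partial>S) \<le> (\<integral>\<^sup>+z. ennreal (min 1 (exp (a - snd z))) \<partial>D)"
proof (induction n arbitrary: a)
  case 0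
  then show ?case by (simp add: renewal_count_def)
next
  case (Suc n)
  have "ennreal (count_const l) * (\<integral>\<^sup>+\<omega>. renewal_count (Suc n) l a \<omega> \<partial>S)
      = ennreal (count_const l) * (\<integral>\<^sup>+z. \<integral>\<^sup>+\<omega>. indicator {- l..0} (a - snd z) + renewal_count n l (a - snd z) \<omega> \<partial>S \<partial>D)"
    by (subst nn_integral_first_step) (simp_all add: renewal_count_Suc)
  also have "\<dots> = ennreal (count_const l) * (\<integral>\<^sup>+z. indicator {- l..0} (a - snd z) + (\<integral>\<^sup>+\<omega>. renewal_count n l (a - snd z) \<omega> \<partial>S) \<partial>D)"
    by (subst nn_integral_add) (auto simp: S.emeasure_space_1)
  also have "\<dots> = (\<integral>\<^sup>+z. ennreal (count_const l) * (indicator {- l..0} (a - snd z) + (\<integral>\<^sup>+\<omega>. renewal_count n l (a - snd z) \<omega> \<partial>S)) \<partial>D)"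
  proof (rule nn_integral_cmult[symmetric])
    have "(\<lambda>(z, \<omega>). renewal_count n l (a - snd z) \<omega>) \<in> borel_measurable (D \<Otimes>\<^sub>M S)"
      unfolding renewal_count_def case_prod_beta indicator_def atLeastAtMost_iff by measurable
    from S.borel_measurable_nn_integral[OF this]
    show "(\<lambda>z. indicator {- l..0} (a - snd z) + (\<integral>\<^sup>+\<omega>. renewal_count n l (a - snd z) \<omega> \<partial>S)) \<in> borel_measurable D"
      by measurable
  qed
  also have "\<dots> \<le> (\<integral>\<^sup>+z. ennreal (min 1 (exp (a - snd z))) \<partial>D)"
  proof (rule nn_integral_mono)
    fix z
    have "ennreal (count_const l) * (indicator {- l..0} (a - snd z) + (\<integral>\<^sup>+\<omega>. renewal_count n l (a - snd z) \<omega> \<partial>S))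
        \<le> ennreal (count_const l * indicator {- l..0} (a - snd z)) + (\<integral>\<^sup>+z'. ennreal (min 1 (exp (a - snd z - snd z'))) \<partial>D)"
      unfolding distrib_left using Suc[of "a - snd z"]
      by (intro add_mono) (auto simp: indicator_def)
    also have "\<dots> \<le> ennreal (min 1 (exp (a - snd z)))"
      by (rule superharmonic_step)
    finally show "ennreal (count_const l) * (indicator {- l..0} (a - snd z) + (\<integral>\<^sup>+\<omega>. renewal_count n l (a - snd z) \<omega> \<partial>S))
        \<le> ennreal (min 1 (exp (a - snd z)))" .
  qed
  finally show ?case .
qed

lemma renewal_number_eq_suminf:
  "emeasure (count_space UNIV) {i. fst (renewal_points \<omega> i) \<in> A} = (\<Sum>i. indicator A (fst (renewal_points \<omega> i)))"
proof -
  have "emeasure (count_space UNIV) {i. fst (renewal_points \<omega> i) \<in> A}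
      = (\<integral>\<^sup>+i. indicator {i. fst (renewal_points \<omega> i) \<in> A} i \<partial>count_space UNIV)"
    by (simp add: nn_integral_indicator)
  also have "\<dots> = (\<Sum>i. indicator {i. fst (renewal_points \<omega> i) \<in> A} i)"
    by (rule nn_integral_count_space_nat)
  finally show ?thesis
    by (simp add: indicator_def)
qed

lemma expected_renewals_bound:
  "(\<integral>\<^sup>+\<omega>. emeasure (count_space UNIV) {i. fst (renewal_points \<omega> i) \<in> {a..a + l}} \<partial>S) \<le> ennreal (1 / count_const l)"
proof -
  have "(\<integral>\<^sup>+\<omega>. emeasure (count_space UNIV) {i. fst (renewal_points \<omega> i) \<in> {a..a + l}} \<partial>S)
      = (\<Sum>i. \<integral>\<^sup>+\<omega>. indicator {a..a + l} (fst (renewal_points \<omega> i)) \<partial>S)"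
    unfolding renewal_number_eq_suminf by (rule nn_integral_suminf) measurable
  also have "\<dots> = (SUP n. \<Sum>i<n. \<integral>\<^sup>+\<omega>. indicator {a..a + l} (fst (renewal_points \<omega> i)) \<partial>S)"
    by (rule suminf_eq_SUP)
  also have "\<dots> \<le> ennreal (1 / count_const l)"
  proof (rule SUP_least)
    fix n
    have "ennreal (count_const l) * (\<Sum>i<n. \<integral>\<^sup>+\<omega>. indicator {a..a + l} (fst (renewal_points \<omega> i)) \<partial>S)
        = ennreal (count_const l) * (\<integral>\<^sup>+\<omega>. renewal_count n l a \<omega> \<partial>S)"
      unfolding renewal_count_def by (subst nn_integral_sum) auto
    also have "\<dots> \<le> (\<integral>\<^sup>+z. ennreal (min 1 (exp (a - snd z))) \<partial>D)"
      by (rule renewal_count_bound)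
    also have "\<dots> \<le> (\<integral>\<^sup>+z. 1 \<partial>D)"
      by (intro nn_integral_mono) (auto simp: ennreal_le_1)
    also have "\<dots> = 1"
      by (simp add: D.emeasure_space_1[simplified])
    finally have "ennreal (1 / count_const l) * (ennreal (count_const l) * (\<Sum>i<n. \<integral>\<^sup>+\<omega>. indicator {a..a + l} (fst (renewal_points \<omega> i)) \<partial>S))
        \<le> ennreal (1 / count_const l) * 1"
      by (rule mult_left_mono) simp
    moreover have "ennreal (1 / count_const l) * ennreal (count_const l) = 1"
      using count_const_pos[of l] by (simp flip: ennreal_mult)
    ultimately show "(\<Sum>i<n. \<integral>\<^sup>+\<omega>. indicator {a..a + l} (fst (renewal_points \<omega> i)) \<partial>S) \<le> ennreal (1 / count_const l)"
      by (simp flip: mult.assoc)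
  qed
  finally show ?thesis .
qed

lemma AE_locally_finite: "AE \<omega> in S. locally_finite_points (renewal_points \<omega>)"
proof -
  have "AE \<omega> in S. finite {i. \<bar>fst (renewal_points \<omega> i)\<bar> \<le> real h}" for h :: nat
  proof -
    have eq: "{i. \<bar>fst (renewal_points \<omega> i)\<bar> \<le> real h} = {i. fst (renewal_points \<omega> i) \<in> {- real h..- real h + 2 * real h}}" for \<omega> :: "nat \<Rightarrow> 'm \<times> real"
      by auto
    have "AE \<omega> in S. emeasure (count_space UNIV) {i. fst (renewal_points \<omega> i) \<in> {- real h..- real h + 2 * real h}} \<noteq> \<infinity>"
    proof (rule nn_integral_PInf_AE)
      show "(\<lambda>\<omega>. emeasure (count_space UNIV) {i. fst (renewal_points \<omega> i) \<in> {- real h..- real h + 2 * real h}}) \<in> borel_measurable S"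
        unfolding renewal_number_eq_suminf by measurable
      show "(\<integral>\<^sup>+\<omega>. emeasure (count_space UNIV) {i. fst (renewal_points \<omega> i) \<in> {- real h..- real h + 2 * real h}} \<partial>S) \<noteq> \<infinity>"
        using order_le_less_trans[OF expected_renewals_bound[of "- real h" "2 * real h"] ennreal_less_top] 
        unfolding infinity_ennreal_def by (rule less_imp_neq)
    qed
    then show ?thesis
      by eventually_elim (auto simp: eq emeasure_count_space split: if_splits)
  qed
  then show ?thesis
    unfolding locally_finite_points_iff_nat by (simp add: AE_all_countable)
qed

end

section \<open>The law seen from a late time does not depend on the delay\<close>

definition observe :: "((real \<times> 'm::topological_space) measure \<Rightarrow> real) \<Rightarrow> real \<Rightarrow> ('i \<Rightarrow> real \<times> 'm) \<Rightarrow> real" where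
  "observe \<Phi> t x = \<Phi> (point_process UNIV (shift_points t x))"

lemma observe_measurable:
  fixes x :: "'a \<Rightarrow> 'i::countable \<Rightarrow> real \<times> 'm::polish_space"
  assumes \<Phi>: "\<Phi> \<in> borel_measurable (borel_algebra vague_topology)"
    and [measurable]: "\<And>i. (\<lambda>\<omega>. x \<omega> i) \<in> measurable M borel" "t \<in> borel_measurable M"
  shows "(\<lambda>\<omega>. observe \<Phi> (t \<omega>) (x \<omega>)) \<in> borel_measurable M"
proof -
  have "(\<lambda>\<omega>. shift_points (t \<omega>) (x \<omega>) i) \<in> measurable M borel" for i
    unfolding shift_points_def by (intro borel_measurable_Pair) measurable
  then have "(\<lambda>\<omega>. point_process UNIV (\<lambda>i. shift_points (t \<omega>) (x \<omega>) i)) \<in> measurable M (borel_algebra vague_topology)"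
    by (rule point_process_measurable)
  from measurable_compose[OF this \<Phi>] show ?thesis
    by (simp add: observe_def)
qed

locale window_functional = renewal_law D for D :: "('m::polish_space \<times> real) measure" +
  fixes \<Phi> :: "(real \<times> 'm) measure \<Rightarrow> real" and h C B :: real
  assumes window: "window_lipschitz h C \<Phi>" and h_pos: "0 < h" and C_nonneg: "0 \<le> C"
    and \<Phi>_nonneg: "\<And>m. 0 \<le> \<Phi> m" and \<Phi>_le: "\<And>m. \<Phi> m \<le> B"
    and \<Phi>_measurable: "\<Phi> \<in> borel_measurable (borel_algebra vague_topology)"
begin

lemma observe_bounds: "0 \<le> observe \<Phi> t x" "observe \<Phi> t x \<le> B" "\<bar>observe \<Phi> t x\<bar> \<le> B"
  using \<Phi>_nonneg \<Phi>_le by (auto simp: observe_def abs_of_nonneg)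

text \<open>This function satisfies the renewal equation up to a vanishing error, see
  \<open>delayed_mean_renewal_equation\<close>.\<close>

definition H :: "real \<Rightarrow> real" where
  "H t = (\<integral>\<omega>. observe \<Phi> t (renewal_points \<omega>) \<partial>S)"

lemma observe_renewal_measurable [measurable]:
  "(\<lambda>\<omega>. observe \<Phi> t (renewal_points \<omega>)) \<in> borel_measurable S"
  by (rule observe_measurable[OF \<Phi>_measurable]) measurable

lemma integrable_observe_renewal: "integrable S (\<lambda>\<omega>. observe \<Phi> t (renewal_points \<omega>))"
  by (rule S.integrable_const_bound[where B = B]) (auto intro!: AE_I2 observe_bounds)

lemma H_bound: "\<bar>H t\<bar> \<le> B"
proof -
  have "\<bar>H t\<bar> \<le> (\<integral>\<omega>. \<bar>observe \<Phi> t (renewal_points \<omega>)\<bar> \<partial>S)"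
    unfolding H_def by (rule integral_abs_bound)
  also have "\<dots> \<le> (\<integral>\<omega>. B \<partial>S)"
    using integrable_observe_renewal by (intro integral_mono) (auto intro: observe_bounds)
  finally show ?thesis
    by (simp add: S.P.prob_space)
qed

lemma observe_lipschitz:
  fixes x :: "'i::countable \<Rightarrow> real \<times> 'm"
  assumes lf: "locally_finite_points x" and s: "\<bar>s\<bar> \<le> 1"
  shows "ennreal \<bar>observe \<Phi> (t + s) x - observe \<Phi> t x\<bar> \<le>
    ennreal (C * \<bar>s\<bar>) * emeasure (count_space UNIV) {i. fst (x i) \<in> {t - (h + 1)..t - (h + 1) + 2 * (h + 1)}}"
proof -
  let ?m = "point_process UNIV (shift_points t x)"
  have pm: "?m \<in> point_measures" by simp
  have "\<bar>observe \<Phi> (t + s) x - observe \<Phi> t x\<bar> = \<bar>\<Phi> (shift_measure s ?m) - \<Phi> ?m\<bar>"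
    by (simp add: observe_def shift_points_add shift_point_process)
  also have "\<dots> \<le> C * \<bar>s\<bar> * measure ?m (strip (h + 1))"
    using window pm s unfolding window_lipschitz_def by blast
  finally have "ennreal \<bar>observe \<Phi> (t + s) x - observe \<Phi> t x\<bar> \<le> ennreal (C * \<bar>s\<bar> * measure ?m (strip (h + 1)))"
    by (rule ennreal_leI)
  also have "\<dots> = ennreal (C * \<bar>s\<bar>) * emeasure ?m (strip (h + 1))"
    using emeasure_strip[OF pm, of "h + 1"] C_nonneg
    by (simp add: ennreal_mult emeasure_eq_ennreal_measure)
  also have "emeasure ?m (strip (h + 1)) = emeasure (count_space UNIV) {i. shift_points t x i \<in> strip (h + 1)}"
    using lf by (subst point_process_eq_dirac_sum) (simp_all only: locally_finite_shift_points emeasure_dirac_sum_count strip_sets)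
  also have "{i. shift_points t x i \<in> strip (h + 1)} = {i. fst (x i) \<in> {t - (h + 1)..t - (h + 1) + 2 * (h + 1)}}"
    by (auto simp: mem_Times_iff algebra_simps)
  finally show ?thesis .
qed

lemma H_lipschitz:
  assumes s: "\<bar>s\<bar> \<le> 1"
  shows "\<bar>H (t + s) - H t\<bar> \<le> C / count_const (2 * (h + 1)) * \<bar>s\<bar>"
proof -
  let ?N = "\<lambda>\<omega>. emeasure (count_space UNIV) {i. fst (renewal_points \<omega> i) \<in> {t - (h + 1)..t - (h + 1) + 2 * (h + 1)}}"
  note int = integrable_observe_renewal
  have "\<bar>H (t + s) - H t\<bar> = \<bar>\<integral>\<omega>. observe \<Phi> (t + s) (renewal_points \<omega>) - observe \<Phi> t (renewal_points \<omega>) \<partial>S\<bar>"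
    unfolding H_def using int by simp
  also have "\<dots> \<le> (\<integral>\<omega>. \<bar>observe \<Phi> (t + s) (renewal_points \<omega>) - observe \<Phi> t (renewal_points \<omega>)\<bar> \<partial>S)"
    by (rule integral_abs_bound)
  finally have "ennreal \<bar>H (t + s) - H t\<bar> \<le> ennreal (\<integral>\<omega>. \<bar>observe \<Phi> (t + s) (renewal_points \<omega>) - observe \<Phi> t (renewal_points \<omega>)\<bar> \<partial>S)"
    by (rule ennreal_leI)
  also have "\<dots> = (\<integral>\<^sup>+\<omega>. ennreal \<bar>observe \<Phi> (t + s) (renewal_points \<omega>) - observe \<Phi> t (renewal_points \<omega>)\<bar> \<partial>S)"
    using int by (intro nn_integral_eq_integral[symmetric]) auto
  also have "\<dots> \<le> (\<integral>\<^sup>+\<omega>. ennreal (C * \<bar>s\<bar>) * ?N \<omega> \<partial>S)"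
  proof (rule nn_integral_mono_AE)
    show "AE \<omega> in S. ennreal \<bar>observe \<Phi> (t + s) (renewal_points \<omega>) - observe \<Phi> t (renewal_points \<omega>)\<bar>
        \<le> ennreal (C * \<bar>s\<bar>) * ?N \<omega>"
      using AE_locally_finite by eventually_elim (rule observe_lipschitz[OF _ s])
  qed
  also have "\<dots> = ennreal (C * \<bar>s\<bar>) * (\<integral>\<^sup>+\<omega>. ?N \<omega> \<partial>S)"
    unfolding renewal_number_eq_suminf by (rule nn_integral_cmult) measurable
  also have "\<dots> \<le> ennreal (C * \<bar>s\<bar>) * ennreal (1 / count_const (2 * (h + 1)))"
    by (intro mult_left_mono expected_renewals_bound) simp
  also have "\<dots> = ennreal (C / count_const (2 * (h + 1)) * \<bar>s\<bar>)"
    using C_nonneg count_const_pos[of "2 * (h + 1)"] by (simp flip: ennreal_mult)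
  finally show ?thesis
    using C_nonneg count_const_pos[of "2 * (h + 1)"] by (subst (asm) ennreal_le_iff) auto
qed

lemma H_uniformly_continuous:
  assumes e: "e > 0"
  shows "\<exists>\<delta>>0. \<forall>u v. \<bar>u - v\<bar> \<le> \<delta> \<longrightarrow> \<bar>H u - H v\<bar> \<le> e"
proof -
  define K where "K = C / count_const (2 * (h + 1))"
  have K: "0 \<le> K"
    using C_nonneg count_const_pos[of "2 * (h + 1)"] by (simp add: K_def)
  show ?thesis
  proof (intro exI[of _ "min 1 (e / (K + 1))"] conjI allI impI)
    show "0 < min 1 (e / (K + 1))"
      using e K by simp
    fix u v assume uv: "\<bar>u - v\<bar> \<le> min 1 (e / (K + 1))"
    then have "\<bar>H u - H v\<bar> \<le> K * \<bar>u - v\<bar>"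
      using H_lipschitz[of "u - v" v] by (simp add: K_def)
    also have "\<dots> \<le> (K + 1) * (e / (K + 1))"
      using uv K by (intro mult_mono) auto
    also have "\<dots> = e"
      using K by simp
    finally show "\<bar>H u - H v\<bar> \<le> e" .
  qed
qed

lemma H_measurable [measurable]: "H \<in> borel_measurable borel"
  by (intro borel_measurable_continuous_onI continuous_on_if_modulus H_uniformly_continuous)

abbreviation delayed_obs :: "real \<Rightarrow> 'm \<times> real \<Rightarrow> (nat \<Rightarrow> 'm \<times> real) \<Rightarrow> real" where
  "delayed_obs t z \<omega> \<equiv> observe \<Phi> t (renewal_points (case_nat z \<omega>))"

text \<open>The expected observation at time \<open>t\<close> when the first pair, mark and delay, has law \<open>D0\<close>.\<close>

definition delayed_mean :: "('m \<times> real) measure \<Rightarrow> real \<Rightarrow> real" where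
  "delayed_mean D0 t = (\<integral>z. \<integral>\<omega>. delayed_obs t z \<omega> \<partial>S \<partial>D0)"

text \<open>Once the first point has left the window, only the renewal process that starts from it is seen.\<close>

lemma observe_after_delay:
  assumes "locally_finite_points (renewal_points \<omega>)" "h < t - snd z"
  shows "delayed_obs t z \<omega> = observe \<Phi> (t - snd z) (renewal_points \<omega>)"
  unfolding observe_def
proof (rule window_lipschitz_point_process_eq[OF window, where \<pi> = Suc])
  show "h < \<bar>fst (shift_points t (renewal_points (case_nat z \<omega>)) j)\<bar>" if "j \<notin> range Suc" for j
  proof -
    have "j = 0" using that by (cases j) auto
    then show ?thesis using assms(2) by (simp add: renewal_points_case_nat)
  qed
  show "shift_points t (renewal_points (case_nat z \<omega>)) (Suc i) = shift_points (t - snd z) (renewal_points \<omega>) i" for i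
    by (simp add: shift_points_def renewal_points_case_nat)
qed (simp_all add: assms(1) locally_finite_renewal_case_nat)

lemma case_nat_renewal_measurable:
  assumes [measurable_cong]: "sets D0 = sets (borel :: ('m \<times> real) measure)"
  shows "(\<lambda>(z, \<omega>). delayed_obs t z \<omega>) \<in> borel_measurable (D0 \<Otimes>\<^sub>M S)"
proof -
  have [measurable_cong]: "sets D0 = sets D"
    using assms sets_D by simp
  have "(\<lambda>(z, \<omega>). case_nat z \<omega>) \<in> measurable (D0 \<Otimes>\<^sub>M S) S"
    by measurable
  from measurable_compose[OF this observe_renewal_measurable]
  show ?thesis by (simp add: case_prod_beta)
qed

lemma delayed_obs_measurable [measurable]: "(\<lambda>\<omega>. delayed_obs t z \<omega>) \<in> borel_measurable S"
  using measurable_compose[OF measurable_Pair1'[of z] case_nat_renewal_measurable[OF sets_D]] by simp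

lemma integrable_delayed_obs: "integrable S (\<lambda>\<omega>. delayed_obs t z \<omega>)"
  by (rule S.integrable_const_bound[where B = B]) (auto intro!: AE_I2 observe_bounds)

lemma inner_mean_measurable:
  assumes "sets D0 = sets (borel :: ('m \<times> real) measure)"
  shows "(\<lambda>z. \<integral>\<omega>. delayed_obs t z \<omega> \<partial>S) \<in> borel_measurable D0"
  using case_nat_renewal_measurable[OF assms] by (rule S.borel_measurable_lebesgue_integral)

lemma inner_mean_bound: "\<bar>\<integral>\<omega>. delayed_obs t z \<omega> \<partial>S\<bar> \<le> B"
proof -
  from integrable_delayed_obs have "(\<integral>\<omega>. \<bar>delayed_obs t z \<omega>\<bar> \<partial>S) \<le> (\<integral>\<omega>. B \<partial>S)"
    by (intro integral_mono) (auto intro: observe_bounds)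
  also have "\<dots> = B"
    by (simp add: S.P.prob_space)
  finally show ?thesis
    using integral_abs_bound[of S "\<lambda>\<omega>. delayed_obs t z \<omega>"] by linarith
qed

lemma delayed_mean_renewal_equation:
  assumes D0: "prob_space D0" "sets D0 = sets (borel :: ('m \<times> real) measure)"
  shows "((\<lambda>t. delayed_mean D0 t - (\<integral>z. H (t - snd z) \<partial>D0)) \<longlongrightarrow> 0) at_top"
proof -
  interpret D0: prob_space D0 by fact
  note [measurable_cong] = D0(2)
  note [measurable] = inner_mean_measurable[OF D0(2)]
  let ?f = "\<lambda>t z. (\<integral>\<omega>. delayed_obs t z \<omega> \<partial>S) - H (t - snd z)"
  have eq: "delayed_mean D0 t - (\<integral>z. H (t - snd z) \<partial>D0) = (\<integral>z. ?f t z \<partial>D0)" for t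
    unfolding delayed_mean_def
  proof (rule Bochner_Integration.integral_diff[symmetric])
    show "integrable D0 (\<lambda>z. \<integral>\<omega>. delayed_obs t z \<omega> \<partial>S)"
      by (rule D0.integrable_const_bound[where B = B]) (use inner_mean_bound in auto)
    show "integrable D0 (\<lambda>z. H (t - snd z))"
      by (rule D0.integrable_const_bound[where B = B]) (use H_bound in auto)
  qed
  have zero: "?f t z = 0" if "snd z + h < t" for t z
  proof -
    have "(\<integral>\<omega>. delayed_obs t z \<omega> \<partial>S) = H (t - snd z)"
      unfolding H_def
    proof (rule integral_cong_AE)
      show "AE \<omega> in S. delayed_obs t z \<omega> = observe \<Phi> (t - snd z) (renewal_points \<omega>)"
        using AE_locally_finite by eventually_elim (rule observe_after_delay, use that in auto)
    qed measurable
    then show ?thesis by simp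
  qed
  have "((\<lambda>t. \<integral>z. ?f t z \<partial>D0) \<longlongrightarrow> (\<integral>z. 0 \<partial>D0)) at_top"
  proof (rule integral_dominated_convergence_at_top[where w = "\<lambda>_. 2 * B"])
    show "AE z in D0. ((\<lambda>t. ?f t z) \<longlongrightarrow> 0) at_top"
    proof (rule AE_I2)
      fix z
      have "\<forall>\<^sub>F t in at_top. ?f t z = 0"
        using eventually_gt_at_top[of "snd z + h"] by eventually_elim (rule zero)
      then show "((\<lambda>t. ?f t z) \<longlongrightarrow> 0) at_top"
        by (rule tendsto_eventually)
    qed
    show "\<forall>\<^sub>F t in at_top. AE z in D0. norm (?f t z) \<le> 2 * B"
    proof (intro always_eventually allI AE_I2)
      fix t z
      show "norm (?f t z) \<le> 2 * B"
        using inner_mean_bound[of t z] H_bound[of "t - snd z"] unfolding real_norm_def by linarith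
    qed
  qed auto
  then show ?thesis
    by (simp add: eq)
qed

lemma case_nat_measurable_delayed:
  assumes "sets D0 = sets (borel :: ('m \<times> real) measure)"
  shows "sets S = sets (PiM UNIV (\<lambda>i::nat. if i = 0 then D0 else D))"
    and "(\<lambda>(z, \<omega>). case_nat z \<omega>) \<in> measurable (D0 \<Otimes>\<^sub>M S) (PiM UNIV (\<lambda>i::nat. if i = 0 then D0 else D))"
proof -
  have [measurable_cong]: "sets D0 = sets D"
    using assms sets_D by simp
  show sets: "sets S = sets (PiM UNIV (\<lambda>i::nat. if i = 0 then D0 else D))"
    by (intro sets_PiM_cong) (auto simp: sets_D assms)
  have "(\<lambda>(z, \<omega>). case_nat z \<omega>) \<in> measurable (D0 \<Otimes>\<^sub>M S) S"
    by measurable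
  then show "(\<lambda>(z, \<omega>). case_nat z \<omega>) \<in> measurable (D0 \<Otimes>\<^sub>M S) (PiM UNIV (\<lambda>i::nat. if i = 0 then D0 else D))"
    using measurable_cong_sets[OF refl sets] by blast
qed

text \<open>This extends \<open>sequence_space.PiM_iter\<close> to a first coordinate with a law of its own; it suffices to compare
  the two measures on cylinders.\<close>

lemma PiM_delayed:
  assumes D0: "prob_space D0" "sets D0 = sets (borel :: ('m \<times> real) measure)"
  shows "distr (D0 \<Otimes>\<^sub>M S) (PiM UNIV (\<lambda>i::nat. if i = 0 then D0 else D)) (\<lambda>(z, \<omega>). case_nat z \<omega>)
    = PiM UNIV (\<lambda>i::nat. if i = 0 then D0 else D)" (is "?L = PiM UNIV ?M")
proof -
  interpret D0: prob_space D0 by fact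
  note [measurable_cong] = D0(2)
  interpret M: product_prob_space ?M UNIV
    by (intro product_prob_spaceI) (auto intro: D0 D.prob_space_axioms)
  have spD0: "space D0 = UNIV"
    using sets_eq_imp_space_eq[OF D0(2)] by simp
  note meas = case_nat_measurable_delayed(2)[OF D0(2)]
  show ?thesis
  proof (rule M.PiM_eq)
    fix J :: "nat set" and F
    assume J: "finite J" and F: "\<And>j. j \<in> J \<Longrightarrow> F j \<in> sets (?M j)"
    let ?E = "prod_emb UNIV ?M J (\<Pi>\<^sub>E j\<in>J. F j)"
    define A where "A = (if 0 \<in> J then F 0 else UNIV)"
    let ?K = "Suc -` J"
    let ?C = "{\<omega> \<in> space S. \<forall>i\<in>?K. \<omega> i \<in> F (Suc i)}"
    have K: "finite ?K"
      using J by (intro finite_vimageI) auto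
    have FK: "F (Suc i) \<in> sets D" if "i \<in> ?K" for i
      using F[of "Suc i"] that by simp
    have A: "A \<in> sets D0"
      using F[of 0] sets.top[of D0] by (simp add: A_def spD0)
    have C: "?C \<in> sets S"
      using K FK by (intro sets.sets_Collect_finite_All) auto
    have "?E \<in> sets (PiM UNIV ?M)"
      using F J by (intro sets_PiM_I) auto
    then have "emeasure ?L ?E = emeasure (D0 \<Otimes>\<^sub>M S) ((\<lambda>(z, \<omega>). case_nat z \<omega>) -` ?E \<inter> space (D0 \<Otimes>\<^sub>M S))"
      by (rule emeasure_distr[OF meas])
    also have "(\<lambda>(z, \<omega>). case_nat z \<omega>) -` ?E \<inter> space (D0 \<Otimes>\<^sub>M S) = A \<times> ?C"
    proof -
      have E: "?E = {\<omega>. \<forall>j\<in>J. \<omega> j \<in> F j}"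
        by (auto simp: prod_emb_def space_PiM spD0 PiE_iff)
      have iff: "(\<forall>j\<in>J. case_nat z \<omega> j \<in> F j) \<longleftrightarrow> z \<in> A \<and> (\<forall>i\<in>?K. \<omega> i \<in> F (Suc i))" for z \<omega>
      proof (intro iffI conjI ballI)
        assume *: "\<forall>j\<in>J. case_nat z \<omega> j \<in> F j"
        show "z \<in> A"
          using *[rule_format, of 0] by (simp add: A_def)
        show "\<omega> i \<in> F (Suc i)" if "i \<in> ?K" for i
          using *[rule_format, of "Suc i"] that by simp
      next
        fix j assume *: "z \<in> A \<and> (\<forall>i\<in>?K. \<omega> i \<in> F (Suc i))" "j \<in> J"
        then show "case_nat z \<omega> j \<in> F j"
          by (cases j) (auto simp: A_def)
      qed
      have "x \<in> (\<lambda>(z, \<omega>). case_nat z \<omega>) -` ?E \<inter> space (D0 \<Otimes>\<^sub>M S) \<longleftrightarrow> x \<in> A \<times> ?C" for x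
      proof -
        obtain z \<omega> where x: "x = (z, \<omega>)" by (cases x)
        have "\<omega> \<in> space S" "z \<in> space D0"
          by (simp_all add: space_PiM spD0)
        then show ?thesis
          unfolding x E vimage_eq Int_iff mem_Times_iff mem_Collect_eq prod.case iff space_pair_measure fst_conv snd_conv
          by blast
      qed
      then show ?thesis
        by blast
    qed
    also have "emeasure (D0 \<Otimes>\<^sub>M S) (A \<times> ?C) = emeasure D0 A * emeasure S ?C"
      by (rule S.P.emeasure_pair_measure_Times[OF A C])
    also have "emeasure S ?C = (\<Prod>i\<in>?K. emeasure D (F (Suc i)))"
      using K FK by (intro S.emeasure_PiM_Collect) auto
    also have "\<dots> = (\<Prod>j\<in>J - {0}. emeasure (?M j) (F j))"
    proof (rule prod.reindex_cong[of Suc, symmetric])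
      show "J - {0} = Suc ` ?K"
      proof (intro equalityI subsetI)
        fix j assume j: "j \<in> J - {0}"
        then show "j \<in> Suc ` ?K"
          by (cases j) auto
      qed auto
    qed simp_all
    also have "emeasure D0 A * (\<Prod>j\<in>J - {0}. emeasure (?M j) (F j)) = (\<Prod>j\<in>J. emeasure (?M j) (F j))"
    proof (cases "0 \<in> J")
      case True
      then show ?thesis
        using prod.remove[OF J True, of "\<lambda>j. emeasure (?M j) (F j)"] by (simp add: A_def)
    next
      case False
      then show ?thesis
        using D0.emeasure_space_1 by (simp add: A_def spD0)
    qed
    finally show "emeasure ?L ?E = (\<Prod>j\<in>J. emeasure (?M j) (F j))" .
  qed simp
qed

lemma delayed_mean_eq_integral_PiM:
  assumes D0: "prob_space D0" "sets D0 = sets (borel :: ('m \<times> real) measure)"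
  shows "(\<integral>\<omega>. observe \<Phi> t (renewal_points \<omega>) \<partial>PiM UNIV (\<lambda>i::nat. if i = 0 then D0 else D)) = delayed_mean D0 t"
proof -
  let ?f = "\<lambda>(z, \<omega>). delayed_obs t z \<omega>"
  let ?M = "PiM UNIV (\<lambda>i::nat. if i = 0 then D0 else D)"
  interpret D0: prob_space D0 by fact
  interpret DS: pair_prob_space D0 S ..
  note sets = case_nat_measurable_delayed(1)[OF D0(2)] and map = case_nat_measurable_delayed(2)[OF D0(2)]
  have obs: "(\<lambda>\<omega>. observe \<Phi> t (renewal_points \<omega>)) \<in> borel_measurable ?M"
    using observe_renewal_measurable measurable_cong_sets[OF sets refl] by blast
  have "(\<integral>\<omega>. observe \<Phi> t (renewal_points \<omega>) \<partial>?M)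
      = (\<integral>\<omega>. observe \<Phi> t (renewal_points \<omega>) \<partial>distr (D0 \<Otimes>\<^sub>M S) ?M (\<lambda>(z, \<omega>). case_nat z \<omega>))"
    by (simp only: PiM_delayed[OF D0])
  also have "\<dots> = (\<integral>x. ?f x \<partial>(D0 \<Otimes>\<^sub>M S))"
    by (subst integral_distr[OF map obs]) (simp add: case_prod_beta')
  also have "\<dots> = delayed_mean D0 t"
  proof -
    have "integrable (D0 \<Otimes>\<^sub>M S) ?f"
      by (rule DS.P.integrable_const_bound[where B = B])
        (use case_nat_renewal_measurable[OF D0(2)] in \<open>auto intro!: AE_I2 observe_bounds\<close>)
    then show ?thesis
      unfolding delayed_mean_def by (subst DS.integral_fst'[symmetric]) simp_all
  qed
  finally show ?thesis .
qed

lemma delayed_mean_undelayed: "delayed_mean D t = H t"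
  using delayed_mean_eq_integral_PiM[OF D.prob_space_axioms sets_D, of t] by (simp add: H_def)

lemma H_asymptotically_invariant: "((\<lambda>t. H (t + s) - H t) \<longlongrightarrow> 0) at_top"
proof (rule asymptotic_shift_invariance[where F = "distr D borel snd"])
  show "prob_space (distr D borel snd)"
    by (rule D.prob_space_distr) measurable
  show "AE x in distr D borel snd. 0 \<le> x"
    using nonneg by (subst AE_distr_iff) auto
  have "((\<lambda>t. delayed_mean D t - (\<integral>z. H (t - snd z) \<partial>D)) \<longlongrightarrow> 0) at_top"
    by (rule delayed_mean_renewal_equation[OF D.prob_space_axioms sets_D])
  then show "((\<lambda>t. H t - (\<integral>x. H (t - x) \<partial>distr D borel snd)) \<longlongrightarrow> 0) at_top"
    by (simp add: delayed_mean_undelayed integral_distr)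
qed (use nonarith H_bound H_uniformly_continuous in auto)

text \<open>The differences \<open>H (t - x) - H t\<close> vanish for each delay \<open>x\<close>, hence also on average.\<close>

theorem delay_forgotten:
  assumes D0: "prob_space D0" "sets D0 = sets (borel :: ('m \<times> real) measure)"
  shows "((\<lambda>t. delayed_mean D0 t - H t) \<longlongrightarrow> 0) at_top"
proof -
  interpret D0: prob_space D0 by fact
  note [measurable_cong] = D0(2)
  have eq: "(\<integral>z. H (t - snd z) - H t \<partial>D0) = (\<integral>z. H (t - snd z) \<partial>D0) - H t" for t
  proof -
    have "integrable D0 (\<lambda>z. H (t - snd z))"
      by (rule D0.integrable_const_bound[where B = B]) (use H_bound in auto)
    then show ?thesis
      by (simp add: D0.prob_space)
  qed
  have "((\<lambda>t. \<integral>z. H (t - snd z) - H t \<partial>D0) \<longlongrightarrow> (\<integral>z. 0 \<partial>D0)) at_top"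
  proof (rule integral_dominated_convergence_at_top[where w = "\<lambda>_. 2 * B"])
    show "AE z in D0. ((\<lambda>t. H (t - snd z) - H t) \<longlongrightarrow> 0) at_top"
    proof (rule AE_I2)
      show "((\<lambda>t. H (t - snd z) - H t) \<longlongrightarrow> 0) at_top" for z :: "'m \<times> real"
        using H_asymptotically_invariant[of "- snd z"] by simp
    qed
    show "\<forall>\<^sub>F t in at_top. AE z in D0. norm (H (t - snd z) - H t) \<le> 2 * B"
    proof (intro always_eventually allI AE_I2)
      fix t z
      show "norm (H (t - snd z) - H t) \<le> 2 * B"
        using H_bound[of t] H_bound[of "t - snd z"] unfolding real_norm_def by linarith
    qed
  qed auto
  then have "((\<lambda>t. (\<integral>z. H (t - snd z) \<partial>D0) - H t) \<longlongrightarrow> 0) at_top"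
    by (simp add: eq)
  from tendsto_add[OF delayed_mean_renewal_equation[OF D0] this] show ?thesis
    by simp
qed

end

section \<open>Stationarity of the two-sided process\<close>

lemma observe_reindex:
  assumes "bij \<pi>"
  shows "observe \<Phi> t (\<lambda>i. x (\<pi> i)) = observe \<Phi> t x"
proof -
  have "dirac_sum UNIV (\<lambda>i. shift_points t x (\<pi> i)) = dirac_sum UNIV (shift_points t x)"
    using assms by (intro dirac_sum_reindex) simp
  moreover have "shift_points t (\<lambda>i. x (\<pi> i)) = (\<lambda>i. shift_points t x (\<pi> i))"
    by (simp add: fun_eq_iff shift_points_def)
  ultimately show ?thesis
    by (simp add: observe_def point_process_def)
qed

lemma observe_shift_points: "observe \<Phi> t (shift_points s x) = observe \<Phi> (t + s) x"
  by (simp add: observe_def add.commute[of t] shift_points_add)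

text \<open>Point \<open>0\<close> is at the origin, and the interval that ends at point \<open>k\<close> has length \<open>snd (\<omega> k)\<close>.\<close>

definition two_sided_time :: "(int \<Rightarrow> 'm \<times> real) \<Rightarrow> int \<Rightarrow> real" where
  "two_sided_time \<omega> k = (if k \<ge> 0 then (\<Sum>j\<in>{1..k}. snd (\<omega> j)) else - (\<Sum>j\<in>{k+1..0}. snd (\<omega> j)))"

definition two_sided_points :: "(int \<Rightarrow> 'm \<times> real) \<Rightarrow> int \<Rightarrow> real \<times> 'm" where
  "two_sided_points \<omega> k = (two_sided_time \<omega> k, fst (\<omega> k))"

lemma two_sided_time_0 [simp]: "two_sided_time \<omega> 0 = 0"
  by (simp add: two_sided_time_def)

lemma two_sided_time_step: "two_sided_time \<omega> k - two_sided_time \<omega> (k - 1) = snd (\<omega> k)"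
proof -
  consider "k \<ge> 1" | "k = 0" | "k < 0" by linarith
  then show ?thesis
  proof cases
    case 1
    then have "{1..k} = insert k {1..k - 1}" by auto
    then show ?thesis using 1 by (simp add: two_sided_time_def)
  next
    case 2
    then show ?thesis by (simp add: two_sided_time_def)
  next
    case 3
    then have "{k..0} = insert k {k + 1..0}" by auto
    then show ?thesis using 3 by (simp add: two_sided_time_def)
  qed
qed

lemma two_sided_time_Suc: "two_sided_time \<omega> (1 + int n) = (\<Sum>j\<le>n. snd (\<omega> (1 + int j)))"
proof (induction n)
  case 0
  show ?case
    using two_sided_time_step[of \<omega> 1] by simp
next
  case (Suc n)
  then show ?case
    using two_sided_time_step[of \<omega> "2 + int n"] by simp
qed

lemma two_sided_time_shift:
  "two_sided_time (\<lambda>j. \<omega> (j + n)) k = two_sided_time \<omega> (k + n) - two_sided_time \<omega> n"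
proof (induction k rule: int_induct[of _ 0])
  case (step1 k)
  then show ?case
    using two_sided_time_step[of "\<lambda>j. \<omega> (j + n)" "k + 1"] two_sided_time_step[of \<omega> "k + 1 + n"]
    by (simp add: algebra_simps)
next
  case (step2 k)
  then show ?case
    using two_sided_time_step[of "\<lambda>j. \<omega> (j + n)" k] two_sided_time_step[of \<omega> "k + n"]
    by (simp add: algebra_simps)
qed simp

lemma two_sided_points_shift:
  "two_sided_points (\<lambda>j. \<omega> (j + n)) = (\<lambda>k. shift_points (two_sided_time \<omega> n) (two_sided_points \<omega>) (k + n))"
  by (simp add: fun_eq_iff two_sided_points_def shift_points_def two_sided_time_shift)

lemma observe_two_sided_shift:
  "observe \<Phi> s (two_sided_points (\<lambda>j. \<omega> (j + n))) = observe \<Phi> (s + two_sided_time \<omega> n) (two_sided_points \<omega>)"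
proof -
  have "bij (\<lambda>k. k + n)" by (rule bij_betw_byWitness[of _ "\<lambda>k. k - n"]) auto
  from observe_reindex[OF this, of \<Phi> s "shift_points (two_sided_time \<omega> n) (two_sided_points \<omega>)"]
  show ?thesis
    unfolding two_sided_points_shift by (simp add: observe_shift_points)
qed

lemma two_sided_time_mono:
  assumes "\<And>j. 0 \<le> snd (\<omega> j)" "k \<le> k'"
  shows "two_sided_time \<omega> k \<le> two_sided_time \<omega> k'"
  using \<open>k \<le> k'\<close>
proof (induction k' rule: int_ge_induct)
  case (step k')
  then show ?case
    using two_sided_time_step[of \<omega> "k' + 1"] assms(1)[of "k' + 1"] by simp
qed simp

definition cell :: "(int \<Rightarrow> 'm \<times> real) \<Rightarrow> int \<Rightarrow> real \<Rightarrow> ennreal" where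
  "cell \<omega> k = indicator {two_sided_time \<omega> (k - 1)<..two_sided_time \<omega> k}"

lemma cell_shift: "cell (\<lambda>j. \<omega> (j + n)) k s = cell \<omega> (k + n) (s + two_sided_time \<omega> n)"
  by (auto simp: cell_def indicator_def two_sided_time_shift algebra_simps)

text \<open>By local finiteness the times are unbounded in both directions, so that each \<open>s\<close> lies in exactly one
  cell.\<close>

lemma suminf_cell:
  assumes nn: "\<And>j. 0 \<le> snd (\<omega> j)" and lf: "locally_finite_points (two_sided_points \<omega>)"
    and e: "bij (e :: nat \<Rightarrow> int)"
  shows "(\<Sum>n. cell \<omega> (e n) s) = 1"
proof -
  let ?T = "two_sided_time \<omega>"
  note mono = two_sided_time_mono[of \<omega>, OF nn]
  have fin: "finite {k. \<bar>?T k\<bar> \<le> h}" for h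
    using lf by (simp add: locally_finite_points_def two_sided_points_def)
  have "\<exists>k. s \<le> ?T k"
  proof (rule ccontr)
    assume "\<not> ?thesis"
    then have less: "?T k < s" for k
      by (simp add: not_le)
    have "\<bar>?T k\<bar> \<le> \<bar>s\<bar>" if "0 \<le> k" for k
      using mono[OF that] less[of k] by simp
    then have "{0..} \<subseteq> {k. \<bar>?T k\<bar> \<le> \<bar>s\<bar>}"
      by auto
    then show False
      using fin infinite_Ici finite_subset by blast
  qed
  then obtain k1 where k1: "s \<le> ?T k1" by blast
  have "\<exists>k. ?T k < s"
  proof (rule ccontr)
    assume "\<not> ?thesis"
    then have ge: "s \<le> ?T k" for k
      by (simp add: not_less)
    have "\<bar>?T k\<bar> \<le> \<bar>s\<bar>" if "k \<le> 0" for k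
      using mono[OF that] ge[of k] by simp
    then have "{..0} \<subseteq> {k. \<bar>?T k\<bar> \<le> \<bar>s\<bar>}"
      by auto
    then show False
      using fin infinite_Iic finite_subset by blast
  qed
  then obtain k0 where k0: "?T k0 < s" by blast
  define k where "k = (LEAST n. s \<le> ?T (k0 + int n))"
  have "k0 \<le> k1"
    using k0 k1 mono[of k1 k0] by linarith
  then have ex: "s \<le> ?T (k0 + int (nat (k1 - k0)))"
    using k1 by simp
  have k: "s \<le> ?T (k0 + int k)"
    unfolding k_def by (rule LeastI[of "\<lambda>n. s \<le> ?T (k0 + int n)", OF ex])
  have "k \<noteq> 0"
    using k k0 by (intro notI) simp
  have "\<not> s \<le> ?T (k0 + int (k - 1))"
    unfolding k_def by (rule not_less_Least) (use \<open>k \<noteq> 0\<close> in \<open>simp add: k_def\<close>)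
  then have k': "?T (k0 + int k - 1) < s"
    using \<open>k \<noteq> 0\<close> by (simp add: of_nat_diff algebra_simps)
  define K where "K = k0 + int k"
  have K: "?T (K - 1) < s" "s \<le> ?T K"
    using k k' by (simp_all add: K_def)
  have unique: "i = K" if "?T (i - 1) < s" "s \<le> ?T i" for i
  proof (rule ccontr)
    assume "i \<noteq> K"
    then consider "i \<le> K - 1" | "K \<le> i - 1" by linarith
    then show False
      using that K mono[of i "K - 1"] mono[of K "i - 1"] by cases linarith+
  qed
  obtain n0 where n0: "e n0 = K"
    using bij_is_surj[OF e] by (metis surjD)
  have "cell \<omega> (e n) s = (if n = n0 then 1 else 0)" for n
  proof (cases "n = n0")
    case True
    then show ?thesis using K n0 by (simp add: cell_def)
  next
    case False
    then have "e n \<noteq> K"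
      using bij_is_inj[OF e] n0 by (auto dest: injD)
    then show ?thesis
      using False unique[of "e n"] by (auto simp: cell_def indicator_def)
  qed
  then have "(\<lambda>n. cell \<omega> (e n) s) sums 1"
    using sums_single[of n0 "\<lambda>_. 1 :: ennreal"] by simp
  then show ?thesis
    by (rule sums_unique[symmetric])
qed

context window_functional
begin

abbreviation R :: "(int \<Rightarrow> 'm \<times> real) measure" where
  "R \<equiv> PiM UNIV (\<lambda>_. D)"

sublocale R: product_prob_space "\<lambda>_. D" "UNIV :: int set" ..

lemma reindex_measurable: "(\<lambda>\<omega> i. \<omega> (f i)) \<in> measurable R (PiM UNIV (\<lambda>_. D))"
  by (rule measurable_PiM_single') (auto simp: space_PiM)

lemma distr_R_reindex:
  assumes "inj (f :: 'i \<Rightarrow> int)"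
  shows "distr R (PiM UNIV (\<lambda>_. D)) (\<lambda>\<omega> i. \<omega> (f i)) = PiM UNIV (\<lambda>_. D)"
  using distr_PiM_reindex[of UNIV "\<lambda>_. D" f UNIV] assms D.prob_space_axioms by (simp add: restrict_UNIV)

lemma two_sided_time_measurable [measurable]: "(\<lambda>\<omega>. two_sided_time \<omega> k) \<in> borel_measurable R"
  unfolding two_sided_time_def by measurable

lemma two_sided_points_measurable [measurable]: "(\<lambda>\<omega>. two_sided_points \<omega> k) \<in> measurable R borel"
  unfolding two_sided_points_def by (intro borel_measurable_Pair) measurable

lemma AE_R_renewal:
  assumes "inj (f :: nat \<Rightarrow> int)"
  shows "AE \<omega> in R. locally_finite_points (renewal_points (\<lambda>i. \<omega> (f i)))"
proof -
  have "AE \<omega> in distr R S (\<lambda>\<omega> i. \<omega> (f i)). locally_finite_points (renewal_points \<omega>)"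
    using AE_locally_finite by (simp only: distr_R_reindex[OF assms])
  then show ?thesis
    by (subst (asm) AE_distr_iff) (auto intro: reindex_measurable)
qed

lemma AE_two_sided:
  "AE \<omega> in R. (\<forall>j. 0 \<le> snd (\<omega> j)) \<and> locally_finite_points (two_sided_points \<omega>)"
proof -
  have "AE \<omega> in R. \<forall>j. 0 \<le> snd (\<omega> j)"
    unfolding AE_all_countable using R.AE_component[OF _ nonneg] by auto
  moreover have "AE \<omega> in R. locally_finite_points (renewal_points (\<lambda>i. \<omega> (1 + int i)))"
    by (rule AE_R_renewal) (auto simp: inj_def)
  moreover have "AE \<omega> in R. locally_finite_points (renewal_points (\<lambda>i. \<omega> (- int i)))"
    by (rule AE_R_renewal) (auto simp: inj_def)
  ultimately show ?thesis
  proof eventually_elim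
    case (elim \<omega>)
    have right: "fst (renewal_points (\<lambda>i. \<omega> (1 + int i)) n) = two_sided_time \<omega> (1 + int n)" for n
      by (simp add: renewal_points_def two_sided_time_Suc)
    have left: "fst (renewal_points (\<lambda>i. \<omega> (- int i)) n) = - two_sided_time \<omega> (- int n - 1)" for n
    proof (induction n)
      case 0
      show ?case
        using two_sided_time_step[of \<omega> 0] by (simp add: renewal_points_def)
    next
      case (Suc n)
      have *: "- int (Suc n) = - int n - 1" "- int n - 1 - 1 = - int (Suc n) - 1"
        by simp_all
      have "fst (renewal_points (\<lambda>i. \<omega> (- int i)) (Suc n))
          = fst (renewal_points (\<lambda>i. \<omega> (- int i)) n) + snd (\<omega> (- int n - 1))"
        by (simp add: renewal_points_def flip: *(1))
      then show ?case
        using Suc two_sided_time_step[of \<omega> "- int n - 1"] unfolding *(2) by simp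
    qed
    have "finite {k. \<bar>two_sided_time \<omega> k\<bar> \<le> h}" for h
    proof (rule finite_subset)
      let ?A = "{n. \<bar>fst (renewal_points (\<lambda>i. \<omega> (1 + int i)) n)\<bar> \<le> h}"
      let ?B = "{n. \<bar>fst (renewal_points (\<lambda>i. \<omega> (- int i)) n)\<bar> \<le> h}"
      show "finite (insert 0 ((\<lambda>n. 1 + int n) ` ?A \<union> (\<lambda>n. - int n - 1) ` ?B))"
        using elim(2,3) unfolding locally_finite_points_def by blast
      show "{k. \<bar>two_sided_time \<omega> k\<bar> \<le> h} \<subseteq> insert 0 ((\<lambda>n. 1 + int n) ` ?A \<union> (\<lambda>n. - int n - 1) ` ?B)"
      proof
        fix k assume k: "k \<in> {k. \<bar>two_sided_time \<omega> k\<bar> \<le> h}"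
        consider "k = 0" | n where "k = 1 + int n" | n where "k = - int n - 1"
        proof -
          consider "k = 0" | "k \<ge> 1" | "k \<le> -1" by linarith
          then show thesis
          proof cases
            case 2
            then show ?thesis using that(2)[of "nat (k - 1)"] by simp
          next
            case 3
            then show ?thesis using that(3)[of "nat (- k - 1)"] by simp
          qed (use that in blast)
        qed
        then show "k \<in> insert 0 ((\<lambda>n. 1 + int n) ` ?A \<union> (\<lambda>n. - int n - 1) ` ?B)"
        proof cases
          case (2 n)
          then have "n \<in> ?A" using k by (simp add: right)
          then show ?thesis using 2 by blast
        next
          case (3 n)
          then have "n \<in> ?B" using k by (simp add: left)
          then show ?thesis using 3 by blast
        qed simp
      qed
    qed
    then show ?case
      using elim(1) by (simp add: locally_finite_points_def two_sided_points_def)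
  qed
qed

lemma cell_measurable: "(\<lambda>(\<omega>, s). cell \<omega> k (s + c)) \<in> borel_measurable (R \<Otimes>\<^sub>M lborel)"
proof -
  have [measurable]: "(\<lambda>z. two_sided_time (fst z) i) \<in> borel_measurable (R \<Otimes>\<^sub>M lborel)" for i
    by (rule measurable_compose[OF measurable_fst two_sided_time_measurable])
  have "(\<lambda>(\<omega>, s). cell \<omega> k (s + c)) = (\<lambda>z :: (int \<Rightarrow> 'm \<times> real) \<times> real. if two_sided_time (fst z) (k - 1) < snd z + c \<and>
      snd z + c \<le> two_sided_time (fst z) k then 1 else 0)"
    by (auto simp: cell_def indicator_def)
  moreover have "(\<lambda>z. if two_sided_time (fst z) (k - 1) < snd z + c \<and> snd z + c \<le> two_sided_time (fst z) k then 1 else 0 :: ennreal)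
      \<in> borel_measurable (R \<Otimes>\<^sub>M lborel)"
    by measurable
  ultimately show ?thesis
    by (simp only:)
qed

lemma observe_two_sided_measurable:
  "(\<lambda>(\<omega>, s). ennreal (observe \<Phi> s (two_sided_points \<omega>))) \<in> borel_measurable (R \<Otimes>\<^sub>M lborel)"
proof -
  have "(\<lambda>z. observe \<Phi> (snd z) (two_sided_points (fst z))) \<in> borel_measurable (R \<Otimes>\<^sub>M lborel)"
    by (rule observe_measurable[OF \<Phi>_measurable]) measurable
  then show ?thesis
    by (simp add: case_prod_beta)
qed

text \<open>Up to the factor \<open>mean\<close>, this is the stationary mean seen from time \<open>t\<close>, as
  \<open>stationary_mean_eq_cell_mean\<close> will show.\<close>

definition cell_mean :: "real \<Rightarrow> ennreal" where
  "cell_mean t = (\<integral>\<^sup>+\<omega>. \<integral>\<^sup>+s. cell \<omega> 0 (s - t) * ennreal (observe \<Phi> s (two_sided_points \<omega>)) \<partial>lborel \<partial>R)"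

text \<open>Mass transport: the observations made at times \<open>s\<close> with \<open>s - t\<close> in the cell of index \<open>0\<close> are sorted by
  the index \<open>k\<close> of the cell that contains \<open>s\<close>. Relabelling, which preserves the law of the sequence, moves that
  cell to index \<open>0\<close>, and \<open>s - t\<close> then runs through the cells of all indices \<open>- k\<close>.\<close>

lemma cell_mean_const: "cell_mean t = cell_mean 0"
proof -
  define e where "e = int_decode"
  have e: "bij e" "bij (\<lambda>n. - e n)"
  proof -
    show "bij e" unfolding e_def by (rule bij_int_decode)
    moreover have "bij (uminus :: int \<Rightarrow> int)" by (rule bij_uminus)
    ultimately have "bij (uminus \<circ> e)" by (rule bij_comp)
    then show "bij (\<lambda>n. - e n)" by (simp add: comp_def)
  qed
  let ?g = "\<lambda>\<omega> s. ennreal (observe \<Phi> s (two_sided_points \<omega>))"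
  let ?G = "\<lambda>k \<omega>. \<integral>\<^sup>+s. cell \<omega> 0 s * cell \<omega> (- k) (s - t) * ?g \<omega> s \<partial>lborel"
  have m: "(\<lambda>z. cell (fst z) k (snd z - t)) \<in> borel_measurable (R \<Otimes>\<^sub>M lborel)"
    "(\<lambda>z. cell (fst z) k (snd z)) \<in> borel_measurable (R \<Otimes>\<^sub>M lborel)"
    "(\<lambda>z. ?g (fst z) (snd z)) \<in> borel_measurable (R \<Otimes>\<^sub>M lborel)" for k t
    using cell_measurable[of k "- t"] cell_measurable[of k 0] observe_two_sided_measurable
    by (simp_all add: case_prod_beta')
  have sec: "cell \<omega> k \<in> borel_measurable borel" for \<omega> k
    unfolding cell_def by measurable
  have gsec: "?g \<omega> \<in> borel_measurable borel" for \<omega>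
    by (intro measurable_compose[OF _ measurable_ennreal] observe_measurable[OF \<Phi>_measurable]) simp_all
  have sec_shift: "(\<lambda>s. cell \<omega> k (s - t)) \<in> borel_measurable borel" for \<omega> k t
    by (rule measurable_compose[OF _ sec]) simp
  note secs = borel_measurable_times_ennreal sec sec_shift gsec
  have G: "?G k \<in> borel_measurable R" for k
  proof -
    have "(\<lambda>(\<omega>, s). cell \<omega> 0 s * cell \<omega> (- k) (s - t) * ?g \<omega> s) \<in> borel_measurable (R \<Otimes>\<^sub>M lborel)"
      unfolding case_prod_beta' by (intro borel_measurable_times_ennreal m)
    then show ?thesis
      by (rule lborel.borel_measurable_nn_integral)
  qed
  have term_eq: "(\<integral>\<^sup>+\<omega>. \<integral>\<^sup>+s. cell \<omega> k s * (cell \<omega> 0 (s - t) * ?g \<omega> s) \<partial>lborel \<partial>R) = (\<integral>\<^sup>+\<omega>. ?G k \<omega> \<partial>R)" for k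
  proof -
    \<comment> \<open>Moving the origin to point \<open>k\<close> turns the integral into the same functional of the relabelled
      sequence.\<close>
    have "(\<integral>\<^sup>+s. cell \<omega> k s * (cell \<omega> 0 (s - t) * ?g \<omega> s) \<partial>lborel) = ?G k (\<lambda>j. \<omega> (j + k))" for \<omega>
    proof -
      have "(\<integral>\<^sup>+s. cell \<omega> k s * (cell \<omega> 0 (s - t) * ?g \<omega> s) \<partial>lborel)
          = (\<integral>\<^sup>+s. cell \<omega> k (two_sided_time \<omega> k + s) *
              (cell \<omega> 0 (two_sided_time \<omega> k + s - t) * ?g \<omega> (two_sided_time \<omega> k + s)) \<partial>lborel)"
      proof -
        have "(\<lambda>s. cell \<omega> k s * (cell \<omega> 0 (s - t) * ?g \<omega> s)) \<in> borel_measurable borel"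
          by (intro secs)
        from nn_integral_real_affine[OF this one_neq_zero, of "two_sided_time \<omega> k"] show ?thesis
          by (simp only: mult_1 abs_one ennreal_1)
      qed
      also have "\<dots> = ?G k (\<lambda>j. \<omega> (j + k))"
      proof (rule nn_integral_cong)
        fix s
        have "cell (\<lambda>j. \<omega> (j + k)) 0 s = cell \<omega> k (s + two_sided_time \<omega> k)"
          by (simp add: cell_shift)
        moreover have "cell (\<lambda>j. \<omega> (j + k)) (- k) (s - t) = cell \<omega> 0 (s - t + two_sided_time \<omega> k)"
          by (simp add: cell_shift)
        moreover have "?g (\<lambda>j. \<omega> (j + k)) s = ?g \<omega> (s + two_sided_time \<omega> k)"
          by (simp add: observe_two_sided_shift)
        ultimately show "cell \<omega> k (two_sided_time \<omega> k + s) *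
              (cell \<omega> 0 (two_sided_time \<omega> k + s - t) * ?g \<omega> (two_sided_time \<omega> k + s))
            = cell (\<lambda>j. \<omega> (j + k)) 0 s * cell (\<lambda>j. \<omega> (j + k)) (- k) (s - t) * ?g (\<lambda>j. \<omega> (j + k)) s"
          by (simp add: algebra_simps)
      qed
      finally show ?thesis .
    qed
    then have "(\<integral>\<^sup>+\<omega>. \<integral>\<^sup>+s. cell \<omega> k s * (cell \<omega> 0 (s - t) * ?g \<omega> s) \<partial>lborel \<partial>R) = (\<integral>\<^sup>+\<omega>. ?G k (\<lambda>j. \<omega> (j + k)) \<partial>R)"
      by simp
    also have "\<dots> = (\<integral>\<^sup>+\<omega>. ?G k \<omega> \<partial>distr R R (\<lambda>\<omega> j. \<omega> (j + k)))"
      by (rule nn_integral_distr[OF reindex_measurable, symmetric]) (simp only: measurable_distr_eq1, rule G)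
    also have "distr R R (\<lambda>\<omega> j. \<omega> (j + k)) = R"
      by (rule distr_R_reindex) (auto simp: inj_def)
    finally show ?thesis .
  qed
  have "cell_mean t = (\<integral>\<^sup>+\<omega>. (\<Sum>n. \<integral>\<^sup>+s. cell \<omega> (e n) s * (cell \<omega> 0 (s - t) * ?g \<omega> s) \<partial>lborel) \<partial>R)"
    unfolding cell_mean_def
  proof (rule nn_integral_cong_AE)
    show "AE \<omega> in R. (\<integral>\<^sup>+s. cell \<omega> 0 (s - t) * ?g \<omega> s \<partial>lborel) =
        (\<Sum>n. \<integral>\<^sup>+s. cell \<omega> (e n) s * (cell \<omega> 0 (s - t) * ?g \<omega> s) \<partial>lborel)"
      using AE_two_sided
    proof eventually_elim
      case (elim \<omega>)
      have cover: "(\<Sum>n. cell \<omega> (e n) s) = 1" for s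
        using elim by (intro suminf_cell[OF _ _ e(1)]) simp_all
      have "(\<integral>\<^sup>+s. cell \<omega> 0 (s - t) * ?g \<omega> s \<partial>lborel) = (\<integral>\<^sup>+s. (\<Sum>n. cell \<omega> (e n) s * (cell \<omega> 0 (s - t) * ?g \<omega> s)) \<partial>lborel)"
        by (simp only: ennreal_suminf_multc cover mult_1)
      also have "\<dots> = (\<Sum>n. \<integral>\<^sup>+s. cell \<omega> (e n) s * (cell \<omega> 0 (s - t) * ?g \<omega> s) \<partial>lborel)"
        by (rule nn_integral_suminf) (simp only: measurable_lborel2, intro secs)
      finally show ?case .
    qed
  qed
  also have "\<dots> = (\<Sum>n. \<integral>\<^sup>+\<omega>. \<integral>\<^sup>+s. cell \<omega> (e n) s * (cell \<omega> 0 (s - t) * ?g \<omega> s) \<partial>lborel \<partial>R)"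
  proof (rule nn_integral_suminf)
    fix n
    have "(\<lambda>(\<omega>, s). cell \<omega> (e n) s * (cell \<omega> 0 (s - t) * ?g \<omega> s)) \<in> borel_measurable (R \<Otimes>\<^sub>M lborel)"
      unfolding case_prod_beta' by (intro borel_measurable_times_ennreal m)
    then show "(\<lambda>\<omega>. \<integral>\<^sup>+s. cell \<omega> (e n) s * (cell \<omega> 0 (s - t) * ?g \<omega> s) \<partial>lborel) \<in> borel_measurable R"
      by (rule lborel.borel_measurable_nn_integral)
  qed
  also have "\<dots> = (\<Sum>n. \<integral>\<^sup>+\<omega>. ?G (e n) \<omega> \<partial>R)"
    by (simp only: term_eq)
  also have "\<dots> = (\<integral>\<^sup>+\<omega>. (\<Sum>n. ?G (e n) \<omega>) \<partial>R)"
    by (rule nn_integral_suminf[symmetric]) (rule G)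
  also have "\<dots> = cell_mean 0"
    unfolding cell_mean_def
  proof (rule nn_integral_cong_AE)
    show "AE \<omega> in R. (\<Sum>n. ?G (e n) \<omega>) = (\<integral>\<^sup>+s. cell \<omega> 0 (s - 0) * ?g \<omega> s \<partial>lborel)"
      using AE_two_sided
    proof eventually_elim
      case (elim \<omega>)
      have cover: "(\<Sum>n. cell \<omega> (- e n) s) = 1" for s
        using elim by (intro suminf_cell[OF _ _ e(2)]) simp_all
      have "(\<Sum>n. ?G (e n) \<omega>) = (\<integral>\<^sup>+s. (\<Sum>n. cell \<omega> (- e n) (s - t) * (cell \<omega> 0 s * ?g \<omega> s)) \<partial>lborel)"
        by (subst nn_integral_suminf) (simp only: measurable_lborel2, intro secs, simp only: mult_ac)
      also have "\<dots> = (\<integral>\<^sup>+s. cell \<omega> 0 s * ?g \<omega> s \<partial>lborel)"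
        by (simp only: ennreal_suminf_multc cover mult_1)
      finally show ?case by (simp only: diff_zero)
    qed
  qed
  finally show ?thesis .
qed

end

section \<open>The size-biased law and the stationary process\<close>

text \<open>The origin is placed at the fraction \<open>1 - u\<close> of the interval that ends at point \<open>0\<close>, so that point \<open>0\<close>
  is at distance \<open>u * snd (\<omega> 0)\<close> to its right.\<close>

definition stationary_points :: "real \<Rightarrow> (int \<Rightarrow> 'm \<times> real) \<Rightarrow> int \<Rightarrow> real \<times> 'm" where
  "stationary_points u \<omega> = shift_points (- (u * snd (\<omega> 0))) (two_sided_points \<omega>)"

lemma stationary_point_eq:
  assumes "\<And>j. j \<noteq> 0 \<Longrightarrow> x j = snd (\<omega> j)"
  shows "stationary_point u (snd (\<omega> 0)) x k = u * snd (\<omega> 0) + two_sided_time \<omega> k"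
proof (cases "k \<ge> 0")
  case True
  have "(\<Sum>j\<in>{1..k}. x j) = (\<Sum>j\<in>{1..k}. snd (\<omega> j))"
    using assms by (intro sum.cong) auto
  then show ?thesis
    using True by (simp add: stationary_point_def two_sided_time_def)
next
  case False
  have "(\<Sum>j\<in>{k+1..-1}. x j) = (\<Sum>j\<in>{k+1..-1}. snd (\<omega> j))"
    using assms by (intro sum.cong) auto
  moreover have "{k+1..0} = insert 0 {k+1..-1}"
    using False by auto
  ultimately show ?thesis
    using False by (simp add: stationary_point_def two_sided_time_def algebra_simps)
qed

lemma renewal_points_stationary:
  "renewal_points (case_nat (fst (\<omega> 0), u * snd (\<omega> 0)) (\<lambda>i. \<omega> (1 + int i))) n = stationary_points u \<omega> (int n)"
proof (cases n)
  case 0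
  then show ?thesis
    by (simp add: renewal_points_case_nat stationary_points_def shift_points_def two_sided_points_def)
next
  case (Suc i)
  show ?thesis
    unfolding Suc renewal_points_case_nat using two_sided_time_Suc[of \<omega> i]
    by (simp add: stationary_points_def shift_points_def two_sided_points_def renewal_points_def)
qed

context window_functional
begin

definition mean :: real where
  "mean = (\<integral>z. snd z \<partial>D)"

lemma mean_gt_0: "0 < mean"
  using mean_pos by (simp add: mean_def)

definition size_biased :: "('m \<times> real) measure" where
  "size_biased = density D (\<lambda>z. ennreal (snd z / mean))"

lemma sets_size_biased [measurable_cong]: "sets size_biased = sets borel"
  by (simp add: size_biased_def sets_D)

lemma nn_integral_size_bias: "(\<integral>\<^sup>+z. ennreal (snd z / mean) \<partial>D) = 1"
proof -
  have "(\<integral>\<^sup>+z. ennreal (snd z / mean) \<partial>D) = ennreal (\<integral>z. snd z / mean \<partial>D)"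
    using integrable_snd nonneg mean_gt_0 by (intro nn_integral_eq_integral) auto
  then show ?thesis
    using mean_gt_0 by (simp flip: mean_def)
qed

lemma prob_space_size_biased: "prob_space size_biased"
proof
  show "emeasure size_biased (space size_biased) = 1"
    unfolding size_biased_def using nn_integral_size_bias by (simp add: emeasure_density)
qed

definition Rs :: "(int \<Rightarrow> 'm \<times> real) measure" where
  "Rs = PiM UNIV (\<lambda>i. if i = 0 then size_biased else D)"

text \<open>As only the coordinate \<open>0\<close> is biased, the density of the product depends on that coordinate alone. This
  carries statements about the independent and identically distributed sequence over to the biased one.\<close>

lemma Rs_eq_density: "Rs = density R (\<lambda>\<omega>. ennreal (snd (\<omega> 0) / mean))"
proof -
  let ?M = "\<lambda>i::int. if i = 0 then size_biased else D"
  interpret M: product_prob_space ?M UNIV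
    by (intro product_prob_spaceI) (auto intro: prob_space_size_biased D.prob_space_axioms)
  have sets: "sets R = sets (PiM UNIV ?M)"
    by (intro sets_PiM_cong) (auto simp: sets_D sets_size_biased)
  have "density R (\<lambda>\<omega>. ennreal (snd (\<omega> 0) / mean)) = PiM UNIV ?M"
  proof (rule M.PiM_eq)
    show "sets (density R (\<lambda>\<omega>. ennreal (snd (\<omega> 0) / mean))) = sets (PiM UNIV ?M)"
      using sets by simp
    fix J :: "int set" and F
    assume J: "finite J" and F: "\<And>j. j \<in> J \<Longrightarrow> F j \<in> sets (?M j)"
    have F' [measurable]: "F j \<in> sets D" if "j \<in> J" for j
      using F[OF that] by (simp add: sets_D sets_size_biased split: if_splits)
    define Y :: "int \<Rightarrow> 'm \<times> real \<Rightarrow> ennreal" where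
      "Y j z = (if j = 0 then ennreal (snd z / mean) else 1) * (if j \<in> J then indicator (F j) z else 1)" for j z
    have Y [measurable]: "Y j \<in> borel_measurable D" for j
      unfolding Y_def using F' by (cases "j = 0"; cases "j \<in> J") simp_all
    have YM: "(\<integral>\<^sup>+z. Y j z \<partial>D) = (if j \<in> J then emeasure (?M j) (F j) else 1)" for j
      using F' nn_integral_size_bias
      by (auto simp: Y_def size_biased_def emeasure_density D.emeasure_space_1[simplified])
    let ?E = "prod_emb UNIV ?M J (\<Pi>\<^sub>E j\<in>J. F j)"
    have E: "?E = {\<omega>. \<forall>j\<in>J. \<omega> j \<in> F j}"
      by (auto simp: prod_emb_def space_PiM sets_eq_imp_space_eq[OF sets_size_biased] PiE_iff)
    have "?E \<in> sets R"
      using F J unfolding sets by (intro sets_PiM_I) auto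
    then have "emeasure (density R (\<lambda>\<omega>. ennreal (snd (\<omega> 0) / mean))) ?E
        = (\<integral>\<^sup>+\<omega>. ennreal (snd (\<omega> 0) / mean) * indicator ?E \<omega> \<partial>R)"
      by (intro emeasure_density) auto
    also have "\<dots> = (\<integral>\<^sup>+\<omega>. (\<Prod>j\<in>insert 0 J. Y j (\<omega> j)) \<partial>R)"
    proof (rule nn_integral_cong)
      fix \<omega>
      have "(\<Prod>j\<in>insert 0 J. Y j (\<omega> j))
          = (\<Prod>j\<in>insert 0 J. (if j = 0 then ennreal (snd (\<omega> j) / mean) else 1)) * (\<Prod>j\<in>insert 0 J. (if j \<in> J then indicator (F j) (\<omega> j) else 1))"
        unfolding Y_def by (rule prod.distrib)
      also have "(\<Prod>j\<in>insert 0 J. (if j = 0 then ennreal (snd (\<omega> j) / mean) else 1)) = ennreal (snd (\<omega> 0) / mean)"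
        using J by (simp add: prod.delta)
      also have "(\<Prod>j\<in>insert 0 J. (if j \<in> J then indicator (F j) (\<omega> j) else 1 :: ennreal)) = (\<Prod>j\<in>J. indicator (F j) (\<omega> j))"
        using J by (intro prod.mono_neutral_cong_right) auto
      also have "\<dots> = indicator ?E \<omega>"
      proof (cases "\<forall>j\<in>J. \<omega> j \<in> F j")
        case False
        then have "\<exists>j\<in>J. indicator (F j) (\<omega> j) = (0 :: ennreal)"
          by (auto simp: indicator_def)
        then show ?thesis
          using J False unfolding E by (simp add: prod_zero)
      qed (simp add: E)
      finally show "ennreal (snd (\<omega> 0) / mean) * indicator ?E \<omega> = (\<Prod>j\<in>insert 0 J. Y j (\<omega> j))" ..
    qed
    also have "\<dots> = (\<integral>\<^sup>+\<omega>. (\<Prod>j\<in>insert 0 J. Y j (\<omega> j)) \<partial>distr R (PiM (insert 0 J) (\<lambda>_. D)) (\<lambda>\<omega>. restrict \<omega> (insert 0 J)))"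
      using J by (subst nn_integral_distr) (auto intro!: nn_integral_cong prod.cong)
    also have "\<dots> = (\<integral>\<^sup>+\<omega>. (\<Prod>j\<in>insert 0 J. Y j (\<omega> j)) \<partial>PiM (insert 0 J) (\<lambda>_. D))"
      using J by (subst R.distr_PiM_restrict_finite) auto
    also have "\<dots> = (\<Prod>j\<in>insert 0 J. \<integral>\<^sup>+z. Y j z \<partial>D)"
      using J by (intro R.product_nn_integral_prod) auto
    also have "\<dots> = (\<Prod>j\<in>J. emeasure (?M j) (F j))"
      unfolding YM using J by (intro prod.mono_neutral_cong_right) auto
    finally show "emeasure (density R (\<lambda>\<omega>. ennreal (snd (\<omega> 0) / mean))) ?E = (\<Prod>j\<in>J. emeasure (?M j) (F j))" .
  qed
  then show ?thesis
    by (simp add: Rs_def)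
qed

abbreviation unif :: "real measure" where
  "unif \<equiv> uniform_measure lborel {0..1}"

lemma prob_space_unif: "prob_space unif"
  by (rule prob_space_uniform_measure) auto

lemma stationary_points_measurable:
  "(\<lambda>z. stationary_points (fst z) (snd z) k) \<in> measurable (lborel \<Otimes>\<^sub>M R) borel"
proof -
  have [measurable]: "(\<lambda>z. two_sided_points (snd z) k) \<in> measurable (lborel \<Otimes>\<^sub>M R) borel"
    by (rule measurable_compose[OF measurable_snd two_sided_points_measurable])
  show ?thesis
    unfolding stationary_points_def shift_points_def by (intro borel_measurable_Pair) measurable
qed

lemma observe_stationary_measurable:
  "(\<lambda>z. observe \<Phi> t (stationary_points (fst z) (snd z))) \<in> borel_measurable (lborel \<Otimes>\<^sub>M R)"
  by (rule observe_measurable[OF \<Phi>_measurable]) (simp_all add: stationary_points_measurable)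

definition stationary_mean :: "real \<Rightarrow> ennreal" where
  "stationary_mean t = (\<integral>\<^sup>+u. \<integral>\<^sup>+\<omega>. ennreal (observe \<Phi> t (stationary_points u \<omega>)) \<partial>Rs \<partial>unif)"

lemma nn_integral_unif:
  assumes "f \<in> borel_measurable borel"
  shows "(\<integral>\<^sup>+u. f u \<partial>unif) = (\<integral>\<^sup>+u. indicator {0..1} u * f u \<partial>lborel)"
  using assms by (subst nn_integral_uniform_measure) (auto simp: mult.commute divide_ennreal_def)

lemma observe_stationary_section:
  "(\<lambda>\<omega>. ennreal (observe \<Phi> t (stationary_points u \<omega>))) \<in> borel_measurable R"
proof -
  have "(\<lambda>\<omega>. observe \<Phi> t (stationary_points (fst (u, \<omega>)) (snd (u, \<omega>)))) \<in> borel_measurable R"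
    by (rule measurable_compose[OF measurable_Pair1' observe_stationary_measurable]) simp
  then show ?thesis by simp
qed

lemma nn_integral_Rs:
  assumes "f \<in> borel_measurable R"
  shows "(\<integral>\<^sup>+\<omega>. f \<omega> \<partial>Rs) = (\<integral>\<^sup>+\<omega>. ennreal (snd (\<omega> 0) / mean) * f \<omega> \<partial>R)"
  unfolding Rs_eq_density using assms by (intro nn_integral_density) auto

lemma stationary_mean_eq:
  "stationary_mean t = (\<integral>\<^sup>+\<omega>. \<integral>\<^sup>+u. indicator {0..1} u * (ennreal (snd (\<omega> 0) / mean) * ennreal (observe \<Phi> t (stationary_points u \<omega>))) \<partial>lborel \<partial>R)"
proof -
  interpret LR: pair_sigma_finite lborel R ..
  let ?F = "\<lambda>u \<omega>. ennreal (snd (\<omega> 0) / mean) * ennreal (observe \<Phi> t (stationary_points u \<omega>))"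
  have F: "(\<lambda>(u, \<omega>). ?F u \<omega>) \<in> borel_measurable (lborel \<Otimes>\<^sub>M R)"
    unfolding case_prod_beta' using observe_stationary_measurable[of t] by measurable
  then have "(\<lambda>u. \<integral>\<^sup>+\<omega>. ?F u \<omega> \<partial>R) \<in> borel_measurable lborel"
    by (rule R.borel_measurable_nn_integral)
  then have "(\<integral>\<^sup>+u. \<integral>\<^sup>+\<omega>. ?F u \<omega> \<partial>R \<partial>unif) = (\<integral>\<^sup>+u. indicator {0..1} u * (\<integral>\<^sup>+\<omega>. ?F u \<omega> \<partial>R) \<partial>lborel)"
    by (intro nn_integral_unif) simp
  also have "\<dots> = (\<integral>\<^sup>+u. \<integral>\<^sup>+\<omega>. indicator {0..1} u * ?F u \<omega> \<partial>R \<partial>lborel)"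
  proof (rule nn_integral_cong)
    fix u
    have "?F u \<in> borel_measurable R"
      using observe_stationary_section[of t u] by measurable
    then show "indicator {0..1} u * (\<integral>\<^sup>+\<omega>. ?F u \<omega> \<partial>R) = (\<integral>\<^sup>+\<omega>. indicator {0..1} u * ?F u \<omega> \<partial>R)"
      by (rule nn_integral_cmult[symmetric])
  qed
  also have "\<dots> = (\<integral>\<^sup>+\<omega>. \<integral>\<^sup>+u. indicator {0..1} u * ?F u \<omega> \<partial>lborel \<partial>R)"
  proof (rule LR.Fubini'[symmetric])
    show "(\<lambda>(u, \<omega>). indicator {0..1} u * ?F u \<omega>) \<in> borel_measurable (lborel \<Otimes>\<^sub>M R)"
      using F unfolding case_prod_beta' by measurable
  qed
  finally show ?thesis
    by (simp add: stationary_mean_def nn_integral_Rs observe_stationary_section)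
qed

text \<open>The substitution \<open>s = t - u * x\<close>, with \<open>x\<close> the length of the interval, turns the uniform law of \<open>u\<close> into
  Lebesgue measure on the interval divided by \<open>x\<close>, and the size bias cancels this factor.\<close>

lemma stationary_mean_eq_cell_mean: "stationary_mean t = ennreal (1 / mean) * cell_mean t"
proof -
  let ?g = "\<lambda>\<omega> s. ennreal (observe \<Phi> s (two_sided_points \<omega>))"
  have sec: "(\<lambda>s. cell \<omega> 0 (s - t) * ?g \<omega> s) \<in> borel_measurable borel" for \<omega>
  proof (intro borel_measurable_times_ennreal)
    have "cell \<omega> 0 \<in> borel_measurable borel"
      unfolding cell_def by measurable
    then show "(\<lambda>s. cell \<omega> 0 (s - t)) \<in> borel_measurable borel"
      by (rule measurable_compose[rotated]) simp
    show "?g \<omega> \<in> borel_measurable borel"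
      by (intro measurable_compose[OF _ measurable_ennreal] observe_measurable[OF \<Phi>_measurable]) simp_all
  qed
  have "stationary_mean t = (\<integral>\<^sup>+\<omega>. ennreal (1 / mean) * (\<integral>\<^sup>+s. cell \<omega> 0 (s - t) * ?g \<omega> s \<partial>lborel) \<partial>R)"
    unfolding stationary_mean_eq
  proof (rule nn_integral_cong_AE)
    show "AE \<omega> in R. (\<integral>\<^sup>+u. indicator {0..1} u * (ennreal (snd (\<omega> 0) / mean) * ennreal (observe \<Phi> t (stationary_points u \<omega>))) \<partial>lborel)
        = ennreal (1 / mean) * (\<integral>\<^sup>+s. cell \<omega> 0 (s - t) * ?g \<omega> s \<partial>lborel)"
      using AE_two_sided
    proof eventually_elim
      case (elim \<omega>)
      let ?x = "snd (\<omega> 0)"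
      have T: "two_sided_time \<omega> (- 1) = - ?x"
        using two_sided_time_step[of \<omega> 0] by simp
      show ?case
      proof (cases "?x = 0")
        case True
        then have "cell \<omega> 0 s = 0" for s
          using T by (simp add: cell_def)
        then show ?thesis using True by simp
      next
        case False
        then have x: "0 < ?x"
          using elim by (metis less_eq_real_def)
        have "(\<integral>\<^sup>+s. cell \<omega> 0 (s - t) * ?g \<omega> s \<partial>lborel)
            = ennreal ?x * (\<integral>\<^sup>+u. cell \<omega> 0 (t + (- ?x) * u - t) * ?g \<omega> (t + (- ?x) * u) \<partial>lborel)"
          using nn_integral_real_affine[OF sec[of \<omega>], of "- ?x" t] x by simp
        also have "(\<integral>\<^sup>+u. cell \<omega> 0 (t + (- ?x) * u - t) * ?g \<omega> (t + (- ?x) * u) \<partial>lborel)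
            = (\<integral>\<^sup>+u. indicator {0..1} u * ennreal (observe \<Phi> t (stationary_points u \<omega>)) \<partial>lborel)"
        proof (rule nn_integral_cong_AE)
          show "AE u in lborel. cell \<omega> 0 (t + (- ?x) * u - t) * ?g \<omega> (t + (- ?x) * u)
              = indicator {0..1} u * ennreal (observe \<Phi> t (stationary_points u \<omega>))"
            \<comment> \<open>The value \<open>u = 1\<close> is left out because the cell is open on the left.\<close>
            using AE_lborel_singleton[of 1]
          proof eventually_elim
            case (elim u)
            have "t + (- ?x) * u - t \<in> {- ?x<..0} \<longleftrightarrow> u \<in> {0..1}"
              using x elim by (auto simp: zero_le_mult_iff mult_less_cancel_left1 less_le)
            then have "cell \<omega> 0 (t + (- ?x) * u - t) = indicator {0..1} u"
              using T by (simp add: cell_def indicator_def)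
            moreover have "observe \<Phi> t (stationary_points u \<omega>) = observe \<Phi> (t + (- ?x) * u) (two_sided_points \<omega>)"
              by (simp add: stationary_points_def observe_shift_points mult.commute)
            ultimately show ?case by simp
          qed
        qed
        also have "ennreal (1 / mean) * (ennreal ?x * (\<integral>\<^sup>+u. indicator {0..1} u * ennreal (observe \<Phi> t (stationary_points u \<omega>)) \<partial>lborel))
            = ennreal (?x / mean) * (\<integral>\<^sup>+u. indicator {0..1} u * ennreal (observe \<Phi> t (stationary_points u \<omega>)) \<partial>lborel)"
          using x mean_gt_0 by (simp add: mult.assoc[symmetric] flip: ennreal_mult)
        also have "\<dots> = (\<integral>\<^sup>+u. ennreal (?x / mean) * (indicator {0..1} u * ennreal (observe \<Phi> t (stationary_points u \<omega>))) \<partial>lborel)"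
        proof (rule nn_integral_cmult[symmetric])
          have "(\<lambda>u. observe \<Phi> t (stationary_points (fst (u, \<omega>)) (snd (u, \<omega>)))) \<in> borel_measurable lborel"
            by (rule measurable_compose[OF measurable_Pair2' observe_stationary_measurable]) (simp add: space_PiM)
          then show "(\<lambda>u. indicator {0..1} u * ennreal (observe \<Phi> t (stationary_points u \<omega>))) \<in> borel_measurable lborel"
            by simp
        qed
        finally show ?thesis
          by (simp only: mult.left_commute[of "ennreal (?x / mean)"])
      qed
    qed
  qed
  also have "\<dots> = ennreal (1 / mean) * cell_mean t"
    unfolding cell_mean_def
  proof (rule nn_integral_cmult)
    have "(\<lambda>(\<omega>, s). cell \<omega> 0 (s - t) * ?g \<omega> s) \<in> borel_measurable (R \<Otimes>\<^sub>M lborel)"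
      using cell_measurable[of 0 "- t"] observe_two_sided_measurable unfolding case_prod_beta'
      by (intro borel_measurable_times_ennreal) simp_all
    then show "(\<lambda>\<omega>. \<integral>\<^sup>+s. cell \<omega> 0 (s - t) * ?g \<omega> s \<partial>lborel) \<in> borel_measurable R"
      by (rule lborel.borel_measurable_nn_integral)
  qed
  finally show ?thesis .
qed

lemma stationary_mean_const: "stationary_mean t = stationary_mean 0"
  unfolding stationary_mean_eq_cell_mean by (simp only: cell_mean_const[of t])

lemma AE_Rs: "AE \<omega> in R. P \<omega> \<Longrightarrow> AE \<omega> in Rs. P \<omega>"
  unfolding Rs_eq_density by (subst AE_density) auto

text \<open>The law of the first mark and point to the right of the origin.\<close>

definition stationary_delay :: "('m \<times> real) measure" where
  "stationary_delay = distr (unif \<Otimes>\<^sub>M size_biased) borel (\<lambda>(u, z). (fst z, u * snd z))"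

lemma stationary_delay_map_measurable:
  "(\<lambda>(u, z). (fst z, u * snd z)) \<in> measurable (unif \<Otimes>\<^sub>M size_biased) (borel :: ('m \<times> real) measure)"
  unfolding case_prod_beta' by (intro borel_measurable_Pair) measurable

lemma prob_space_stationary_delay: "prob_space stationary_delay"
proof -
  interpret U: prob_space unif by (rule prob_space_unif)
  interpret B: prob_space size_biased by (rule prob_space_size_biased)
  interpret UB: pair_prob_space unif size_biased ..
  show ?thesis
    unfolding stationary_delay_def by (rule UB.prob_space_distr) (rule stationary_delay_map_measurable)
qed

lemma sets_stationary_delay: "sets stationary_delay = sets borel"
  by (simp add: stationary_delay_def)

lemma nn_integral_inner_mean:
  "(\<integral>\<^sup>+\<omega>. ennreal (delayed_obs t z \<omega>) \<partial>S)
    = ennreal (\<integral>\<omega>. delayed_obs t z \<omega> \<partial>S)"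
  by (rule nn_integral_eq_integral) (auto intro!: AE_I2 observe_bounds integrable_delayed_obs)

lemma nn_integral_inner_mean_law:
  assumes D0: "prob_space D0" "sets D0 = sets (borel :: ('m \<times> real) measure)"
  shows "(\<integral>\<^sup>+z. ennreal (\<integral>\<omega>. delayed_obs t z \<omega> \<partial>S) \<partial>D0) = ennreal (delayed_mean D0 t)"
  unfolding delayed_mean_def
proof (rule nn_integral_eq_integral)
  interpret D0: prob_space D0 by fact
  show "integrable D0 (\<lambda>z. \<integral>\<omega>. delayed_obs t z \<omega> \<partial>S)"
    by (rule D0.integrable_const_bound[where B = B]) (use inner_mean_bound inner_mean_measurable[OF D0(2)] in auto)
qed (auto intro!: AE_I2 integral_nonneg_AE observe_bounds)

text \<open>Late windows contain points to the right of the origin only, and these form a delayed renewal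
  process.\<close>

lemma stationary_mean_eq_delayed_mean:
  assumes t: "h < t"
  shows "stationary_mean t = ennreal (delayed_mean stationary_delay t)"
proof -
  let ?I = "\<lambda>z. \<integral>\<^sup>+\<omega>. ennreal (delayed_obs t z \<omega>) \<partial>S"
  let ?F = "\<lambda>u \<omega>. ennreal (delayed_obs t (fst (\<omega> 0), u * snd (\<omega> 0)) (\<lambda>i. \<omega> (Suc i)))"
  have I_meas: "?I \<in> borel_measurable (borel :: ('m \<times> real) measure)"
    unfolding nn_integral_inner_mean
    by (intro measurable_compose[OF _ measurable_ennreal] inner_mean_measurable) simp
  have inner: "(\<integral>\<^sup>+\<omega>. ennreal (observe \<Phi> t (stationary_points u \<omega>)) \<partial>Rs) = (\<integral>\<^sup>+z. ?I (fst z, u * snd z) \<partial>size_biased)"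
    if u: "u \<in> {0..1}" for u
  proof -
    have F_meas: "?F u \<in> borel_measurable S"
    proof (intro measurable_compose[OF _ measurable_ennreal] observe_measurable[OF \<Phi>_measurable])
      fix i
      show "(\<lambda>\<omega>. renewal_points (case_nat (fst (\<omega> 0), u * snd (\<omega> 0)) (\<lambda>i. \<omega> (Suc i))) i) \<in> measurable S borel"
      proof (cases i)
        case 0
        show ?thesis
          unfolding 0 renewal_points_case_nat by (intro borel_measurable_Pair) measurable
      next
        case (Suc n)
        show ?thesis
          unfolding Suc renewal_points_case_nat shift_points_def renewal_points_def fst_conv snd_conv
          by (intro borel_measurable_Pair) measurable
      qed
    qed simp
    have "AE \<omega> in R. ennreal (observe \<Phi> t (stationary_points u \<omega>)) = ?F u (\<lambda>i. \<omega> (int i))"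
      using AE_two_sided
    proof eventually_elim
      case (elim \<omega>)
      let ?x = "renewal_points (case_nat (fst (\<omega> 0), u * snd (\<omega> 0)) (\<lambda>i. \<omega> (1 + int i)))"
      have x: "?x n = stationary_points u \<omega> (int n)" for n
        by (rule renewal_points_stationary)
      have lf: "locally_finite_points (stationary_points u \<omega>)"
        using elim by (simp add: stationary_points_def)
      have "locally_finite_points ?x"
        unfolding locally_finite_points_def
      proof
        fix h
        have "finite (int -` {k. \<bar>fst (stationary_points u \<omega> k)\<bar> \<le> h})"
          using lf by (intro finite_vimageI) (auto simp: locally_finite_points_def inj_def)
        then show "finite {i. \<bar>fst (?x i)\<bar> \<le> h}"
          by (simp add: x vimage_def)
      qed
      have "observe \<Phi> t (stationary_points u \<omega>) = observe \<Phi> t ?x"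
        unfolding observe_def
      proof (rule window_lipschitz_point_process_eq[OF window, where \<pi> = int])
        show "shift_points t (stationary_points u \<omega>) (int i) = shift_points t ?x i" for i
          by (simp add: shift_points_def x)
        show "h < \<bar>fst (shift_points t (stationary_points u \<omega>) k)\<bar>" if "k \<notin> range int" for k
        proof -
          have "k \<le> - 1"
            using that by (metis int_one_le_iff_zero_less linorder_not_le nonneg_int_cases rangeI uminus_int_code(1) zle_add1_eq_le add.left_inverse)
          then have "two_sided_time \<omega> k \<le> two_sided_time \<omega> (- 1)"
            using elim by (intro two_sided_time_mono) auto
          also have "\<dots> = - snd (\<omega> 0)"
            using two_sided_time_step[of \<omega> 0] by simp
          also have "\<dots> \<le> - (u * snd (\<omega> 0))"
            using elim u by (simp add: mult_left_le_one_le)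
          finally show ?thesis
            using t by (simp add: stationary_points_def two_sided_points_def)
        qed
      qed (use lf \<open>locally_finite_points ?x\<close> in \<open>simp_all add: inj_def\<close>)
      then show ?case
        by simp
    qed
    then have "(\<integral>\<^sup>+\<omega>. ennreal (observe \<Phi> t (stationary_points u \<omega>)) \<partial>Rs) = (\<integral>\<^sup>+\<omega>. ?F u (\<lambda>i. \<omega> (int i)) \<partial>Rs)"
      by (intro nn_integral_cong_AE AE_Rs)
    also have "\<dots> = (\<integral>\<^sup>+\<omega>. ennreal (snd (\<omega> (int 0)) / mean) * ?F u (\<lambda>i. \<omega> (int i)) \<partial>R)"
      by (subst nn_integral_Rs) (use measurable_compose[OF reindex_measurable[of int] F_meas] in simp_all)
    also have "\<dots> = (\<integral>\<^sup>+\<omega>. ennreal (snd (\<omega> 0) / mean) * ?F u \<omega> \<partial>distr R S (\<lambda>\<omega> i. \<omega> (int i)))"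
      using F_meas by (subst nn_integral_distr[OF reindex_measurable]) simp_all
    also have "distr R S (\<lambda>\<omega> i. \<omega> (int i)) = S"
      by (rule distr_R_reindex) (simp add: inj_def)
    also have "(\<integral>\<^sup>+\<omega>. ennreal (snd (\<omega> 0) / mean) * ?F u \<omega> \<partial>S)
        = (\<integral>\<^sup>+z. \<integral>\<^sup>+\<omega>. ennreal (snd z / mean) * ennreal (delayed_obs t (fst z, u * snd z) \<omega>) \<partial>S \<partial>D)"
      using F_meas by (subst nn_integral_first_step) simp_all
    also have "\<dots> = (\<integral>\<^sup>+z. ennreal (snd z / mean) * ?I (fst z, u * snd z) \<partial>D)"
      by (intro nn_integral_cong nn_integral_cmult) measurable
    also have "\<dots> = (\<integral>\<^sup>+z. ?I (fst z, u * snd z) \<partial>size_biased)"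
    proof -
      have "(\<lambda>z. (fst z, u * snd z)) \<in> measurable D (borel :: ('m \<times> real) measure)"
        by (intro borel_measurable_Pair) measurable
      from measurable_compose[OF this I_meas] show ?thesis
        unfolding size_biased_def by (intro nn_integral_density[symmetric]) auto
    qed
    finally show ?thesis .
  qed
  interpret U: prob_space unif by (rule prob_space_unif)
  interpret B: prob_space size_biased by (rule prob_space_size_biased)
  have unif: "AE u in unif. u \<in> {0..1}"
    by (rule AE_uniform_measureI) auto
  have "stationary_mean t = (\<integral>\<^sup>+u. \<integral>\<^sup>+z. ?I (fst z, u * snd z) \<partial>size_biased \<partial>unif)"
    unfolding stationary_mean_def
  proof (rule nn_integral_cong_AE)
    show "AE u in unif. (\<integral>\<^sup>+\<omega>. ennreal (observe \<Phi> t (stationary_points u \<omega>)) \<partial>Rs) = (\<integral>\<^sup>+z. ?I (fst z, u * snd z) \<partial>size_biased)"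
      using unif by eventually_elim (rule inner)
  qed
  also have "\<dots> = (\<integral>\<^sup>+x. ?I (case x of (u, z) \<Rightarrow> (fst z, u * snd z)) \<partial>(unif \<Otimes>\<^sub>M size_biased))"
    using measurable_compose[OF stationary_delay_map_measurable I_meas]
    by (subst B.nn_integral_fst[symmetric]) simp_all
  also have "\<dots> = (\<integral>\<^sup>+z. ?I z \<partial>stationary_delay)"
    unfolding stationary_delay_def
    by (rule nn_integral_distr[symmetric, OF stationary_delay_map_measurable]) (use I_meas in simp)
  also have "\<dots> = ennreal (delayed_mean stationary_delay t)"
    unfolding nn_integral_inner_mean
    by (rule nn_integral_inner_mean_law[OF prob_space_stationary_delay sets_stationary_delay])
  finally show ?thesis .
qed

text \<open>The stationary process is a delayed renewal process with constant mean, and the delay is forgotten.\<close>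

theorem delayed_mean_tendsto_stationary_mean:
  assumes D0: "prob_space D0" "sets D0 = sets (borel :: ('m \<times> real) measure)"
  shows "(delayed_mean D0 \<longlongrightarrow> enn2real (stationary_mean 0)) at_top"
proof -
  have nonneg: "0 \<le> delayed_mean stationary_delay t" for t
    unfolding delayed_mean_def by (intro integral_nonneg_AE AE_I2 observe_bounds)
  have "\<forall>\<^sub>F t in at_top. delayed_mean stationary_delay t = enn2real (stationary_mean 0)"
    using eventually_gt_at_top[of h]
  proof eventually_elim
    case (elim t)
    show ?case
      using stationary_mean_eq_delayed_mean[OF elim] nonneg[of t]
      by (simp add: stationary_mean_const[of t])
  qed
  then have "(delayed_mean stationary_delay \<longlongrightarrow> enn2real (stationary_mean 0)) at_top"
    by (rule tendsto_eventually)
  from tendsto_diff[OF this delay_forgotten[OF prob_space_stationary_delay sets_stationary_delay]]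
  have "(H \<longlongrightarrow> enn2real (stationary_mean 0)) at_top"
    by simp
  from tendsto_add[OF this delay_forgotten[OF D0]] show ?thesis
    by simp
qed

end

section \<open>Convergence of the delayed marked renewal process\<close>

lemma (in prob_space) distr_indep_family:
  assumes "indep_vars (\<lambda>_. borel) Z UNIV"
  shows "(\<lambda>\<omega> i. Z i \<omega>) \<in> measurable M (PiM UNIV (\<lambda>_. borel))"
    and "distr M (PiM UNIV (\<lambda>_. borel)) (\<lambda>\<omega> i. Z i \<omega>) = PiM UNIV (\<lambda>i. distr M borel (Z i))"
proof -
  have rv: "random_variable borel (Z i)" for i
    using assms by (auto simp: indep_vars_def)
  show "(\<lambda>\<omega> i. Z i \<omega>) \<in> measurable M (PiM UNIV (\<lambda>_. borel))"
    by (rule measurable_PiM_single') (use rv in \<open>auto simp: space_PiM\<close>)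
  have "distr M (PiM UNIV (\<lambda>_. borel)) (\<lambda>\<omega>. \<lambda>i\<in>UNIV. Z i \<omega>) = PiM UNIV (\<lambda>i. distr M borel (Z i))"
    using indep_vars_iff_distr_eq_PiM[where I = UNIV and X = Z and M' = "\<lambda>_. borel"] rv assms by simp
  then show "distr M (PiM UNIV (\<lambda>_. borel)) (\<lambda>\<omega> i. Z i \<omega>) = PiM UNIV (\<lambda>i. distr M borel (Z i))"
    by (simp add: restrict_UNIV)
qed

lemma shift_delayed_renewal:
  "shift_measure t (delayed_renewal (\<lambda>i. fst (\<omega> i)) (\<lambda>i. snd (\<omega> i))) = point_process UNIV (shift_points t (renewal_points \<omega>))"
  unfolding delayed_renewal_eq by (rule shift_point_process)

lemma stationary_renewal_eq:
  assumes "\<omega> 0 = (ws, xs)" "\<And>k. k \<noteq> 0 \<Longrightarrow> \<omega> k = (w k, x k)"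
  shows "stationary_renewal u ws xs w x = point_process UNIV (stationary_points u \<omega>)"
proof -
  have "(stationary_point u xs x k, if k = 0 then ws else w k) = stationary_points u \<omega> k" for k
    using stationary_point_eq[of x \<omega> u k] assms
    by (simp add: stationary_points_def shift_points_def two_sided_points_def)
  then show ?thesis
    by (simp add: stationary_renewal_def)
qed

lemma (in renewal_law) window_functional_maxl:
  "\<exists>h C B. window_functional D (maxl (tents vdist) L) h C B"
proof -
  obtain h C where hC: "h > 0" "C \<ge> 0" "window_lipschitz h C (maxl (tents vdist) L :: (real \<times> 'm) measure \<Rightarrow> real)"
    using windowed_maxl[of L, where 'm = 'm] unfolding windowed_def by blast
  obtain B where B: "\<And>m :: (real \<times> 'm) measure. maxl (tents vdist) L m \<le> B"
    using maxl_tents_bounded[of vdist L] vdist_nonneg by blast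
  have "(maxl (tents vdist) L :: (real \<times> 'm) measure \<Rightarrow> real) \<in> borel_measurable (borel_algebra vague_topology)"
    by (intro maxl_measurable tents_measurable vdist_borel_measurable)
  then have "window_functional D (maxl (tents vdist) L) h C B"
    using hC B maxl_nonneg by unfold_locales auto
  then show ?thesis by blast
qed

lemma (in window_functional) integral_renewal_family:
  assumes P: "prob_space P" and indep: "prob_space.indep_vars P (\<lambda>_. borel) Z UNIV"
    and law: "\<And>i. i \<ge> 1 \<Longrightarrow> distr P borel (Z i) = D"
  shows "(\<integral>\<omega>. observe \<Phi> t (renewal_points (\<lambda>i. Z i \<omega>)) \<partial>P) = delayed_mean (distr P borel (Z 0)) t"
proof -
  interpret P: prob_space P by fact
  note Z = P.distr_indep_family[OF indep]
  let ?D0 = "distr P borel (Z 0)"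
  have rv: "Z 0 \<in> measurable P borel"
    using indep by (auto simp: P.indep_vars_def)
  have "(\<lambda>i. distr P borel (Z i)) = (\<lambda>i. if i = 0 then ?D0 else D)"
    using law by auto
  then have eq: "distr P (PiM UNIV (\<lambda>_. borel)) (\<lambda>\<omega> i. Z i \<omega>) = PiM UNIV (\<lambda>i. if i = 0 then ?D0 else D)"
    using Z(2) by simp
  have "sets S = sets (PiM UNIV (\<lambda>_::nat. borel :: ('m \<times> real) measure))"
    by (intro sets_PiM_cong) (auto simp: sets_D)
  then have "(\<lambda>\<omega>. observe \<Phi> t (renewal_points \<omega>)) \<in> borel_measurable (PiM UNIV (\<lambda>_. borel))"
    using observe_renewal_measurable measurable_cong_sets[OF _ refl] by blast
  then have "(\<integral>\<omega>. observe \<Phi> t (renewal_points (\<lambda>i. Z i \<omega>)) \<partial>P)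
      = (\<integral>\<omega>. observe \<Phi> t (renewal_points \<omega>) \<partial>distr P (PiM UNIV (\<lambda>_. borel)) (\<lambda>\<omega> i. Z i \<omega>))"
    by (rule integral_distr[OF Z(1), symmetric])
  also have "\<dots> = delayed_mean ?D0 t"
    unfolding eq by (rule delayed_mean_eq_integral_PiM) (auto intro: P.prob_space_distr rv)
  finally show ?thesis .
qed

lemma (in window_functional) integral_stationary_family:
  assumes N: "prob_space N" and indep: "prob_space.indep_vars N (\<lambda>_. borel) V UNIV"
    and law: "\<And>i. i \<noteq> 0 \<Longrightarrow> distr N borel (V i) = D" and law0: "distr N borel (V 0) = size_biased"
    and U: "U \<in> borel_measurable N" "distr N borel U = unif"
    and UV: "prob_space.indep_set N (sets (vimage_algebra (space N) U borel))
      (sets (vimage_algebra (space N) (\<lambda>\<omega> i. V i \<omega>) (PiM (UNIV :: int set) (\<lambda>_. borel :: ('m \<times> real) measure))))"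
  shows "(\<integral>\<omega>. observe \<Phi> 0 (stationary_points (U \<omega>) (\<lambda>i. V i \<omega>)) \<partial>N) = enn2real (stationary_mean 0)"
proof -
  interpret N: prob_space N by fact
  let ?Q = "PiM UNIV (\<lambda>_. borel) :: (int \<Rightarrow> 'm \<times> real) measure"
  note V = N.distr_indep_family[OF indep]
  have "(\<lambda>i. distr N borel (V i)) = (\<lambda>i. if i = 0 then size_biased else D)"
    using law law0 by auto
  then have distrV: "distr N ?Q (\<lambda>\<omega> i. V i \<omega>) = Rs"
    using V(2) by (simp add: Rs_def)
  have setsR: "sets R = sets ?Q"
    by (intro sets_PiM_cong) (auto simp: sets_D)
  have "sets (lborel \<Otimes>\<^sub>M R) = sets (borel \<Otimes>\<^sub>M ?Q)"
    by (rule sets_pair_measure_cong) (auto simp: setsR)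
  then have obs: "(\<lambda>z. observe \<Phi> 0 (stationary_points (fst z) (snd z))) \<in> borel_measurable (borel \<Otimes>\<^sub>M ?Q)"
    using observe_stationary_measurable measurable_cong_sets[OF _ refl] by blast
  have UVm: "(\<lambda>\<omega>. (U \<omega>, \<lambda>i. V i \<omega>)) \<in> measurable N (borel \<Otimes>\<^sub>M ?Q)"
    using U(1) V(1) by (rule measurable_Pair)
  from measurable_compose[OF this obs]
  have obsN: "(\<lambda>\<omega>. observe \<Phi> 0 (stationary_points (U \<omega>) (\<lambda>i. V i \<omega>))) \<in> borel_measurable N"
    by simp
  interpret U: prob_space unif by (rule prob_space_unif)
  interpret Rs: prob_space Rs
    unfolding distrV[symmetric] by (rule N.prob_space_distr[OF V(1)])
  have setsRs: "sets Rs = sets ?Q"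
    unfolding distrV[symmetric] by simp
  have "unif \<Otimes>\<^sub>M Rs = distr N (borel \<Otimes>\<^sub>M ?Q) (\<lambda>\<omega>. (U \<omega>, \<lambda>i. V i \<omega>))"
  proof (rule pair_measure_eqI)
    show "sets (unif \<Otimes>\<^sub>M Rs) = sets (distr N (borel \<Otimes>\<^sub>M ?Q) (\<lambda>\<omega>. (U \<omega>, \<lambda>i. V i \<omega>)))"
      by (simp add: setsRs cong: sets_pair_measure_cong)
    fix A E assume "A \<in> sets unif" "E \<in> sets Rs"
    then have A: "A \<in> sets borel" and E: "E \<in> sets ?Q"
      using setsRs by simp_all
    let ?A = "U -` A \<inter> space N" and ?E = "(\<lambda>\<omega> i. V i \<omega>) -` E \<inter> space N"
    have "emeasure (distr N (borel \<Otimes>\<^sub>M ?Q) (\<lambda>\<omega>. (U \<omega>, \<lambda>i. V i \<omega>))) (A \<times> E)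
        = emeasure N ((\<lambda>\<omega>. (U \<omega>, \<lambda>i. V i \<omega>)) -` (A \<times> E) \<inter> space N)"
      using A E by (intro emeasure_distr[OF UVm]) simp
    also have "(\<lambda>\<omega>. (U \<omega>, \<lambda>i. V i \<omega>)) -` (A \<times> E) \<inter> space N = ?A \<inter> ?E"
      by auto
    also have "emeasure N (?A \<inter> ?E) = ennreal (N.prob ?A * N.prob ?E)"
      using N.indep_setD[OF UV in_vimage_algebra[OF A] in_vimage_algebra[OF E]]
      by (simp add: N.emeasure_eq_measure)
    also have "\<dots> = emeasure unif A * emeasure Rs E"
      unfolding U(2)[symmetric] distrV[symmetric] using A E
      by (simp add: emeasure_distr U(1) V(1) N.emeasure_eq_measure ennreal_mult)
    finally show "emeasure unif A * emeasure Rs E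
        = emeasure (distr N (borel \<Otimes>\<^sub>M ?Q) (\<lambda>\<omega>. (U \<omega>, \<lambda>i. V i \<omega>))) (A \<times> E)" ..
  qed (rule U.sigma_finite_measure_axioms Rs.sigma_finite_measure_axioms)+
  then have joint: "distr N (borel \<Otimes>\<^sub>M ?Q) (\<lambda>\<omega>. (U \<omega>, \<lambda>i. V i \<omega>)) = unif \<Otimes>\<^sub>M Rs" ..
  have setsUR: "sets (unif \<Otimes>\<^sub>M Rs) = sets (borel \<Otimes>\<^sub>M ?Q)"
    unfolding joint[symmetric] by simp
  have "(\<integral>\<omega>. observe \<Phi> 0 (stationary_points (U \<omega>) (\<lambda>i. V i \<omega>)) \<partial>N)
      = enn2real (\<integral>\<^sup>+\<omega>. ennreal (observe \<Phi> 0 (stationary_points (U \<omega>) (\<lambda>i. V i \<omega>))) \<partial>N)"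
    by (rule integral_eq_nn_integral[OF obsN]) (auto intro!: AE_I2 observe_bounds)
  also have "(\<integral>\<^sup>+\<omega>. ennreal (observe \<Phi> 0 (stationary_points (U \<omega>) (\<lambda>i. V i \<omega>))) \<partial>N)
      = (\<integral>\<^sup>+z. ennreal (observe \<Phi> 0 (stationary_points (fst z) (snd z))) \<partial>distr N (borel \<Otimes>\<^sub>M ?Q) (\<lambda>\<omega>. (U \<omega>, \<lambda>i. V i \<omega>)))"
    using obs by (subst nn_integral_distr[OF UVm]) simp_all
  also have "\<dots> = (\<integral>\<^sup>+u. \<integral>\<^sup>+\<omega>. ennreal (observe \<Phi> 0 (stationary_points u \<omega>)) \<partial>Rs \<partial>unif)"
  proof -
    have "(\<lambda>z. ennreal (observe \<Phi> 0 (stationary_points (fst z) (snd z)))) \<in> borel_measurable (unif \<Otimes>\<^sub>M Rs)"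
      using measurable_compose[OF obs measurable_ennreal] measurable_cong_sets[OF setsUR refl] by blast
    from Rs.nn_integral_fst[OF this] show ?thesis
      unfolding joint by simp
  qed
  finally show ?thesis
    by (simp add: stationary_mean_def)
qed

lemma (in window_functional) size_biased_eqI:
  fixes V :: "'b \<Rightarrow> 'm \<times> real"
  assumes N: "prob_space N" and V: "V \<in> measurable N borel"
    and law: "\<And>f :: 'm \<times> real \<Rightarrow> real. f \<in> borel_measurable borel \<Longrightarrow> bounded (range f) \<Longrightarrow>
      (\<integral>\<omega>. f (V \<omega>) \<partial>N) = (1 / mean) * (\<integral>z. snd z * f z \<partial>D)"
  shows "distr N borel V = size_biased"
proof (rule measure_eqI)
  interpret N: prob_space N by fact
  show "sets (distr N borel V) = sets size_biased"
    by (simp add: sets_size_biased)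
  fix A assume "A \<in> sets (distr N borel V)"
  then have A [measurable]: "A \<in> sets borel" by simp
  have int: "integrable D (\<lambda>z. snd z * indicator A z)"
    by (rule Bochner_Integration.integrable_bound[OF integrable_snd]) (auto simp: indicator_def)
  have "emeasure size_biased A = (\<integral>\<^sup>+z. ennreal (snd z / mean) * indicator A z \<partial>D)"
    unfolding size_biased_def by (rule emeasure_density) (simp_all add: sets_D)
  also have "\<dots> = (\<integral>\<^sup>+z. ennreal ((1 / mean) * (snd z * indicator A z)) \<partial>D)"
    by (intro nn_integral_cong) (auto simp: indicator_def)
  also have "\<dots> = ennreal (\<integral>z. (1 / mean) * (snd z * indicator A z) \<partial>D)"
    using int nonneg mean_gt_0 by (intro nn_integral_eq_integral) (auto simp: indicator_def)
  also have "(\<integral>z. (1 / mean) * (snd z * indicator A z) \<partial>D) = (\<integral>\<omega>. indicator A (V \<omega>) \<partial>N)"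
  proof -
    have "bounded (range (indicator A :: 'm \<times> real \<Rightarrow> real))"
      by (rule boundedI[of _ 1]) (auto simp: indicator_def)
    then show ?thesis
      using law[of "indicator A"] by simp
  qed
  also have "\<dots> = (\<integral>z. indicator A z \<partial>distr N borel V)"
    by (rule integral_distr[OF V, symmetric]) simp
  also have "ennreal \<dots> = emeasure (distr N borel V) A"
    using N.finite_measure_distr[OF V] by (simp add: finite_measure.emeasure_eq_measure)
  finally show "emeasure (distr N borel V) A = emeasure size_biased A" ..
qed

theorem theorem2p1:
  fixes P :: "'a measure" and N :: "'b measure"
    and W' :: "nat \<Rightarrow> 'a \<Rightarrow> 'm::polish_space" and X' :: "nat \<Rightarrow> 'a \<Rightarrow> real" and \<mu> :: real
    and W :: "int \<Rightarrow> 'b \<Rightarrow> 'm" and X :: "int \<Rightarrow> 'b \<Rightarrow> real"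
    and Ws :: "'b \<Rightarrow> 'm" and Xs :: "'b \<Rightarrow> real" and U :: "'b \<Rightarrow> real"
  assumes "prob_space P"
    and "prob_space.indep_vars P (\<lambda>_. borel) (\<lambda>i \<omega>. (W' i \<omega>, X' i \<omega>)) UNIV"
    and "\<And>i. i \<ge> 1 \<Longrightarrow>
      distr P borel (\<lambda>\<omega>. (W' i \<omega>, X' i \<omega>)) = distr P borel (\<lambda>\<omega>. (W' 1 \<omega>, X' 1 \<omega>))"
    and "\<And>i \<omega>. \<omega> \<in> space P \<Longrightarrow> X' i \<omega> \<ge> 0"
    and "nonarithmetic (distr P borel (X' 1))"
    and "integrable P (X' 1)" and "\<mu> = (\<integral>\<omega>. X' 1 \<omega> \<partial>P)" and "\<mu> > 0"
    and "prob_space N"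
    and "prob_space.indep_vars N (\<lambda>_. borel)
      ((\<lambda>i \<omega>. (W i \<omega>, X i \<omega>))(0 := (\<lambda>\<omega>. (Ws \<omega>, Xs \<omega>)))) UNIV"
    and "\<And>i. i \<noteq> 0 \<Longrightarrow>
      distr N borel (\<lambda>\<omega>. (W i \<omega>, X i \<omega>)) = distr P borel (\<lambda>\<omega>. (W' 1 \<omega>, X' 1 \<omega>))"
    and "\<And>i \<omega>. i \<noteq> 0 \<Longrightarrow> \<omega> \<in> space N \<Longrightarrow> X i \<omega> \<ge> 0"
    and "\<And>\<omega>. \<omega> \<in> space N \<Longrightarrow> Xs \<omega> \<ge> 0"
    and "\<And>f :: 'm \<times> real \<Rightarrow> real. f \<in> borel_measurable borel \<Longrightarrow> bounded (range f) \<Longrightarrow>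
      (\<integral>\<omega>. f (Ws \<omega>, Xs \<omega>) \<partial>N) = (1 / \<mu>) * (\<integral>\<omega>. X' 1 \<omega> * f (W' 1 \<omega>, X' 1 \<omega>) \<partial>P)"
    and "U \<in> borel_measurable N" and "distr N borel U = uniform_measure lborel {0..1}"
    and "prob_space.indep_set N
      (sets (vimage_algebra (space N) U borel))
      (sets (vimage_algebra (space N)
        (\<lambda>\<omega> i. ((\<lambda>i \<omega>. (W i \<omega>, X i \<omega>))(0 := (\<lambda>\<omega>. (Ws \<omega>, Xs \<omega>)))) i \<omega>)
        (PiM (UNIV :: int set) (\<lambda>_. borel :: ('m \<times> real) measure))))"
  shows "converges_in_distribution vague_topology
    P (\<lambda>t \<omega>. shift_measure t (delayed_renewal (\<lambda>i. W' i \<omega>) (\<lambda>i. X' i \<omega>)))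
    N (\<lambda>\<omega>. stationary_renewal (U \<omega>) (Ws \<omega>) (Xs \<omega>) (\<lambda>i. W i \<omega>) (\<lambda>i. X i \<omega>))
    at_top"
proof -
  interpret P: prob_space P by (rule assms(1))
  interpret N: prob_space N by (rule assms(9))
  define Z where "Z = (\<lambda>i \<omega>. (W' i \<omega>, X' i \<omega>))"
  define V where "V = (\<lambda>i \<omega>. (W i \<omega>, X i \<omega>))(0 := (\<lambda>\<omega>. (Ws \<omega>, Xs \<omega>)))"
  define D where "D = distr P borel (Z 1)"
  have indepP: "P.indep_vars (\<lambda>_. borel) Z UNIV"
    using assms(2) by (simp add: Z_def)
  have indepN: "N.indep_vars (\<lambda>_. borel) V UNIV"
    using assms(10) by (simp add: V_def)
  have Z [measurable]: "Z i \<in> measurable P borel" for i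
    using indepP by (auto simp: P.indep_vars_def)
  have V [measurable]: "V i \<in> measurable N borel" for i
    using indepN by (auto simp: N.indep_vars_def)
  have sndZ: "snd (Z i \<omega>) = X' i \<omega>" "fst (Z i \<omega>) = W' i \<omega>" for i \<omega>
    by (simp_all add: Z_def)
  have lawZ: "distr P borel (Z i) = D" if "i \<ge> 1" for i
    using assms(3)[OF that] by (simp add: Z_def D_def)
  have lawV: "distr N borel (V i) = D" if "i \<noteq> 0" for i
    using assms(11)[OF that] that by (simp add: V_def Z_def D_def)
  have integral_snd: "(\<integral>z. snd z \<partial>D) = \<mu>"
    unfolding D_def by (subst integral_distr) (simp_all add: sndZ assms(7))
  interpret renewal_law D
  proof (intro renewal_law.intro renewal_law_axioms.intro)
    show "prob_space D"
      unfolding D_def by (rule P.prob_space_distr) simp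
    show "sets D = sets borel"
      by (simp add: D_def)
    show "AE z in D. 0 \<le> snd z"
      unfolding D_def by (subst AE_distr_iff) (auto simp: sndZ assms(4))
    have "distr D borel snd = distr P borel (X' 1)"
      unfolding D_def by (subst distr_distr) (auto simp: comp_def sndZ)
    then show "nonarithmetic (distr D borel snd)"
      using assms(5) by simp
    show "integrable D snd"
      unfolding D_def using assms(6) by (subst integrable_distr_eq) (simp_all add: sndZ)
    show "0 < (\<integral>z. snd z \<partial>D)"
      using integral_snd assms(8) by simp
  qed
  have \<xi>: "shift_measure t (delayed_renewal (\<lambda>i. W' i \<omega>) (\<lambda>i. X' i \<omega>))
      = point_process UNIV (shift_points t (renewal_points (\<lambda>i. Z i \<omega>)))" for t \<omega>
    using shift_delayed_renewal[of t "\<lambda>i. Z i \<omega>"] by (simp add: sndZ)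
  have \<zeta>: "stationary_renewal (U \<omega>) (Ws \<omega>) (Xs \<omega>) (\<lambda>i. W i \<omega>) (\<lambda>i. X i \<omega>)
      = point_process UNIV (stationary_points (U \<omega>) (\<lambda>i. V i \<omega>))" for \<omega>
    by (rule stationary_renewal_eq) (simp_all add: V_def)
  show ?thesis
    unfolding \<xi> \<zeta>
  proof (rule converges_in_distribution_by_tents[OF assms(1,9)])
    show "(\<lambda>\<omega>. point_process UNIV (shift_points t (renewal_points (\<lambda>i. Z i \<omega>)))) \<in> measurable P (borel_algebra vague_topology)" for t
    proof (rule point_process_measurable)
      show "(\<lambda>\<omega>. shift_points t (renewal_points (\<lambda>i. Z i \<omega>)) i) \<in> measurable P borel" for i
        unfolding shift_points_def renewal_points_def fst_conv snd_conv by (intro borel_measurable_Pair) measurable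
    qed
    note [measurable] = assms(15)
    show "(\<lambda>\<omega>. point_process UNIV (stationary_points (U \<omega>) (\<lambda>i. V i \<omega>))) \<in> measurable N (borel_algebra vague_topology)"
    proof (rule point_process_measurable)
      show "(\<lambda>\<omega>. stationary_points (U \<omega>) (\<lambda>i. V i \<omega>) k) \<in> measurable N borel" for k
        unfolding stationary_points_def shift_points_def two_sided_points_def two_sided_time_def fst_conv snd_conv
        by (intro borel_measurable_Pair) measurable
    qed
    fix L :: "(rat list \<times> rat \<times> rat) list"
    obtain h C B where "window_functional D (maxl (tents vdist) L) h C B"
      using window_functional_maxl by blast
    then interpret window_functional D "maxl (tents vdist) L" h C B .
    have mean: "mean = \<mu>"
      by (simp add: mean_def integral_snd)
    have "distr N borel (V 0) = size_biased"
    proof (rule size_biased_eqI[OF assms(9) V])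
      fix f :: "'m \<times> real \<Rightarrow> real" assume f: "f \<in> borel_measurable borel" "bounded (range f)"
      note [measurable] = f(1)
      have "(\<integral>z. snd z * f z \<partial>D) = (\<integral>\<omega>. X' 1 \<omega> * f (W' 1 \<omega>, X' 1 \<omega>) \<partial>P)"
        unfolding D_def by (subst integral_distr) (simp_all add: Z_def[symmetric] sndZ, simp add: Z_def)
      then show "(\<integral>\<omega>. f (V 0 \<omega>) \<partial>N) = (1 / mean) * (\<integral>z. snd z * f z \<partial>D)"
        using assms(14)[OF f] by (simp add: V_def mean)
    qed
    from integral_stationary_family[OF assms(9) indepN lawV this assms(15,16)] assms(17)
    have N: "(\<integral>\<omega>. maxl (tents vdist) L (point_process UNIV (stationary_points (U \<omega>) (\<lambda>i. V i \<omega>))) \<partial>N) = enn2real (stationary_mean 0)"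
      by (simp add: V_def observe_def shift_points_0)
    have P: "(\<integral>\<omega>. maxl (tents vdist) L (point_process UNIV (shift_points t (renewal_points (\<lambda>i. Z i \<omega>)))) \<partial>P)
        = delayed_mean (distr P borel (Z 0)) t" for t
      using integral_renewal_family[OF assms(1) indepP lawZ, of t] by (simp add: observe_def)
    show "((\<lambda>t. \<integral>\<omega>. maxl (tents vdist) L (point_process UNIV (shift_points t (renewal_points (\<lambda>i. Z i \<omega>)))) \<partial>P)
        \<longlongrightarrow> (\<integral>\<omega>. maxl (tents vdist) L (point_process UNIV (stationary_points (U \<omega>) (\<lambda>i. V i \<omega>))) \<partial>N)) at_top"
      unfolding N P by (rule delayed_mean_tendsto_stationary_mean) (auto intro: P.prob_space_distr)
  qed
qed

end
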